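(* Let $\Lambda^\vee$ be a lattice, $J$ an integral bilinear form on $\Lambda^\vee$, $I=J+J^t$, and assume that $I^\sharp:\Lambda^\vee\to\operatorname{Hom}(\Lambda^\vee,\mathbb Z)$, $m\mapsto I(m,-)$, is an isomorphism. Let $\mathcal T\rtimes\{\pm1\}=\mathcal S(\Theta')$. Then there is an isomorphism of groups $$\pi_0\left(\mathcal Out^+(\mathcal T\rtimes\{\pm1\})\right)\cong PO(\Lambda^\vee,I),$$ where $PO(\Lambda^\vee,I)=O(\Lambda^\vee,I)/\{\pm\operatorname{id}\}$ and $O(\Lambda^\vee,I)$ is the group of automorphisms of $\Lambda^\vee$ preserving $I$.
   Context: **Crossed modules.** A crossed module $\Psi$ is a homomorphism $\psi:G_1\to G_0$, $\alpha\mapsto\underline\alpha$, with a right action of $G_0$ on $G_1$ with $\underline{\alpha^x}=x^{-1}\underline\alpha x$, $\beta^{\underline\alpha}=\alpha^{-1}\beta\alpha$; $\pi_0(\Psi)=\operatorname{coker}\psi$, $\pi_1(\Psi)=\ker\psi$. Its strict categorical group $\mathcal S(\Psi)$ is the strict monoidal groupoid with objects $G_0$, arrows $(x,\alpha):x\to x\underline\alpha$, composition by multiplication of the $\alpha$'s, monoidal structure $(x,\alpha)(y,\beta)=(xy,\alpha^y\beta)$; $\pi_0(\mathcal S(\Psi))=\pi_0(\Psi)$ is its group of isomorphism classes. **$\Theta'$.** $\mathfrak t=\Lambda^\vee\otimes\mathbb R$; $J$ extended bilinearly. $\Theta'$ is $\theta':\Lambda^\vee\times\mathbb R/\mathbb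 Z\to\mathfrak t\rtimes\{\pm1\}$, $(m,[a])\mapsto(m,1)$, where $(x,\epsilon)(y,\delta)=(x+\epsilon y,\epsilon\delta)$, with action $(m,[a])^{(x,\epsilon)}=(\epsilon m,[a+J(m,x)])$. **Weak automorphisms.** A weak endomorphism of $\Psi$ is $(p,\kappa)$ with pointed maps $p_i:G_i\to G_i$ and $\kappa:G_0\times G_0\to G_1$ satisfying: $p_0(\underline\alpha)=\underline{p_1(\alpha)}$; $p_0(x)p_0(y)\underline{\kappa_{x,y}}=p_0(xy)$; $p_1(\alpha)p_1(\beta)\kappa_{\underline\alpha,\underline\beta}=p_1(\alpha\beta)$; $\kappa_{x,y}^{p_0(z)}\kappa_{xy,z}=\kappa_{y,z}\kappa_{x,yz}$ (either side is denoted $\kappa_{x,y,z}$); $p_1(\alpha)^{p_0(x)}\kappa_{\underline\alpha,x}=p_1(\alpha^x)\kappa_{x,\underline{\alpha^x}}$. Composition: $(f,\kappa)(g,\gamma)=(f\circ g,\beta)$ with $\beta_{x,y}=f_1(\gamma_{x,y})\kappa_{g_0(x),g_0(y),\underline{\gamma_{x,y}}}$. Let $wAct^+(\Psi)_0$ be the group of those $(f,\kappa)$ with $f_0,f_1$ bijective and $f_1$ the identity on $\pi_1(\Psi)$ (centre-preserving). The group of invertible elements of the semigroup of pointed maps $\eta:G_0\to G_1$ under $(\eta_1\circ\eta_2)(x)=\eta_2(x)\eta_1(x\underline{\eta_2(x)})$ maps to it by $\delta:\eta\mapsto(f,\kappa)$, $f_0(x)=x\underline{\eta(x)}$, $f_1(\alpha)=\alpha\eta(\underline\alpha)$,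 $\kappa_{x,y}=\eta(y)^{-1}(\eta(x)^y)^{-1}\eta(xy)$; this is the structure map of a crossed module $wAct^+(\Psi)$. For $\Psi=\Theta'$ all maps $f_0,f_1,\kappa,\eta$ (and inverses) are required to be analytic. $\mathcal Aut^+(\mathcal S(\Psi))=\mathcal S(wAct^+(\Psi))$, so $\pi_0\mathcal Aut^+(\mathcal S(\Psi))=\operatorname{coker}\delta$. **Outer automorphisms.** $\mathcal Ad^+:\mathcal S(\Psi)\to\mathcal Aut^+(\mathcal S(\Psi))$ sends $x\in G_0$ to the strict automorphism $y\mapsto xyx^{-1}$, $\alpha\mapsto\alpha^{x^{-1}}$ (with $\kappa=1$) whenever this acts trivially on $\pi_1(\Psi)$, as is always the case for $\Psi=\Theta'$. $\mathcal Out^+(\mathcal S(\Psi))$ is the cokernel of $\mathcal Ad^+$; $\pi_0\mathcal Out^+(\mathcal S(\Psi))$ is the cokernel of the induced homomorphism $\pi_0\mathcal S(\Psi)\to\pi_0\mathcal Aut^+(\mathcal S(\Psi))$. *)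

theory Defs
  imports "HOL-Analysis.Analysis" "HOL-Algebra.Coset" "HOL-Algebra.Bij"
begin

section \<open>Real analytic maps\<close>

text \<open>
  Power series in the sense of normed spaces: the \<open>k\<close>-th homogeneous term is
  \<open>h \<mapsto> M\<^sub>k(h, \<dots>, h)\<close> for a bounded \<open>k\<close>-linear map \<open>M\<^sub>k\<close>, which is encoded as the restriction
  of \<open>M\<close> to the lists of length \<open>k\<close>. The bound on \<open>M\<close> makes the series converge absolutely for
  \<open>norm h < r\<close>. In finite dimension this is the usual notion given by convergent power series in
  coordinates.
\<close>

definition real_analytic_at ::
    "('a::real_normed_vector \<Rightarrow> 'b::real_normed_vector) \<Rightarrow> 'a \<Rightarrow> bool" where
  "real_analytic_at f x \<longleftrightarrow>
    (\<exists>(M :: 'a list \<Rightarrow> 'b) C r.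
       r > 0 \<and>
       (\<forall>us vs. linear (\<lambda>v. M (us @ v # vs))) \<and>
       (\<forall>vs. norm (M vs) \<le> C * (\<Prod>v\<leftarrow>vs. norm v / r)) \<and>
       (\<forall>h. norm h < r \<longrightarrow> (\<lambda>k. M (replicate k h)) sums f (x + h)))"

text \<open>
  A manifold is given by a set of local parametrisations \<open>P :: ('v \<Rightarrow> 'x) set\<close>. They are defined
  on all of the model space and need only be locally injective (as in \<open>s \<mapsto> [s]\<close>
  for \<open>\<real>/\<int>\<close>).
\<close>

definition analytic_map ::
    "('v::real_normed_vector \<Rightarrow> 'x) set \<Rightarrow> ('w::real_normed_vector \<Rightarrow> 'y) set \<Rightarrow> ('x \<Rightarrow> 'y) \<Rightarrow> bool"
  where
  "analytic_map P Q F \<longleftrightarrow>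
    (\<forall>p\<in>P. \<forall>u. \<exists>q\<in>Q. \<exists>g. \<exists>e>0.
       real_analytic_at g u \<and> (\<forall>v\<in>ball u e. F (p v) = q (g v)))"

definition prod_charts :: "('v \<Rightarrow> 'x) set \<Rightarrow> ('w \<Rightarrow> 'y) set \<Rightarrow> ('v \<times> 'w \<Rightarrow> 'x \<times> 'y) set" where
  "prod_charts P Q = {map_prod p q | p q. p \<in> P \<and> q \<in> Q}"


section \<open>Crossed modules in the analytic category\<close>

record ('g1, 'g0, 'v1, 'v0) xmod =
  G1 :: "'g1 monoid"
  G0 :: "'g0 monoid"
  bd :: "'g1 \<Rightarrow> 'g0"
  act :: "'g1 \<Rightarrow> 'g0 \<Rightarrow> 'g1"
  charts1 :: "('v1 \<Rightarrow> 'g1) set"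
  charts0 :: "('v0 \<Rightarrow> 'g0) set"

definition crossed_module :: "('g1, 'g0, 'v1, 'v0) xmod \<Rightarrow> bool" where
  "crossed_module \<Psi> \<longleftrightarrow>
     group (G1 \<Psi>) \<and> group (G0 \<Psi>) \<and> bd \<Psi> \<in> hom (G1 \<Psi>) (G0 \<Psi>) \<and>
     (\<forall>x\<in>carrier (G0 \<Psi>). (\<lambda>\<alpha>. act \<Psi> \<alpha> x) \<in> hom (G1 \<Psi>) (G1 \<Psi>)) \<and>
     (\<forall>\<alpha>\<in>carrier (G1 \<Psi>). act \<Psi> \<alpha> \<one>\<^bsub>G0 \<Psi>\<^esub> = \<alpha>) \<and>
     (\<forall>\<alpha>\<in>carrier (G1 \<Psi>). \<forall>x\<in>carrier (G0 \<Psi>). \<forall>y\<in>carrier (G0 \<Psi>).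
        act \<Psi> \<alpha> (x \<otimes>\<^bsub>G0 \<Psi>\<^esub> y) = act \<Psi> (act \<Psi> \<alpha> x) y) \<and>
     (\<forall>\<alpha>\<in>carrier (G1 \<Psi>). \<forall>x\<in>carrier (G0 \<Psi>).
        bd \<Psi> (act \<Psi> \<alpha> x) = inv\<^bsub>G0 \<Psi>\<^esub> x \<otimes>\<^bsub>G0 \<Psi>\<^esub> bd \<Psi> \<alpha> \<otimes>\<^bsub>G0 \<Psi>\<^esub> x) \<and>
     (\<forall>\<alpha>\<in>carrier (G1 \<Psi>). \<forall>\<beta>\<in>carrier (G1 \<Psi>).
        act \<Psi> \<beta> (bd \<Psi> \<alpha>) = inv\<^bsub>G1 \<Psi>\<^esub> \<alpha> \<otimes>\<^bsub>G1 \<Psi>\<^esub> \<beta> \<otimes>\<^bsub>G1 \<Psi>\<^esub> \<alpha>)"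

definition cokernel :: "'a monoid \<Rightarrow> 'b monoid \<Rightarrow> ('a \<Rightarrow> 'b) \<Rightarrow> 'b set monoid" where
  "cokernel A B h = B Mod (h ` carrier A)"

text \<open>
  \<open>xmod_pi0 \<Psi>\<close> is also \<open>\<pi>\<^sub>0\<close> of the strict categorical group of \<open>\<Psi>\<close>: its arrows with source \<open>x\<close>
  are \<open>(x, \<alpha>) : x \<rightarrow> x \<otimes> bd \<alpha>\<close>, so that its isomorphism classes of objects are the cosets of the
  normal subgroup \<open>bd ` carrier G1\<close>.
\<close>

definition xmod_pi0 :: "('g1, 'g0, 'v1, 'v0) xmod \<Rightarrow> 'g0 set monoid" where
  "xmod_pi0 \<Psi> = cokernel (G1 \<Psi>) (G0 \<Psi>) (bd \<Psi>)"

definition xmod_pi1 :: "('g1, 'g0, 'v1, 'v0) xmod \<Rightarrow> 'g1 set" where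
  "xmod_pi1 \<Psi> = kernel (G1 \<Psi>) (G0 \<Psi>) (bd \<Psi>)"


section \<open>Weak automorphisms\<close>

text \<open>
  A weak endomorphism is a triple \<open>(p0, p1, \<kappa>)\<close>, \<open>\<kappa>\<close> being a function of pairs. All functions
  are \<open>undefined\<close> outside the carriers, so that equality is equality on the carriers.
\<close>

type_synonym ('g1, 'g0) wmap = "('g0 \<Rightarrow> 'g0) \<times> ('g1 \<Rightarrow> 'g1) \<times> ('g0 \<times> 'g0 \<Rightarrow> 'g1)"

definition kappa3 ::
    "('g1, 'g0, 'v1, 'v0) xmod \<Rightarrow> ('g1, 'g0) wmap \<Rightarrow> 'g0 \<Rightarrow> 'g0 \<Rightarrow> 'g0 \<Rightarrow> 'g1" where
  "kappa3 \<Psi> = (\<lambda>(p0, p1, \<kappa>) x y z.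
     act \<Psi> (\<kappa> (x, y)) (p0 z) \<otimes>\<^bsub>G1 \<Psi>\<^esub> \<kappa> (x \<otimes>\<^bsub>G0 \<Psi>\<^esub> y, z))"

definition weak_endos :: "('g1, 'g0, 'v1, 'v0) xmod \<Rightarrow> ('g1, 'g0) wmap set" where
  "weak_endos \<Psi> = {(p0, p1, \<kappa>).
     p0 \<in> carrier (G0 \<Psi>) \<rightarrow>\<^sub>E carrier (G0 \<Psi>) \<and> p0 \<one>\<^bsub>G0 \<Psi>\<^esub> = \<one>\<^bsub>G0 \<Psi>\<^esub> \<and>
     p1 \<in> carrier (G1 \<Psi>) \<rightarrow>\<^sub>E carrier (G1 \<Psi>) \<and> p1 \<one>\<^bsub>G1 \<Psi>\<^esub> = \<one>\<^bsub>G1 \<Psi>\<^esub> \<and>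
     \<kappa> \<in> carrier (G0 \<Psi>) \<times> carrier (G0 \<Psi>) \<rightarrow>\<^sub>E carrier (G1 \<Psi>) \<and>
     (\<forall>\<alpha>\<in>carrier (G1 \<Psi>). p0 (bd \<Psi> \<alpha>) = bd \<Psi> (p1 \<alpha>)) \<and>
     (\<forall>x\<in>carrier (G0 \<Psi>). \<forall>y\<in>carrier (G0 \<Psi>).
        p0 x \<otimes>\<^bsub>G0 \<Psi>\<^esub> p0 y \<otimes>\<^bsub>G0 \<Psi>\<^esub> bd \<Psi> (\<kappa> (x, y)) = p0 (x \<otimes>\<^bsub>G0 \<Psi>\<^esub> y)) \<and>
     (\<forall>\<alpha>\<in>carrier (G1 \<Psi>). \<forall>\<beta>\<in>carrier (G1 \<Psi>).
        p1 \<alpha> \<otimes>\<^bsub>G1 \<Psi>\<^esub> p1 \<beta> \<otimes>\<^bsub>G1 \<Psi>\<^esub> \<kappa> (bd \<Psi> \<alpha>, bd \<Psi> \<beta>) = p1 (\<alpha> \<otimes>\<^bsub>G1 \<Psi>\<^esub> \<beta>)) \<and>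
     (\<forall>x\<in>carrier (G0 \<Psi>). \<forall>y\<in>carrier (G0 \<Psi>). \<forall>z\<in>carrier (G0 \<Psi>).
        kappa3 \<Psi> (p0, p1, \<kappa>) x y z = \<kappa> (y, z) \<otimes>\<^bsub>G1 \<Psi>\<^esub> \<kappa> (x, y \<otimes>\<^bsub>G0 \<Psi>\<^esub> z)) \<and>
     (\<forall>\<alpha>\<in>carrier (G1 \<Psi>). \<forall>x\<in>carrier (G0 \<Psi>).
        act \<Psi> (p1 \<alpha>) (p0 x) \<otimes>\<^bsub>G1 \<Psi>\<^esub> \<kappa> (bd \<Psi> \<alpha>, x) =
        p1 (act \<Psi> \<alpha> x) \<otimes>\<^bsub>G1 \<Psi>\<^esub> \<kappa> (x, bd \<Psi> (act \<Psi> \<alpha> x)))}"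

definition weak_comp ::
    "('g1, 'g0, 'v1, 'v0) xmod \<Rightarrow> ('g1, 'g0) wmap \<Rightarrow> ('g1, 'g0) wmap \<Rightarrow> ('g1, 'g0) wmap" where
  "weak_comp \<Psi> = (\<lambda>(f0, f1, \<kappa>) (g0, g1, \<gamma>).
     (compose (carrier (G0 \<Psi>)) f0 g0,
      compose (carrier (G1 \<Psi>)) f1 g1,
      \<lambda>(x, y)\<in>carrier (G0 \<Psi>) \<times> carrier (G0 \<Psi>).
        f1 (\<gamma> (x, y)) \<otimes>\<^bsub>G1 \<Psi>\<^esub> kappa3 \<Psi> (f0, f1, \<kappa>) (g0 x) (g0 y) (bd \<Psi> (\<gamma> (x, y)))))"

definition wAct_plus0 ::
    "('g1, 'g0, 'v1::real_normed_vector, 'v0::real_normed_vector) xmod \<Rightarrow> ('g1, 'g0) wmap monoid"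
  where
  "wAct_plus0 \<Psi> = \<lparr>
     carrier = {(f0, f1, \<kappa>) \<in> weak_endos \<Psi>.
       bij_betw f0 (carrier (G0 \<Psi>)) (carrier (G0 \<Psi>)) \<and>
       bij_betw f1 (carrier (G1 \<Psi>)) (carrier (G1 \<Psi>)) \<and>
       (\<forall>\<alpha>\<in>xmod_pi1 \<Psi>. f1 \<alpha> = \<alpha>) \<and>
       analytic_map (charts0 \<Psi>) (charts0 \<Psi>) f0 \<and>
       analytic_map (charts0 \<Psi>) (charts0 \<Psi>) (inv_into (carrier (G0 \<Psi>)) f0) \<and>
       analytic_map (charts1 \<Psi>) (charts1 \<Psi>) f1 \<and>
       analytic_map (charts1 \<Psi>) (charts1 \<Psi>) (inv_into (carrier (G1 \<Psi>)) f1) \<and>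
       analytic_map (prod_charts (charts0 \<Psi>) (charts0 \<Psi>)) (charts1 \<Psi>) \<kappa>},
     monoid.mult = weak_comp \<Psi>,
     one = (\<lambda>x\<in>carrier (G0 \<Psi>). x, \<lambda>\<alpha>\<in>carrier (G1 \<Psi>). \<alpha>,
            \<lambda>_\<in>carrier (G0 \<Psi>) \<times> carrier (G0 \<Psi>). \<one>\<^bsub>G1 \<Psi>\<^esub>)\<rparr>"

definition pointed_maps ::
    "('g1, 'g0, 'v1::real_normed_vector, 'v0::real_normed_vector) xmod \<Rightarrow> ('g0 \<Rightarrow> 'g1) monoid"
  where
  "pointed_maps \<Psi> = \<lparr>
     carrier = {\<eta> \<in> carrier (G0 \<Psi>) \<rightarrow>\<^sub>E carrier (G1 \<Psi>).
       \<eta> \<one>\<^bsub>G0 \<Psi>\<^esub> = \<one>\<^bsub>G1 \<Psi>\<^esub> \<and> analytic_map (charts0 \<Psi>) (charts1 \<Psi>) \<eta>},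
     monoid.mult = (\<lambda>\<eta>1 \<eta>2. \<lambda>x\<in>carrier (G0 \<Psi>).
       \<eta>2 x \<otimes>\<^bsub>G1 \<Psi>\<^esub> \<eta>1 (x \<otimes>\<^bsub>G0 \<Psi>\<^esub> bd \<Psi> (\<eta>2 x))),
     one = (\<lambda>x\<in>carrier (G0 \<Psi>). \<one>\<^bsub>G1 \<Psi>\<^esub>)\<rparr>"

text \<open>As the units are taken inside the analytic pointed maps, the inverse of \<open>\<eta>\<close> is analytic too.\<close>

definition wAct_plus1 ::
    "('g1, 'g0, 'v1::real_normed_vector, 'v0::real_normed_vector) xmod \<Rightarrow> ('g0 \<Rightarrow> 'g1) monoid"
  where
  "wAct_plus1 \<Psi> = units_of (pointed_maps \<Psi>)"

definition wAct_delta :: "('g1, 'g0, 'v1, 'v0) xmod \<Rightarrow> ('g0 \<Rightarrow> 'g1) \<Rightarrow> ('g1, 'g0) wmap" where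
  "wAct_delta \<Psi> \<eta> =
     (\<lambda>x\<in>carrier (G0 \<Psi>). x \<otimes>\<^bsub>G0 \<Psi>\<^esub> bd \<Psi> (\<eta> x),
      \<lambda>\<alpha>\<in>carrier (G1 \<Psi>). \<alpha> \<otimes>\<^bsub>G1 \<Psi>\<^esub> \<eta> (bd \<Psi> \<alpha>),
      \<lambda>(x, y)\<in>carrier (G0 \<Psi>) \<times> carrier (G0 \<Psi>).
        inv\<^bsub>G1 \<Psi>\<^esub> (\<eta> y) \<otimes>\<^bsub>G1 \<Psi>\<^esub> inv\<^bsub>G1 \<Psi>\<^esub> (act \<Psi> (\<eta> x) y) \<otimes>\<^bsub>G1 \<Psi>\<^esub> \<eta> (x \<otimes>\<^bsub>G0 \<Psi>\<^esub> y))"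

definition pi0_Aut_plus ::
    "('g1, 'g0, 'v1::real_normed_vector, 'v0::real_normed_vector) xmod \<Rightarrow> ('g1, 'g0) wmap set monoid"
  where
  "pi0_Aut_plus \<Psi> = cokernel (wAct_plus1 \<Psi>) (wAct_plus0 \<Psi>) (wAct_delta \<Psi>)"


section \<open>Outer automorphisms\<close>

text \<open>
  \<open>Ad_plus \<Psi>\<close> is centre preserving if the action of \<open>G0 \<Psi>\<close> on \<open>xmod_pi1 \<Psi>\<close> is trivial; only such
  \<open>\<Psi>\<close> are considered.
\<close>

definition Ad_plus :: "('g1, 'g0, 'v1, 'v0) xmod \<Rightarrow> 'g0 \<Rightarrow> ('g1, 'g0) wmap" where
  "Ad_plus \<Psi> x =
     (\<lambda>y\<in>carrier (G0 \<Psi>). x \<otimes>\<^bsub>G0 \<Psi>\<^esub> y \<otimes>\<^bsub>G0 \<Psi>\<^esub> inv\<^bsub>G0 \<Psi>\<^esub> x,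
      \<lambda>\<alpha>\<in>carrier (G1 \<Psi>). act \<Psi> \<alpha> (inv\<^bsub>G0 \<Psi>\<^esub> x),
      \<lambda>_\<in>carrier (G0 \<Psi>) \<times> carrier (G0 \<Psi>). \<one>\<^bsub>G1 \<Psi>\<^esub>)"

definition pi0_Ad_plus ::
    "('g1, 'g0, 'v1::real_normed_vector, 'v0::real_normed_vector) xmod \<Rightarrow>
      'g0 set \<Rightarrow> ('g1, 'g0) wmap set" where
  "pi0_Ad_plus \<Psi> C = the_elem
     ((\<lambda>x. (wAct_delta \<Psi> ` carrier (wAct_plus1 \<Psi>)) #>\<^bsub>wAct_plus0 \<Psi>\<^esub> Ad_plus \<Psi> x) ` C)"

definition pi0_Out_plus ::
    "('g1, 'g0, 'v1::real_normed_vector, 'v0::real_normed_vector) xmod \<Rightarrow>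
      ('g1, 'g0) wmap set set monoid" where
  "pi0_Out_plus \<Psi> = cokernel (xmod_pi0 \<Psi>) (pi0_Aut_plus \<Psi>) (pi0_Ad_plus \<Psi>)"


section \<open>Lattices and orthogonal groups\<close>

text \<open>
  A lattice \<open>\<Lambda>\<close> is given inside its real span \<open>\<Lambda> \<otimes> \<real>\<close>, which is the whole type. The zero lattice
  is included. An integral bilinear form on \<open>\<Lambda>\<close> is given by its real bilinear extension to
  \<open>\<Lambda> \<otimes> \<real>\<close>, that is, by a real bilinear form with integer values on \<open>\<Lambda>\<close>. A norm, where one is
  required, only serves to define analyticity; all norms are equivalent here.
\<close>

definition full_lattice :: "'t::real_vector set \<Rightarrow> bool" where
  "full_lattice L \<longleftrightarrow>
    (\<exists>B. finite B \<and> independent B \<and> span B = UNIV \<and>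
         L = range (\<lambda>c :: 't \<Rightarrow> int. \<Sum>b\<in>B. of_int (c b) *\<^sub>R b))"

definition lattice_group :: "'t::real_vector set \<Rightarrow> 't monoid" where
  "lattice_group L = \<lparr>carrier = L, monoid.mult = (+), one = 0\<rparr>"

definition dual_lattice_group :: "'t::real_vector set \<Rightarrow> ('t \<Rightarrow> real) monoid" where
  "dual_lattice_group L = \<lparr>
     carrier = {\<phi> \<in> L \<rightarrow>\<^sub>E \<int>. \<forall>m\<in>L. \<forall>n\<in>L. \<phi> (m + n) = \<phi> m + \<phi> n},
     monoid.mult = (\<lambda>\<phi> \<psi>. \<lambda>m\<in>L. \<phi> m + \<psi> m),
     one = (\<lambda>m\<in>L. 0)\<rparr>"

definition symmetrization :: "('t \<Rightarrow> 't \<Rightarrow> real) \<Rightarrow> 't \<Rightarrow> 't \<Rightarrow> real" where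
  "symmetrization J m n = J m n + J n m"

definition orthogonal_lattice_group ::
    "'t::real_vector set \<Rightarrow> ('t \<Rightarrow> 't \<Rightarrow> real) \<Rightarrow> ('t \<Rightarrow> 't) monoid" where
  "orthogonal_lattice_group L I = AutoGroup (lattice_group L)
     \<lparr>carrier := {g \<in> auto (lattice_group L). \<forall>m\<in>L. \<forall>n\<in>L. I (g m) (g n) = I m n}\<rparr>"

definition projective_orthogonal_lattice_group ::
    "'t::real_vector set \<Rightarrow> ('t \<Rightarrow> 't \<Rightarrow> real) \<Rightarrow> ('t \<Rightarrow> 't) set monoid" where
  "projective_orthogonal_lattice_group L I =
     orthogonal_lattice_group L I Mod {\<lambda>m\<in>L. m, \<lambda>m\<in>L. - m}"


section \<open>The crossed module \<open>\<Theta>'\<close>\<close>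

quotient_type circle = real / "\<lambda>x y :: real. x - y \<in> \<int>"
  morphisms rep_circle circle_of
proof (rule equivpI)
  show "symp (\<lambda>x y :: real. x - y \<in> \<int>)"
    by (auto intro!: sympI) (metis Ints_minus minus_diff_eq)
  show "transp (\<lambda>x y :: real. x - y \<in> \<int>)"
    by (auto intro!: transpI) (metis Ints_add diff_add_cancel add_diff_eq)
qed (auto intro!: reflpI)

instantiation circle :: ab_group_add
begin

lift_definition zero_circle :: circle is 0 .

lift_definition plus_circle :: "circle \<Rightarrow> circle \<Rightarrow> circle" is "(+)"
  by (metis Ints_add add_diff_add)

lift_definition uminus_circle :: "circle \<Rightarrow> circle" is uminus
  by (metis Ints_minus minus_diff_minus)

lift_definition minus_circle :: "circle \<Rightarrow> circle \<Rightarrow> circle" is "(-)"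
  by (metis Ints_diff diff_diff_eq2 diff_diff_eq add_diff_eq diff_add_eq)

instance
  by standard (transfer; simp)+

end

definition circle_group :: "circle monoid" where
  "circle_group = \<lparr>carrier = UNIV, monoid.mult = (+), one = 0\<rparr>"

definition semidirect_sign_group :: "('t::real_vector \<times> int) monoid" where
  "semidirect_sign_group = \<lparr>
     carrier = UNIV \<times> {1, -1},
     monoid.mult = (\<lambda>(x, \<epsilon>) (y, \<delta>). (x + of_int \<epsilon> *\<^sub>R y, \<epsilon> * \<delta>)),
     one = (0, 1)\<rparr>"

definition Theta' ::
    "'t::real_normed_vector set \<Rightarrow> ('t \<Rightarrow> 't \<Rightarrow> real) \<Rightarrow> ('t \<times> circle, 't \<times> int, real, 't) xmod"
  where
  "Theta' L J = \<lparr>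
     G1 = lattice_group L \<times>\<times> circle_group,
     G0 = semidirect_sign_group,
     bd = (\<lambda>(m, a). (m, 1)),
     act = (\<lambda>(m, a) (x, \<epsilon>). (of_int \<epsilon> *\<^sub>R m, a + circle_of (J m x))),
     charts1 = {\<lambda>s. (m, circle_of s) | m. m \<in> L},
     charts0 = {\<lambda>x. (x, \<epsilon>) | \<epsilon>. \<epsilon> \<in> {1, -1}}\<rparr>"

lemma circle_of_eq_iff: "circle_of s = circle_of t \<longleftrightarrow> s - t \<in> \<int>"
  by (rule circle.abs_eq_iff)

lemma circle_of_add: "circle_of (s + t) = circle_of s + circle_of t"
  by (simp add: plus_circle.abs_eq)

lemma circle_of_Ints: "s \<in> \<int> \<Longrightarrow> circle_of s = 0"
  by (simp add: zero_circle_def circle_of_eq_iff)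

lemma full_latticeD:
  assumes "full_lattice L"
  shows "0 \<in> L" "m \<in> L \<Longrightarrow> n \<in> L \<Longrightarrow> m + n \<in> L" "m \<in> L \<Longrightarrow> - m \<in> L"
proof -
  obtain B where B: "finite B" "L = range (\<lambda>c :: 'a \<Rightarrow> int. \<Sum>b\<in>B. of_int (c b) *\<^sub>R b)"
    using assms by (auto simp: full_lattice_def)
  show "0 \<in> L"
    unfolding B(2) by (rule range_eqI[of _ _ "\<lambda>_. 0"]) simp
  show "m + n \<in> L" if mn: "m \<in> L" "n \<in> L"
  proof -
    obtain c d :: "'a \<Rightarrow> int" where
      "m = (\<Sum>b\<in>B. of_int (c b) *\<^sub>R b)" "n = (\<Sum>b\<in>B. of_int (d b) *\<^sub>R b)"
      using mn unfolding B(2) by blast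
    then show ?thesis
      unfolding B(2)
      by (intro range_eqI[of _ _ "\<lambda>b. c b + d b"]) (simp add: scaleR_add_left sum.distrib)
  qed
  show "- m \<in> L" if "m \<in> L"
  proof -
    obtain c :: "'a \<Rightarrow> int" where "m = (\<Sum>b\<in>B. of_int (c b) *\<^sub>R b)"
      using \<open>m \<in> L\<close> unfolding B(2) by blast
    then show ?thesis
      unfolding B(2)
      by (intro range_eqI[of _ _ "\<lambda>b. - c b"]) (simp add: sum_negf)
  qed
qed

lemma group_lattice_group: "full_lattice L \<Longrightarrow> group (lattice_group L)"
  by (rule groupI)
     (auto simp: lattice_group_def full_latticeD intro!: bexI[of _ "- x" for x])

lemma group_circle_group: "group circle_group"
proof (rule groupI)
  fix a assume "a \<in> carrier circle_group"
  show "\<exists>b\<in>carrier circle_group. b \<otimes>\<^bsub>circle_group\<^esub> a = \<one>\<^bsub>circle_group\<^esub>"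
    by (rule bexI[of _ "- a"]) (simp_all add: circle_group_def)
qed (simp_all add: circle_group_def add.assoc)

lemma group_semidirect_sign_group: "group semidirect_sign_group"
proof (rule groupI)
  fix a :: "'a \<times> int" assume "a \<in> carrier semidirect_sign_group"
  then show "\<exists>b\<in>carrier semidirect_sign_group.
      b \<otimes>\<^bsub>semidirect_sign_group\<^esub> a = \<one>\<^bsub>semidirect_sign_group\<^esub>"
    by (intro bexI[of _ "(- (of_int (snd a) *\<^sub>R fst a), snd a)"])
       (auto simp: semidirect_sign_group_def)
qed (auto simp: semidirect_sign_group_def scaleR_add_right add.assoc)

lemma inv_semidirect_sign_group:
  "\<epsilon> \<in> {1, -1} \<Longrightarrow> inv\<^bsub>semidirect_sign_group\<^esub> (x, \<epsilon>) = (- (of_int \<epsilon> *\<^sub>R x), \<epsilon>)"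
  by (rule group.inv_equality[OF group_semidirect_sign_group])
     (auto simp: semidirect_sign_group_def)

lemma crossed_module_Theta':
  assumes L: "full_lattice L" and J: "bilinear J"
    and int: "\<And>m n. m \<in> L \<Longrightarrow> n \<in> L \<Longrightarrow> J m n \<in> \<int>"
  shows "crossed_module (Theta' L J)"
proof -
  note defs = Theta'_def lattice_group_def circle_group_def semidirect_sign_group_def
  note Ld = full_latticeD[OF L]
  have grp: "group (lattice_group L \<times>\<times> circle_group)"
    by (intro DirProd_group group_lattice_group group_circle_group L)
  have inv1: "inv\<^bsub>lattice_group L \<times>\<times> circle_group\<^esub> (m, a) = (- m, - a)" if "m \<in> L" for m a
    using that
    by (intro group.inv_equality[OF grp]) (auto simp: lattice_group_def circle_group_def Ld)
  show ?thesis
    unfolding crossed_module_def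
  proof (intro conjI ballI)
    fix \<alpha> \<beta> assume "\<alpha> \<in> carrier (G1 (Theta' L J))" "\<beta> \<in> carrier (G1 (Theta' L J))"
    then obtain m a n b where ab: "\<alpha> = (m, a)" "\<beta> = (n, b)" "m \<in> L" "n \<in> L"
      by (auto simp: defs)
    have "inv\<^bsub>G1 (Theta' L J)\<^esub> \<alpha> = (- m, - a)"
      using inv1 ab by (simp add: Theta'_def)
    then show "act (Theta' L J) \<beta> (bd (Theta' L J) \<alpha>) =
        inv\<^bsub>G1 (Theta' L J)\<^esub> \<alpha> \<otimes>\<^bsub>G1 (Theta' L J)\<^esub> \<beta> \<otimes>\<^bsub>G1 (Theta' L J)\<^esub> \<alpha>"
      by (simp add: defs ab circle_of_Ints int)
  next
    fix \<alpha> and x :: "'a \<times> int"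
    assume "\<alpha> \<in> carrier (G1 (Theta' L J))" "x \<in> carrier (G0 (Theta' L J))"
    then obtain m a y \<epsilon> where ab: "\<alpha> = (m, a)" "x = (y, \<epsilon>)" "m \<in> L" "\<epsilon> \<in> {1, -1}"
      by (auto simp: defs)
    have "inv\<^bsub>G0 (Theta' L J)\<^esub> x = (- (of_int \<epsilon> *\<^sub>R y), \<epsilon>)"
      using inv_semidirect_sign_group ab by (simp add: Theta'_def)
    then show "bd (Theta' L J) (act (Theta' L J) \<alpha> x) =
        inv\<^bsub>G0 (Theta' L J)\<^esub> x \<otimes>\<^bsub>G0 (Theta' L J)\<^esub> bd (Theta' L J) \<alpha> \<otimes>\<^bsub>G0 (Theta' L J)\<^esub> x"
      using ab by (auto simp: defs)
  next
    show "group (G1 (Theta' L J))" using grp by (simp add: Theta'_def)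
    show "group (G0 (Theta' L J))" by (simp add: Theta'_def group_semidirect_sign_group)
  qed (use J in \<open>auto simp: defs hom_def Ld bilinear_ladd bilinear_radd bilinear_lneg
        bilinear_rneg bilinear_rsub bilinear_rzero circle_of_add[symmetric] circle_of_Ints add.assoc scaleR_add_right\<close>)
qed

lemma Theta'_act_trivial_on_pi1:
  assumes "bilinear J" "\<alpha> \<in> xmod_pi1 (Theta' L J)" "x \<in> carrier (G0 (Theta' L J))"
  shows "act (Theta' L J) \<alpha> x = \<alpha>"
  using assms
  by (auto simp: xmod_pi1_def kernel_def Theta'_def semidirect_sign_group_def
      bilinear_lzero circle_of_Ints)

end

theory Submission
  imports Defs
begin

text \<open>
  Continuity forces a centre preserving weak automorphism of \<open>\<Theta>'\<close> to consist of a linear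
  automorphism \<open>g\<close> of the lattice, a translation \<open>v\<close> of the component of \<open>-1\<close>, a circle valued
  2-cocycle \<open>k\<close> on the semidirect product of the vector space with \<open>{1, -1}\<close> and a cochain
  \<open>\<phi>\<close> on \<open>L\<close> that trivialises \<open>k\<close> there. The last axiom for weak maps identifies \<open>J \<circ> g - J\<close> with a commutator
  of \<open>k\<close>, which is alternating, so \<open>g\<close> preserves \<open>I\<close>. Conversely, for \<open>g\<close> orthogonal the
  alternating form \<open>J \<circ> g - J\<close> is \<open>C - C\<^sup>t\<close> with \<open>C\<close> integral, and \<open>C\<close> provides a cocycle.

  Suppose \<open>g = id\<close>. Conjugation by \<open>-v/2\<close> makes \<open>v = 0\<close>. Then \<open>k\<close> is symmetric on the identity
  component, hence a coboundary there, and modulo coboundaries only a linear functional \<open>\<Lambda>\<close> on the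
  other component and a character of order two of \<open>L\<close> remain. As \<open>I\<close> is unimodular, that
  character is \<open>I(l, -)/2\<close> for some \<open>l \<in> L\<close>, which is the class of conjugation by \<open>l/2\<close>. Together
  with conjugation by \<open>(0, -1)\<close>, which has \<open>g = -id\<close>, this shows that the kernel of
  \<open>\<pi>\<^sub>0 Aut \<rightarrow> PO\<close> consists of the inner classes.
\<close>

section \<open>Power series in normed spaces\<close>

text \<open>Two obstacles shape the proof. Values lie in \<open>\<real>/\<int>\<close>, where
  halving is ambiguous and bilinear forms cannot be compared. As the vector space is contractible,
  circle valued cochains on its components have global real lifts; a relation between them holds up
  to a continuous integer valued function, which is constant and can be evaluated at the origin.
  This does not reach the cochain \<open>\<phi>\<close>, whose argument runs over the discrete set
  \<open>L\<close>, and that is where a character of order two survives. The second obstacle is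
  regularity: the function trivialising a symmetric cocycle has to be analytic, since only analytic
  functions give pointed maps \<open>\<eta>\<close>. Two constants: a translation by
  \<open>w\<close> and the element \<open>-1\<close> have commutator \<open>2w\<close>, which
  explains the halves in the conjugating elements. And \<open>(J \<circ> g - J)/2\<close> also
  solves the equation for \<open>C\<close>, but its values on \<open>L\<close> are only half
  integers, so the cocycle would not vanish on \<open>L\<close>; a triangular part of the form is
  used instead.\<close>

lemma prod_list_norm_divide:
  fixes vs :: "'a::real_normed_vector list" and c :: real
  shows "(\<Prod>v\<leftarrow>vs. norm v / c) = (\<Prod>v\<leftarrow>vs. norm v) / c ^ length vs"
  by (induction vs) (auto simp: field_simps)

lemma prod_list_norm_nonneg: "0 \<le> (\<Prod>v\<leftarrow>vs. norm v)"
  by (induction vs) auto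

lemma prod_list_norm_divide_antimono:
  fixes vs :: "'a::real_normed_vector list"
  assumes "0 < s" "s \<le> r"
  shows "(\<Prod>v\<leftarrow>vs. norm v / r) \<le> (\<Prod>v\<leftarrow>vs. norm v / s)"
  unfolding prod_list_norm_divide using assms
  by (intro divide_left_mono prod_list_norm_nonneg power_mono) auto

text \<open>Names the witnesses that \<open>real_analytic_at\<close> hides under quantifiers, so
  that radius and bound can be changed and estimated.\<close>

definition power_series_at ::
    "('a::real_normed_vector list \<Rightarrow> 'b::real_normed_vector) \<Rightarrow> real \<Rightarrow> real \<Rightarrow> ('a \<Rightarrow> 'b) \<Rightarrow> 'a \<Rightarrow> bool" where
  "power_series_at M C r f x \<longleftrightarrow>
       r > 0 \<and> (\<forall>us vs. linear (\<lambda>v. M (us @ v # vs))) \<and>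
       (\<forall>vs. norm (M vs) \<le> C * (\<Prod>v\<leftarrow>vs. norm v / r)) \<and>
       (\<forall>h. norm h < r \<longrightarrow> (\<lambda>k. M (replicate k h)) sums f (x + h))"

lemma real_analytic_at_power_series:
  "real_analytic_at f x \<longleftrightarrow> (\<exists>M C r. power_series_at M C r f x)"
  by (simp add: real_analytic_at_def power_series_at_def)

lemma power_series_at_pos: "power_series_at M C r f x \<Longrightarrow> r > 0"
  by (simp add: power_series_at_def)

lemma power_series_at_bound_nonneg:
  fixes f :: "'a::real_normed_vector \<Rightarrow> 'b::real_normed_vector"
  assumes "power_series_at M C r f x"
  shows "0 \<le> C"
proof -
  have "norm (M []) \<le> C * (\<Prod>v\<leftarrow>([] :: 'a list). norm v / r)"
    using assms unfolding power_series_at_def by blast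
  then show ?thesis
    using norm_ge_zero[of "M []"] by (simp del: norm_ge_zero add: order.trans)
qed

text \<open>Two expansions can be added only on a common radius. Decreasing \<open>r\<close> merely
  enlarges the factors \<open>norm v / r\<close> of the bound.\<close>

lemma power_series_at_shrink:
  assumes "power_series_at M C r f x" "0 < s" "s \<le> r" "C \<le> D"
  shows "power_series_at M D s f x"
proof -
  have "norm (M vs) \<le> D * (\<Prod>v\<leftarrow>vs. norm v / s)" for vs
  proof -
    have "norm (M vs) \<le> C * (\<Prod>v\<leftarrow>vs. norm v / r)"
      using assms(1) by (simp add: power_series_at_def)
    also have "\<dots> \<le> D * (\<Prod>v\<leftarrow>vs. norm v / s)"
      using assms power_series_at_bound_nonneg[OF assms(1)] prod_list_norm_nonneg[of vs]
      by (intro mult_mono prod_list_norm_divide_antimono)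
         (auto simp: prod_list_norm_divide)
    finally show ?thesis .
  qed
  then show ?thesis
    using assms by (auto simp: power_series_at_def)
qed

lemma real_analytic_at_cong:
  assumes "real_analytic_at f x" "\<forall>\<^sub>F y in nhds x. f y = g y"
  shows "real_analytic_at g x"
proof -
  obtain M C r where M: "power_series_at M C r f x"
    using assms(1) by (auto simp: real_analytic_at_power_series)
  obtain e where e: "e > 0" "\<And>y. dist y x < e \<Longrightarrow> f y = g y"
    using assms(2) by (auto simp: eventually_nhds_metric)
  have "power_series_at M C (min r e) f x"
    using M e(1) by (intro power_series_at_shrink[OF M]) (auto simp: power_series_at_def)
  moreover have "f (x + h) = g (x + h)" if "norm h < min r e" for h
    using that by (intro e(2)) (simp add: dist_norm)
  ultimately have "power_series_at M C (min r e) g x"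
    by (simp add: power_series_at_def)
  then show ?thesis
    by (auto simp: real_analytic_at_power_series)
qed

lemma real_analytic_at_add:
  assumes "real_analytic_at f x" "real_analytic_at g x"
  shows "real_analytic_at (\<lambda>y. f y + g y) x"
proof -
  obtain M C r N D s where MN: "power_series_at M C r f x" "power_series_at N D s g x"
    using assms by (auto simp: real_analytic_at_power_series)
  have t: "power_series_at M C (min r s) f x" "power_series_at N D (min r s) g x"
    using power_series_at_shrink[OF MN(1) _ _ order_refl, of "min r s"]
      power_series_at_shrink[OF MN(2) _ _ order_refl, of "min r s"]
      power_series_at_pos[OF MN(1)] power_series_at_pos[OF MN(2)] by simp_all
  have "power_series_at (\<lambda>vs. M vs + N vs) (C + D) (min r s) (\<lambda>y. f y + g y) x"
    using t unfolding power_series_at_def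
    by (auto intro!: linear_compose_add sums_add simp: distrib_right
        intro: order.trans[OF norm_triangle_ineq add_mono] simp del: min_less_iff_conj)
  then show ?thesis
    by (auto simp: real_analytic_at_power_series)
qed

lemma real_analytic_at_scaleR:
  assumes "real_analytic_at f x"
  shows "real_analytic_at (\<lambda>y. c *\<^sub>R f y) x"
proof -
  obtain M C r where M: "power_series_at M C r f x"
    using assms by (auto simp: real_analytic_at_power_series)
  then have "power_series_at (\<lambda>vs. c *\<^sub>R M vs) (\<bar>c\<bar> * C) r (\<lambda>y. c *\<^sub>R f y) x"
    unfolding power_series_at_def
    by (auto intro!: linear_compose_scale_right sums_scaleR_right mult_left_mono
        simp: mult.assoc)
  then show ?thesis
    by (auto simp: real_analytic_at_power_series)
qed

lemma real_analytic_at_minus: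
  assumes "real_analytic_at f x"
  shows "real_analytic_at (\<lambda>y. - f y) x"
  using real_analytic_at_scaleR[OF assms, of "- 1"] by simp

text \<open>The linear part is applied to every entry of the list, and its operator bound
  \<open>K\<close> divides the radius. All substitutions of the proof are affine: translations,
  linear maps, and the group law on a fixed pair of components.\<close>

lemma real_analytic_at_compose_affine:
  fixes f :: "'b::real_normed_vector \<Rightarrow> 'c::real_normed_vector"
    and A :: "'a::real_normed_vector \<Rightarrow> 'b"
  assumes f: "real_analytic_at f y" and A: "bounded_linear A"
    and g: "\<And>z. g z = A (z - x) + y"
  shows "real_analytic_at (\<lambda>z. f (g z)) x"
proof -
  interpret A: bounded_linear A by fact
  obtain M C r where M: "power_series_at M C r f y"
    using f by (auto simp: real_analytic_at_power_series)
  obtain K where K: "K > 0" "\<And>v. norm (A v) \<le> norm v * K"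
    using A.pos_bounded by auto
  have r: "r > 0" using M by (simp add: power_series_at_def)
  have prod: "(\<Prod>v\<leftarrow>map A vs. norm v) \<le> (\<Prod>v\<leftarrow>vs. norm v) * K ^ length vs" for vs
  proof (induction vs)
    case (Cons v vs)
    have "norm (A v) * (\<Prod>v\<leftarrow>map A vs. norm v) \<le>
        (norm v * K) * ((\<Prod>v\<leftarrow>vs. norm v) * K ^ length vs)"
      using Cons K by (intro mult_mono prod_list_norm_nonneg) auto
    then show ?case by (simp add: mult_ac)
  qed simp
  have "power_series_at (\<lambda>vs. M (map A vs)) C (r / K) (\<lambda>z. f (g z)) x"
    unfolding power_series_at_def
  proof (intro conjI allI impI)
    show "r / K > 0" using r K by simp
    fix us vs :: "'a list"
    have "linear (\<lambda>v. M (map A us @ v # map A vs))"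
      using M unfolding power_series_at_def by blast
    from linear_compose[OF A.linear this]
    show "linear (\<lambda>v. M (map A (us @ v # vs)))" by (simp add: o_def)
  next
    fix vs :: "'a list"
    have "norm (M (map A vs)) \<le> C * (\<Prod>v\<leftarrow>map A vs. norm v / r)"
      using M unfolding power_series_at_def by blast
    also have "\<dots> \<le> C * (\<Prod>v\<leftarrow>vs. norm v / (r / K))"
      using prod[of vs] r K power_series_at_bound_nonneg[OF M] unfolding prod_list_norm_divide
      by (intro mult_left_mono) (auto simp: field_simps power_divide)
    finally show "norm (M (map A vs)) \<le> C * (\<Prod>v\<leftarrow>vs. norm v / (r / K))" .
  next
    fix h :: 'a assume "norm h < r / K"
    then have "norm (A h) < r"
      using K(2)[of h] K(1) by (simp add: field_simps)
    then have "(\<lambda>k. M (replicate k (A h))) sums f (y + A h)"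
      using M by (simp add: power_series_at_def)
    then show "(\<lambda>k. M (map A (replicate k h))) sums f (g (x + h))"
      by (simp add: g add.commute)
  qed
  then show ?thesis
    by (auto simp: real_analytic_at_power_series)
qed

text \<open>Covers the analytic functions given by formulas below, which are affine or bilinear. The
  three cases of \<open>M\<close> are the homogeneous terms of degree 0, 1 and 2.\<close>

lemma real_analytic_at_quadratic:
  fixes f :: "'a::real_normed_vector \<Rightarrow> 'b::real_normed_vector"
  assumes l: "bounded_linear l" and b: "bounded_bilinear b"
    and f: "\<And>h. f (x + h) = a + l h + b h h"
  shows "real_analytic_at f x"
proof -
  interpret l: bounded_linear l by fact
  interpret b: bounded_bilinear b by fact
  obtain K1 where K1: "K1 > 0" "\<And>v. norm (l v) \<le> norm v * K1"
    using l.pos_bounded by auto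
  obtain K2 where K2: "K2 > 0" "\<And>v w. norm (b v w) \<le> norm v * norm w * K2"
    using b.pos_bounded by auto
  define M where "M vs = (case vs of [] \<Rightarrow> a | [v] \<Rightarrow> l v | [v, w] \<Rightarrow> b v w | _ \<Rightarrow> 0)" for vs
  have M_long: "M vs = 0" if "length vs \<ge> 3" for vs
    using that by (auto simp: M_def split: list.splits)
  define C where "C = norm a + K1 + K2"
  \<comment> \<open>The series is finite, so the radius 1 is an arbitrary choice; \<open>C\<close>
    dominates all three coefficient bounds.\<close>
  have "power_series_at M C 1 f x"
    unfolding power_series_at_def
  proof (intro conjI allI impI)
    fix us vs :: "'a list"
    consider "us = []" "vs = []" | v where "us = [v]" "vs = []" | v where "us = []" "vs = [v]"
      | "length us + length vs \<ge> 2"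
      by (cases us; cases vs) (auto simp: Suc_le_eq)
    then show "linear (\<lambda>v. M (us @ v # vs))"
    proof cases
      case 4
      then have "M (us @ v # vs) = 0" for v
        by (intro M_long) simp
      then show ?thesis by (simp add: linear_iff)
    qed (auto simp: M_def l.linear_axioms b.bounded_linear_left
        b.bounded_linear_right bounded_linear.linear)
  next
    fix vs :: "'a list"
    have p: "norm a \<le> C" "K1 \<le> C" "K2 \<le> C" "C \<ge> 0" using K1 K2 by (auto simp: C_def)
    consider "vs = []" | v where "vs = [v]" | v w where "vs = [v, w]" | "length vs \<ge> 3"
    proof (cases vs)
      case (Cons v vs')
      then show ?thesis
        using that by (cases vs'; cases "tl vs'") (auto simp: Suc_le_eq)
    qed auto
    then show "norm (M vs) \<le> C * (\<Prod>v\<leftarrow>vs. norm v / 1)"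
    proof cases
      case (2 v)
      have "norm (l v) \<le> C * norm v"
        using K1(2)[of v] mult_right_mono[OF p(2), of "norm v"] by (simp add: mult.commute)
      then show ?thesis by (simp add: M_def 2)
    next
      case (3 v w)
      have "norm (b v w) \<le> C * (norm v * norm w)"
        using K2(2)[of v w] mult_right_mono[OF p(3), of "norm v * norm w"] by (simp add: mult.commute)
      then show ?thesis by (simp add: M_def 3)
    next
      case 4
      then have "M vs = 0" by (rule M_long)
      then show ?thesis
        using p(4) prod_list_norm_nonneg[of vs] by simp
    qed (use p in \<open>simp add: M_def\<close>)
  next
    fix h :: 'a
    have "(\<lambda>k. M (replicate k h)) sums (\<Sum>k<3. M (replicate k h))"
    proof (rule sums_finite)
      fix k assume "k \<notin> {..<3::nat}"
      then show "M (replicate k h) = 0" by (intro M_long) simp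
    qed simp
    then show "(\<lambda>k. M (replicate k h)) sums f (x + h)"
      by (simp add: M_def f eval_nat_numeral)
  qed simp
  then show ?thesis
    by (auto simp: real_analytic_at_power_series)
qed

lemma real_analytic_at_affine:
  assumes "bounded_linear l"
  shows "real_analytic_at (\<lambda>y. l y + c) x"
  by (rule real_analytic_at_quadratic[OF assms, where b = "\<lambda>_ _. 0" and a = "l x + c"])
     (use assms in \<open>auto simp: linear_add bounded_linear.linear bounded_bilinear_def intro!: exI[of _ 0]\<close>)

lemma real_analytic_at_const: "real_analytic_at (\<lambda>_. c) x"
  using real_analytic_at_affine[of "\<lambda>_. 0"] by simp

lemma real_analytic_at_bilinear:
  assumes "bounded_bilinear b"
  shows "real_analytic_at (\<lambda>(y, z). b y z) x"
proof -
  interpret b: bounded_bilinear b by fact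
  show ?thesis
  proof (rule real_analytic_at_quadratic)
    show "bounded_linear (\<lambda>h. b (fst x) (snd h) + b (fst h) (snd x))"
      by (intro bounded_linear_add b.bounded_linear_left[THEN bounded_linear_compose]
          b.bounded_linear_right[THEN bounded_linear_compose] bounded_linear_fst bounded_linear_snd)
    show "bounded_bilinear (\<lambda>h k. b (fst h) (snd k))"
      by (intro b.comp bounded_linear_fst bounded_linear_snd)
    show "(case x + h of (y, z) \<Rightarrow> b y z) =
        b (fst x) (snd x) + (b (fst x) (snd h) + b (fst h) (snd x)) + b (fst h) (snd h)" for h
      by (cases x; cases h) (simp add: b.add_left b.add_right)
  qed
qed

section \<open>First order expansion and continuity\<close>

text \<open>From degree 2 on the terms are dominated by a geometric series of ratio
  \<open>norm h / r \<le> 1/2\<close>, whose sum is at most twice its first term.\<close>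

lemma power_series_at_remainder:
  fixes M :: "'a::real_normed_vector list \<Rightarrow> 'b::real_normed_vector"
  assumes M: "power_series_at M C r f x" and h: "norm h \<le> r / 2"
  shows "norm (f (x + h) - M [] - M [h]) \<le> 2 * C * (norm h / r)\<^sup>2"
proof -
  define q where "q = norm h / r"
  have r: "r > 0" using M by (simp add: power_series_at_def)
  have q: "0 \<le> q" "q \<le> 1/2" using h r by (auto simp: q_def field_simps)
  have b: "norm (M (replicate k h)) \<le> C * q ^ k" for k
  proof -
    have "norm (M (replicate k h)) \<le> C * (\<Prod>v\<leftarrow>replicate k h. norm v / r)"
      using M unfolding power_series_at_def by blast
    then show ?thesis by (simp add: q_def map_replicate_const prod_list_replicate power_divide)
  qed
  have s: "(\<lambda>k. M (replicate k h)) sums f (x + h)"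
    using M h r by (auto simp: power_series_at_def)
  then have "(\<lambda>k. M (replicate (k + 2) h)) sums (f (x + h) - (\<Sum>k<2. M (replicate k h)))"
    by (rule sums_split_initial_segment)
  then have s2: "(\<lambda>k. M (replicate (k + 2) h)) sums (f (x + h) - M [] - M [h])"
    by (simp add: eval_nat_numeral algebra_simps)
  have g: "(\<lambda>k. C * q\<^sup>2 * q ^ k) sums (C * q\<^sup>2 * (1 / (1 - q)))"
    using q by (intro sums_mult geometric_sums) auto
  have "norm (\<Sum>k<n. M (replicate (k + 2) h)) \<le> C * q\<^sup>2 * (1 / (1 - q))" for n
  proof -
    have "norm (\<Sum>k<n. M (replicate (k + 2) h)) \<le> (\<Sum>k<n. C * q\<^sup>2 * q ^ k)"
      using b[of "_ + 2"] by (intro sum_norm_le) (simp add: power_add power2_eq_square mult_ac)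
    also have "\<dots> \<le> (\<Sum>k. C * q\<^sup>2 * q ^ k)"
      using q power_series_at_bound_nonneg[OF M]
      by (intro sum_le_suminf sums_summable[OF g]) auto
    finally show ?thesis using sums_unique[OF g] by simp
  qed
  then have "norm (f (x + h) - M [] - M [h]) \<le> C * q\<^sup>2 * (1 / (1 - q))"
    by (intro tendsto_upperbound[OF tendsto_norm[OF s2[unfolded sums_def]]]) auto
  also have "\<dots> \<le> C * q\<^sup>2 * 2"
    using q power_series_at_bound_nonneg[OF M] by (intro mult_left_mono) (auto simp: field_simps)
  finally show ?thesis by (simp add: q_def)
qed

text \<open>At \<open>h = 0\<close> linearity in the first entry kills every term of positive
  degree.\<close>

lemma power_series_at_Nil:
  assumes "power_series_at M C r f x"
  shows "M [] = f x"
proof -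
  have lin: "linear (\<lambda>v. M (us @ v # vs))" for us vs
    using assms by (simp add: power_series_at_def)
  have "M (replicate (Suc k) 0) = 0" for k
    using linear_0[OF lin[of "[]"]] by simp
  then have "M (replicate k 0) = 0" if "k \<noteq> 0" for k
    using that by (cases k) auto
  moreover have "(\<lambda>k. M (replicate k 0)) sums (\<Sum>k\<in>{0}. M (replicate k 0))"
    by (rule sums_finite) (use calculation in auto)
  moreover have "(\<lambda>k. M (replicate k 0)) sums f (x + 0)"
    using assms unfolding power_series_at_def by (metis norm_zero)
  ultimately show ?thesis
    by (metis (no_types, lifting) add_0_right sums_unique2 sum.empty sum.insert empty_iff finite.emptyI replicate_0)
qed

lemma real_analytic_at_imp_isCont:
  fixes f :: "'a::real_normed_vector \<Rightarrow> 'b::real_normed_vector"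
  assumes "real_analytic_at f x"
  shows "isCont f x"
proof -
  obtain M C r where M: "power_series_at M C r f x"
    using assms by (auto simp: real_analytic_at_power_series)
  have r: "r > 0" using M by (simp add: power_series_at_def)
  have nh: "norm (M [h]) \<le> C * (norm h / r)" for h
  proof -
    have "norm (M [h]) \<le> C * (\<Prod>v\<leftarrow>[h]. norm v / r)"
      using M unfolding power_series_at_def by blast
    then show ?thesis by simp
  qed
  have "((\<lambda>h. f (x + h) - f x) \<longlongrightarrow> 0) (at 0)"
  proof (rule Lim_null_comparison)
    show "\<forall>\<^sub>F h in at 0. norm (f (x + h) - f x) \<le> 2 * C * (norm h / r)\<^sup>2 + C * (norm h / r)"
      unfolding eventually_at
    proof (intro exI[of _ "r/2"] conjI ballI impI)
      fix h :: 'a assume "h \<noteq> 0 \<and> dist h 0 < r / 2"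
      then have "norm (f (x + h) - f x - M [h]) \<le> 2 * C * (norm h / r)\<^sup>2"
        using power_series_at_remainder[OF M, of h] power_series_at_Nil[OF M] by simp
      then show "norm (f (x + h) - f x) \<le> 2 * C * (norm h / r)\<^sup>2 + C * (norm h / r)"
        using nh[of h] norm_triangle_ineq[of "f (x + h) - f x - M [h]" "M [h]"] by simp
    qed (use r in simp)
    show "((\<lambda>h. 2 * C * (norm h / r)\<^sup>2 + C * (norm h / r)) \<longlongrightarrow> 0) (at 0)"
      using r by (auto intro!: tendsto_eq_intros)
  qed
  then show ?thesis
    by (simp add: isCont_iff LIM_zero_iff)
qed

section \<open>Circle valued analytic maps and their real lifts\<close>

text \<open>The device that turns a relation modulo \<open>\<int>\<close> between real lifts into an
  exact one: the integer defect is constant and is computed at one point.\<close>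

lemma continuous_Ints_valued_constant:
  fixes f :: "'a::real_normed_vector \<Rightarrow> real"
  assumes "continuous_on UNIV f" "\<And>x. f x \<in> \<int>"
  shows "f x = f y"
proof -
  have "f constant_on UNIV"
  proof (rule continuous_discrete_range_constant[OF connected_UNIV assms(1)])
    fix x
    have "1 \<le> norm (f y - f x)" if "f y \<noteq> f x" for y
      using Ints_nonzero_abs_ge1[OF Ints_diff[OF assms(2) assms(2)], of y x] that by simp
    then show "\<exists>e>0. \<forall>y. y \<in> UNIV \<and> f y \<noteq> f x \<longrightarrow> e \<le> norm (f y - f x)"
      by (intro exI[of _ 1]) auto
  qed
  then show ?thesis by (auto simp: constant_on_def)
qed

lemma eventually_constant_imp_constant:
  fixes f :: "'a::real_normed_vector \<Rightarrow> 'b"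
  assumes "\<And>x. \<forall>\<^sub>F y in nhds x. f y = f x"
  shows "f x = f y"
proof -
  have "f constant_on UNIV"
    by (rule locally_constant_imp_constant)
       (use assms in \<open>auto simp: eventually_nhds convex_connected\<close>)
  then show ?thesis by (auto simp: constant_on_def)
qed

text \<open>Additivity alone gives homogeneity over the rationals, and continuity extends it to
  their closure.\<close>

lemma continuous_additive_imp_linear:
  fixes f :: "'a::real_normed_vector \<Rightarrow> 'b::real_normed_vector"
  assumes cont: "continuous_on UNIV f" and add: "\<And>x y. f (x + y) = f x + f y"
  shows "linear f"
proof (rule linearI)
  fix r :: real and x
  have zero: "f 0 = 0" using add[of 0 0] by simp
  have uminus: "f (- y) = - f y" for y
    using add[of y "- y"] zero by (simp add: eq_neg_iff_add_eq_0 add.commute)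
  have nat: "f (of_nat n *\<^sub>R y) = of_nat n *\<^sub>R f y" for n y
    by (induction n) (auto simp: zero add scaleR_add_left)
  have int: "f (of_int k *\<^sub>R y) = of_int k *\<^sub>R f y" for k y
    by (cases k) (use nat[of _ y] uminus nat[of "Suc _" y] in \<open>auto simp del: of_nat_Suc\<close>)
  have "f (r *\<^sub>R x) - r *\<^sub>R f x = 0"
  proof (rule continuous_constant_on_closure[of \<rat>])
    show "continuous_on (closure \<rat>) (\<lambda>r. f (r *\<^sub>R x) - r *\<^sub>R f x)"
      by (intro continuous_intros continuous_on_compose2[OF cont]) auto
    show "r \<in> closure \<rat>" by (simp add: Rats_closure_real)
    fix q :: real assume "q \<in> \<rat>"
    then obtain a b where q: "b > 0" "q = of_int a / of_int b"
      by (metis Rats_cases' )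
    have "of_int b *\<^sub>R f (q *\<^sub>R x) = of_int a *\<^sub>R f x"
      using int[of b "q *\<^sub>R x"] int[of a x] q by simp
    then have "(1 / of_int b) *\<^sub>R (of_int b *\<^sub>R f (q *\<^sub>R x)) = (1 / of_int b) *\<^sub>R (of_int a *\<^sub>R f x)"
      by simp
    then show "f (q *\<^sub>R x) - q *\<^sub>R f x = 0"
      using q by simp
  qed
  then show "f (r *\<^sub>R x) = r *\<^sub>R f x" by simp
qed (rule add)

text \<open>Analyticity with respect to the chart \<open>circle_of\<close>, phrased by local real
  lifts since that chart is only locally injective.\<close>

definition circle_analytic :: "('a::real_normed_vector \<Rightarrow> circle) \<Rightarrow> bool" where
  "circle_analytic f \<longleftrightarrow>
    (\<forall>x. \<exists>F. real_analytic_at F x \<and> (\<forall>\<^sub>F y in nhds x. f y = circle_of (F y)))"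

lemma circle_of_0: "circle_of 0 = 0"
  by (simp add: circle_of_Ints)

lemma circle_of_minus: "circle_of (- s) = - circle_of s"
  by (simp add: uminus_circle.abs_eq)

lemma circle_of_diff: "circle_of (s - t) = circle_of s - circle_of t"
  by (simp add: minus_circle.abs_eq)

lemma circle_of_eq_0_iff: "circle_of s = 0 \<longleftrightarrow> s \<in> \<int>"
  using circle_of_eq_iff[of s 0] by (simp add: circle_of_0)

lemma circle_of_surj: "\<exists>s. c = circle_of s"
  using Quotient_abs_rep[OF Quotient_circle] by metis

lemma circle_analytic_circle_of:
  assumes "\<And>x. real_analytic_at F x"
  shows "circle_analytic (\<lambda>x. circle_of (F x))"
  using assms by (auto simp: circle_analytic_def intro!: exI[of _ F])

lemma circle_analytic_const: "circle_analytic (\<lambda>x. c)"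
  using circle_of_surj[of c] circle_analytic_circle_of[OF real_analytic_at_const] by metis

lemma circle_analytic_add:
  assumes "circle_analytic f" "circle_analytic g"
  shows "circle_analytic (\<lambda>x. f x + g x)"
  unfolding circle_analytic_def
proof
  fix x
  obtain F G where "real_analytic_at F x" "\<forall>\<^sub>F y in nhds x. f y = circle_of (F y)"
    "real_analytic_at G x" "\<forall>\<^sub>F y in nhds x. g y = circle_of (G y)"
    using assms unfolding circle_analytic_def by metis
  then show "\<exists>F. real_analytic_at F x \<and> (\<forall>\<^sub>F y in nhds x. f y + g y = circle_of (F y))"
    by (intro exI[of _ "\<lambda>y. F y + G y"] conjI real_analytic_at_add)
       (auto simp: circle_of_add elim: eventually_elim2)
qed

lemma circle_analytic_minus:
  assumes "circle_analytic f"
  shows "circle_analytic (\<lambda>x. - f x)"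
  unfolding circle_analytic_def
proof
  fix x
  obtain F where "real_analytic_at F x" "\<forall>\<^sub>F y in nhds x. f y = circle_of (F y)"
    using assms unfolding circle_analytic_def by metis
  then show "\<exists>F. real_analytic_at F x \<and> (\<forall>\<^sub>F y in nhds x. - f y = circle_of (F y))"
    by (intro exI[of _ "\<lambda>y. - F y"] conjI real_analytic_at_minus)
       (auto simp: circle_of_minus elim: eventually_mono)
qed

lemma circle_analytic_diff:
  assumes "circle_analytic f" "circle_analytic g"
  shows "circle_analytic (\<lambda>x. f x - g x)"
  using circle_analytic_add[OF assms(1) circle_analytic_minus[OF assms(2)]] by simp

lemma circle_analytic_compose_affine:
  assumes f: "circle_analytic f" and A: "bounded_linear A"
    and g: "\<And>x. g x = A x + c"
  shows "circle_analytic (\<lambda>x. f (g x))"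
  unfolding circle_analytic_def
proof
  fix x
  interpret A: bounded_linear A by fact
  obtain F where F: "real_analytic_at F (g x)" "\<forall>\<^sub>F y in nhds (g x). f y = circle_of (F y)"
    using f unfolding circle_analytic_def by metis
  have "real_analytic_at (\<lambda>z. F (g z)) x"
    by (rule real_analytic_at_compose_affine[OF F(1) A]) (simp add: g A.diff)
  moreover have "isCont g x"
    unfolding g[abs_def] by (intro continuous_intros A.isCont)
  then have "\<forall>\<^sub>F y in nhds x. f (g y) = circle_of (F (g y))"
    using F(2) by (auto simp: isCont_def tendsto_at_iff_tendsto_nhds
        intro: eventually_compose_filterlim)
  ultimately show "\<exists>F. real_analytic_at F x \<and> (\<forall>\<^sub>F y in nhds x. f (g y) = circle_of (F y))"
    by (intro exI[of _ "\<lambda>z. F (g z)"]) auto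
qed

lemma cis_eq_iff_Ints: "cis (2 * pi * s) = cis (2 * pi * t) \<longleftrightarrow> s - t \<in> \<int>"
proof
  assume "s - t \<in> \<int>"
  then have "cis (2 * pi * t) * cis (2 * pi * (s - t)) = cis (2 * pi * t)" by simp
  then show "cis (2 * pi * s) = cis (2 * pi * t)" by (simp add: cis_mult algebra_simps)
next
  assume "cis (2 * pi * s) = cis (2 * pi * t)"
  then have "cis (2 * pi * (s - t)) = 1"
    by (simp add: right_diff_distrib flip: cis_divide)
  then have "cos (2 * pi * (s - t)) = 1" by (simp add: complex_eq_iff)
  then obtain n :: int where "2 * pi * (s - t) = n * (2 * pi)"
    unfolding cos_one_2pi_int by auto
  then have "(2 * pi) * (s - t) = (2 * pi) * real_of_int n" by (simp only: mult.commute)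
  then have "s - t = n" by (simp del: right_diff_distrib left_diff_distrib)
  then show "s - t \<in> \<int>" by simp
qed

text \<open>The domain is contractible, so a continuous global lift exists; locally it differs from
  an analytic lift by a constant integer, hence it is analytic too.\<close>

lemma circle_analytic_lift:
  fixes f :: "'a::real_normed_vector \<Rightarrow> circle"
  assumes f: "circle_analytic f" and f0: "f 0 = 0"
  obtains F where "\<And>x. real_analytic_at F x" "\<And>x. f x = circle_of (F x)" "F 0 = 0"
proof -
  \<comment> \<open>\<open>rep_circle\<close> is not continuous, but \<open>cis\<close> forgets the
    integer by which its values jump.\<close>
  define E where "E x = cis (2 * pi * rep_circle (f x))" for x
  have E: "E x = cis (2 * pi * s)" if "f x = circle_of s" for x s
    unfolding E_def cis_eq_iff_Ints
    by (metis that Quotient_abs_rep[OF Quotient_circle] circle_of_eq_iff)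
  have "isCont E x" for x
  proof -
    obtain F where F: "real_analytic_at F x" "\<forall>\<^sub>F y in nhds x. f y = circle_of (F y)"
      using f unfolding circle_analytic_def by metis
    have "isCont (\<lambda>y. cis (2 * pi * F y)) x"
      using real_analytic_at_imp_isCont[OF F(1)] unfolding cis_conv_exp
      by (intro continuous_intros)
    moreover have "\<forall>\<^sub>F y in nhds x. E y = cis (2 * pi * F y)"
      using F(2) by (rule eventually_mono) (rule E)
    ultimately show ?thesis
      by (simp add: isCont_cong)
  qed
  then have "continuous_on UNIV E" by (simp add: continuous_on_eq_continuous_at)
  then obtain g where g: "continuous_on UNIV g" "\<And>x. E x = exp (g x)"
    using continuous_logarithm_on_contractible[of UNIV E] convex_imp_contractible[of UNIV]
    by (metis E_def UNIV_I cis_neq_zero convex_UNIV)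
  define G where "G x = Im (g x) / (2 * pi)" for x
  have contG: "continuous_on UNIV G"
    unfolding G_def by (intro continuous_intros g(1)) auto
  have G: "f x = circle_of (G x)" for x
  proof -
    obtain s where s: "f x = circle_of s" using circle_of_surj by blast
    have "norm (exp (g x)) = 1" using g(2)[of x] by (simp add: E_def flip: g(2))
    then have "Re (g x) = 0" by (simp add: norm_exp_eq_Re)
    then have "exp (g x) = cis (2 * pi * G x)"
      by (simp add: exp_eq_polar G_def)
    then have "cis (2 * pi * s) = cis (2 * pi * G x)"
      using E[OF s] g(2)[of x] by simp
    then show ?thesis by (simp add: s circle_of_eq_iff cis_eq_iff_Ints)
  qed
  \<comment> \<open>\<open>f 0 = 0\<close> makes \<open>G 0\<close> an integer, so this
    normalisation leaves the class in the circle unchanged.\<close>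
  define F where "F x = G x - G 0" for x
  have "G 0 \<in> \<int>" using G[of 0] f0 by (simp add: circle_of_eq_0_iff)
  then have F: "f x = circle_of (F x)" for x
    by (simp add: F_def circle_of_diff G circle_of_Ints)
  have contF: "continuous_on UNIV F"
    unfolding F_def by (intro continuous_intros contG)
  have "real_analytic_at F x" for x
  proof -
    obtain H where H: "real_analytic_at H x" "\<forall>\<^sub>F y in nhds x. f y = circle_of (H y)"
      using f unfolding circle_analytic_def by metis
    \<comment> \<open>For \<open>y\<close> near \<open>x\<close> the integers
      \<open>F y - H y\<close> and \<open>F x - H x\<close> are less than 1 apart and therefore
      equal, so \<open>F\<close> is a translate of the analytic function \<open>H\<close>
      there.\<close>
    have cont: "isCont (\<lambda>y. F y - H y) x"
      using real_analytic_at_imp_isCont[OF H(1)] contF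
      by (intro continuous_intros) (auto simp: continuous_on_eq_continuous_at)
    have Hx: "F x - H x \<in> \<int>"
      using eventually_nhds_x_imp_x[OF H(2)] F[of x] by (simp add: circle_of_eq_iff)
    have "\<forall>\<^sub>F y in nhds x. \<bar>(F y - H y) - (F x - H x)\<bar> < 1"
      using cont[unfolded isCont_def, THEN tendstoD, of 1]
      by (auto simp: dist_real_def eventually_at_filter elim: eventually_mono)
    then have "\<forall>\<^sub>F y in nhds x. H y + (F x - H x) = F y"
      using H(2)
    proof eventually_elim
      case (elim y)
      have "F y - H y \<in> \<int>" using elim(2) F[of y] by (simp add: circle_of_eq_iff)
      from Ints_diff[OF this Hx] elim(1) have "(F y - H y) - (F x - H x) = 0"
        using Ints_nonzero_abs_less1 by blast
      then show ?case by simp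
    qed
    then show ?thesis
      using real_analytic_at_add[OF H(1) real_analytic_at_const] real_analytic_at_cong by blast
  qed
  then show thesis using F that[of F] by (simp add: F_def)
qed

section \<open>Symmetric real analytic cocycles\<close>

text \<open>\<open>M [h]\<close> is the derivative of \<open>f\<close> in direction
  \<open>h\<close>: divide the remainder estimate along the ray by \<open>t\<close> and let
  \<open>t\<close> tend to 0.\<close>

lemma power_series_at_linear_term_eq_0:
  fixes f :: "'a::real_normed_vector \<Rightarrow> 'b::real_normed_vector"
  assumes M: "power_series_at M C r f x" and "\<delta> > 0"
    and f: "\<And>t. 0 < t \<Longrightarrow> t < \<delta> \<Longrightarrow> norm (f (x + t *\<^sub>R h) - f x) \<le> B * t\<^sup>2"
  shows "M [h] = 0"
proof -
  have r: "r > 0" using M by (rule power_series_at_pos)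
  have "linear (\<lambda>v. M ([] @ v # []))"
    using M unfolding power_series_at_def by blast
  from linear_scale[OF this] have scale: "M [t *\<^sub>R h] = t *\<^sub>R M [h]" for t
    by simp
  define D where "D = 2 * C * (norm h / r)\<^sup>2 + B"
  \<comment> \<open>Keeps \<open>t *\<^sub>R h\<close> within \<open>r / 2\<close>, where the
    remainder estimate applies; the summand 1 covers \<open>h = 0\<close>.\<close>
  define \<epsilon> where "\<epsilon> = min \<delta> (r / (2 * (norm h + 1)))"
  have \<epsilon>: "\<epsilon> > 0" using r assms(2) by (simp add: \<epsilon>_def add_nonneg_pos)
  have "norm (M [h]) \<le> D * t" if t: "0 < t" "t < \<epsilon>" for t
  proof -
    have "t * (norm h + 1) \<le> r / 2"
      using t norm_ge_zero[of h] by (simp add: \<epsilon>_def pos_less_divide_eq add_nonneg_pos) (simp add: algebra_simps)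
    then have "norm (t *\<^sub>R h) \<le> r / 2"
      using t by (simp add: algebra_simps)
    from power_series_at_remainder[OF M this]
    have "norm (f (x + t *\<^sub>R h) - f x - t *\<^sub>R M [h]) \<le> 2 * C * (norm h / r)\<^sup>2 * t\<^sup>2"
      using t by (simp add: power_series_at_Nil[OF M] scale power_mult_distrib power_divide mult_ac)
    moreover have "norm (f (x + t *\<^sub>R h) - f x) \<le> B * t\<^sup>2"
      using t f by (simp add: \<epsilon>_def)
    ultimately have "norm (t *\<^sub>R M [h]) \<le> D * t\<^sup>2"
      using norm_triangle_ineq4[of "f (x + t *\<^sub>R h) - f x" "f (x + t *\<^sub>R h) - f x - t *\<^sub>R M [h]"]
      by (simp add: D_def algebra_simps)
    then have "t * norm (M [h]) \<le> t * (D * t)"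
      using t by (simp add: power2_eq_square mult_ac)
    then show ?thesis using t by simp
  qed
  then have "\<forall>\<^sub>F t in at_right 0. norm (M [h]) \<le> D * t"
    using \<epsilon> by (auto simp: eventually_at_right_field)
  moreover have "((\<lambda>t. D * t) \<longlongrightarrow> D * 0) (at_right 0)"
    by (intro tendsto_intros)
  ultimately have "norm (M [h]) \<le> D * 0"
    by (intro tendsto_lowerbound) auto
  then show ?thesis by simp
qed

lemma power_series_at_quadratic_bound:
  fixes f :: "'a::real_normed_vector \<Rightarrow> 'b::real_normed_vector"
  assumes M: "power_series_at M C r f x" and "f x = 0" "\<And>h. M [h] = 0" "norm h \<le> r / 2"
  shows "norm (f (x + h)) \<le> (2 * C / r\<^sup>2) * (norm h)\<^sup>2"
  using power_series_at_remainder[OF M assms(4)] power_series_at_Nil[OF M] assms(2,3)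
  by (simp add: power_divide)

text \<open>The prefix \<open>us\<close> carries the induction: once the scalar is pulled out of one
  entry, that entry joins the prefix.\<close>

lemma power_series_at_homogeneous:
  assumes M: "power_series_at M C r f x"
  shows "M (us @ replicate k (c *\<^sub>R h)) = c ^ k *\<^sub>R M (us @ replicate k h)"
proof (induction k arbitrary: us)
  case (Suc k)
  have lin: "linear (\<lambda>v. M (us @ v # replicate k (c *\<^sub>R h)))"
    using M by (simp add: power_series_at_def)
  show ?case
    using Suc[of "us @ [h]"] linear_scale[OF lin, of c h] by simp
qed simp

text \<open>Vanishing to second order beats the weights: \<open>2 ^ n\<close> times the square of
  \<open>(1/2) ^ n\<close> is \<open>(1/2) ^ n\<close>. The bound near 0 is enough, as the arguments
  tend to 0.\<close>

lemma dyadic_summable: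
  fixes q :: "'a::real_normed_vector \<Rightarrow> real"
  assumes "\<delta> > 0" and q: "\<And>h. norm h < \<delta> \<Longrightarrow> \<bar>q h\<bar> \<le> B * (norm h)\<^sup>2"
  shows "summable (\<lambda>n. 2 ^ n * q ((1/2) ^ n *\<^sub>R h))"
proof (rule summable_comparison_test_ev)
  have "(\<lambda>n. (1/2) ^ n * norm h) \<longlonglongrightarrow> 0 * norm h"
    by (intro tendsto_intros LIMSEQ_power_zero) simp
  then have "\<forall>\<^sub>F n in sequentially. (1/2) ^ n * norm h < \<delta>"
    using assms(1) by (simp add: order_tendstoD)
  then show "\<forall>\<^sub>F n in sequentially.
      norm (2 ^ n * q ((1/2) ^ n *\<^sub>R h)) \<le> B * (norm h)\<^sup>2 * (1/2) ^ n"
  proof eventually_elim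
    case (elim n)
    have "\<bar>q ((1/2) ^ n *\<^sub>R h)\<bar> \<le> B * (norm ((1/2) ^ n *\<^sub>R h))\<^sup>2"
      using elim by (intro q) simp
    then have "2 ^ n * \<bar>q ((1/2) ^ n *\<^sub>R h)\<bar> \<le> 2 ^ n * (B * (norm ((1/2) ^ n *\<^sub>R h))\<^sup>2)"
      by simp
    also have "\<dots> = B * (norm h)\<^sup>2 * (1/2) ^ n"
      by (simp add: power2_eq_square power_divide)
    finally show ?case by (simp add: abs_mult)
  qed
  show "summable (\<lambda>n. B * (norm h)\<^sup>2 * (1/2) ^ n)"
    by (intro summable_mult summable_geometric) simp
qed

text \<open>
  A solution that vanishes to second order at \<open>0\<close> satisfies \<open>\<eta> x = 2 \<eta> (x/2) + K (x/2, x/2)\<close>,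
  which determines it as a dyadic series. Near \<open>0\<close> this amounts to dividing the term of degree \<open>k\<close>
  of \<open>x \<mapsto> K (x, x)\<close> by \<open>2 ^ k - 2\<close>; the functional equation carries analyticity to all points.
\<close>

theorem symmetric_cocycle_is_coboundary:
  fixes K :: "'v::real_normed_vector \<times> 'v \<Rightarrow> real"
  assumes an: "\<And>u. real_analytic_at K u"
    and sym: "\<And>x y. K (x, y) = K (y, x)"
    and coc: "\<And>x y z. K (x, y) + K (x + y, z) = K (y, z) + K (x, y + z)"
    and K0: "\<And>x. K (x, 0) = 0"
  obtains \<eta> where "\<And>u. real_analytic_at \<eta> u" "\<And>x y. \<eta> (x + y) = \<eta> x + \<eta> y + K (x, y)"
proof -
  define q where "q x = K (x, x)" for x
  define P where "P n x = (\<Sum>j<n. 2 ^ j * q ((1/2) ^ Suc j *\<^sub>R x))" for n x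
  obtain M C r where M: "power_series_at M C r K 0"
    using an[of 0] by (auto simp: real_analytic_at_power_series)
  have r: "r > 0" using M by (rule power_series_at_pos)
  have K0': "K (0, y) = 0" for y using sym K0 by metis
  \<comment> \<open>The linear term is additive, and \<open>K\<close> vanishes on both coordinate
    axes; so \<open>K\<close> vanishes to second order at the origin.\<close>
  have "M [(x, y)] = 0" for x y
  proof -
    have "linear (\<lambda>v. M ([] @ v # []))"
      using M unfolding power_series_at_def by blast
    from linear_add[OF this, of "(x, 0)" "(0, y)"]
    have "M [(x, y)] = M [(x, 0)] + M [(0, y)]" by simp
    moreover have "M [(x, 0)] = 0"
      by (rule power_series_at_linear_term_eq_0[OF M, of 1 _ 0]) (auto simp: K0 zero_prod_def)
    moreover have "M [(0, y)] = 0"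
      by (rule power_series_at_linear_term_eq_0[OF M, of 1 _ 0]) (auto simp: K0' zero_prod_def)
    ultimately show ?thesis by simp
  qed
  then have M1: "M [h] = 0" for h by (cases h) simp
  define B where "B = 2 * C / r\<^sup>2"
  have K00: "K 0 = 0" using K0[of 0] by (simp add: zero_prod_def)
  have KB: "\<bar>K h\<bar> \<le> B * (norm h)\<^sup>2" if "norm h < r / 2" for h
    using power_series_at_quadratic_bound[OF M K00 M1, of h] that by (simp add: B_def)
  have B: "B \<ge> 0"
    using power_series_at_bound_nonneg[OF M] by (simp add: B_def)
  have qB: "\<bar>q h\<bar> \<le> (4 * B) * (norm h)\<^sup>2" if "norm h < r / 4" for h
  proof -
    have n: "norm (h, h) \<le> 2 * norm h" using norm_Pair_le[of h h] by simp
    then have "\<bar>q h\<bar> \<le> B * (norm (h, h))\<^sup>2"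
      unfolding q_def using that by (intro KB) simp
    also have "\<dots> \<le> B * (2 * norm h)\<^sup>2"
      using n B by (intro mult_left_mono power_mono) auto
    finally show ?thesis by (simp add: power2_eq_square)
  qed
  have Klim: "(\<lambda>n. 2 ^ n * K ((1/2) ^ n *\<^sub>R h)) \<longlonglongrightarrow> 0" for h
    using dyadic_summable[of "r / 2" K B h] KB r by (intro summable_LIMSEQ_zero) auto
  define \<eta> where "\<eta> x = (\<Sum>j. 2 ^ j * q ((1/2) ^ Suc j *\<^sub>R x))" for x
  have Plim: "(\<lambda>n. P n x) \<longlonglongrightarrow> \<eta> x" for x
  proof -
    have "summable (\<lambda>n. 2 ^ n * q ((1/2) ^ n *\<^sub>R x))"
      using dyadic_summable[of "r / 4" q "4 * B" x] qB r by auto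
    then have "summable (\<lambda>n. 2 ^ Suc n * q ((1/2) ^ Suc n *\<^sub>R x))"
      by (subst summable_Suc_iff)
    then have "summable (\<lambda>n. (1/2) * (2 ^ Suc n * q ((1/2) ^ Suc n *\<^sub>R x)))"
      by (rule summable_mult)
    then have "summable (\<lambda>n. 2 ^ n * q ((1/2) ^ Suc n *\<^sub>R x))"
      by simp
    then show ?thesis
      unfolding P_def \<eta>_def by (rule summable_LIMSEQ)
  qed
  \<comment> \<open>Doubling both arguments multiplies the class of \<open>K\<close> by 2:
    \<open>K (2a, 2b)\<close> and \<open>2 K (a, b)\<close> differ by the coboundary of
    \<open>q\<close>. Symmetry enters here.\<close>
  have double: "K (a + a, b + b) = q (a + b) - q a - q b + 2 * K (a, b)" for a b
    using coc[of a a "b + b"] coc[of a b b] coc[of "a + b" b a]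
      sym[of a "a + (b + b)"] sym[of a b]
    by (simp add: q_def algebra_simps)
  \<comment> \<open>Iterating \<open>double\<close> on halved arguments exhibits \<open>K\<close> as
    the coboundary of \<open>P n\<close> up to a rescaled value of \<open>K\<close> near the origin,
    which \<open>Klim\<close> sends to 0.\<close>
  have PK: "K (x, y) = P n (x + y) - P n x - P n y + 2 ^ n * K ((1/2) ^ n *\<^sub>R (x, y))" for n x y
  proof (induction n)
    case (Suc n)
    define a b where "a = (1/2) ^ Suc n *\<^sub>R x" and "b = (1/2) ^ Suc n *\<^sub>R y"
    have ab: "(1/2) ^ n *\<^sub>R (x, y) = (a + a, b + b)" "(1/2) ^ Suc n *\<^sub>R (x, y) = (a, b)"
      "(1/2) ^ Suc n *\<^sub>R (x + y) = a + b"
      by (simp_all add: a_def b_def scaleR_add_right flip: scaleR_add_left)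
    show ?case
      using Suc unfolding P_def ab sum.lessThan_Suc double a_def[symmetric] b_def[symmetric]
      by (simp add: algebra_simps)
  qed (simp add: P_def)
  have \<eta>: "\<eta> (x + y) = \<eta> x + \<eta> y + K (x, y)" for x y
  proof -
    have "(\<lambda>n. P n (x + y) - P n x - P n y + 2 ^ n * K ((1/2) ^ n *\<^sub>R (x, y)))
        \<longlonglongrightarrow> \<eta> (x + y) - \<eta> x - \<eta> y + 0"
      by (intro tendsto_intros Plim Klim)
    then have "K (x, y) = \<eta> (x + y) - \<eta> x - \<eta> y + 0"
      unfolding PK[symmetric] by (simp add: LIMSEQ_const_iff)
    then show ?thesis by simp
  qed
  have "real_analytic_at q 0"
    unfolding q_def
    by (rule real_analytic_at_compose_affine[OF an[of 0], of "\<lambda>x. (x, x)"])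
       (auto intro: bounded_linear_Pair bounded_linear_ident)
  then obtain M' C' r' where M': "power_series_at M' C' r' q 0"
    by (auto simp: real_analytic_at_power_series)
  have r': "r' > 0" using M' by (rule power_series_at_pos)
  have q0: "q 0 = 0" by (simp add: q_def K0)
  have M'1: "M' [h] = 0" for h
  proof (rule power_series_at_linear_term_eq_0[OF M'])
    show "r / (4 * (norm h + 1)) > 0" using r by (simp add: add_nonneg_pos)
    fix t :: real assume t: "0 < t" "t < r / (4 * (norm h + 1))"
    then have "t * (norm h + 1) < r / 4"
      using norm_ge_zero[of h] by (simp add: pos_less_divide_eq add_nonneg_pos) (simp add: algebra_simps)
    then have "norm (t *\<^sub>R h) < r / 4" using t by (simp add: algebra_simps)
    from qB[OF this] show "norm (q (0 + t *\<^sub>R h) - q 0) \<le> (4 * B * (norm h)\<^sup>2) * t\<^sup>2"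
      by (simp add: q0 power_mult_distrib mult_ac)
  qed
  \<comment> \<open>Comparing terms of degree \<open>k\<close> in
    \<open>\<phi> h = q (h/2) + 2 \<phi> (h/2)\<close> multiplies the term of \<open>\<phi>\<close>
    by \<open>2 ^ k - 2\<close>. The default 0 in degrees 0 and 1 makes \<open>\<phi>\<close> vanish
    to second order; \<open>q\<close> has no terms there.\<close>
  define d where "d k = (if k < 2 then 0 else inverse (2 ^ k - 2 :: real))" for k :: nat
  have d: "0 \<le> d k" "d k \<le> 1" "2 \<le> k \<Longrightarrow> d k * (2 ^ k - 2) = 1" for k
  proof -
    have "(2::real) ^ k \<ge> 2 ^ 2" if "2 \<le> k"
      using that by (intro power_increasing) auto
    then show "0 \<le> d k" "d k \<le> 1" "2 \<le> k \<Longrightarrow> d k * (2 ^ k - 2) = 1"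
      by (auto simp: d_def inverse_le_1_iff not_less)
  qed
  define N where "N vs = d (length vs) * M' vs" for vs
  define \<phi> where "\<phi> h = (\<Sum>k. N (replicate k h))" for h
  have N: "power_series_at N C' r' \<phi> 0"
    unfolding power_series_at_def
  proof (intro conjI allI impI r')
    fix us vs
    have "linear (\<lambda>v. M' (us @ v # vs))"
      using M' by (simp add: power_series_at_def)
    from linear_compose_scale_right[OF this, of "d (Suc (length us + length vs))"]
    show "linear (\<lambda>v. N (us @ v # vs))" by (simp add: N_def)
  next
    fix vs
    have "norm (N vs) \<le> 1 * norm (M' vs)"
      unfolding N_def norm_mult using d by (intro mult_right_mono) auto
    also have "norm (M' vs) \<le> C' * (\<Prod>v\<leftarrow>vs. norm v / r')"
      using M' by (simp add: power_series_at_def)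
    finally show N: "norm (N vs) \<le> C' * (\<Prod>v\<leftarrow>vs. norm v / r')" by simp
  next
    fix h :: 'v assume h: "norm h < r'"
    have "summable (\<lambda>k. N (replicate k h))"
    proof (rule summable_comparison_test)
      have "norm (N (replicate k h)) \<le> C' * (norm h / r') ^ k" for k
      proof -
        have "norm (N (replicate k h)) \<le> 1 * norm (M' (replicate k h))"
          unfolding N_def norm_mult using d by (intro mult_right_mono) auto
        also have "norm (M' (replicate k h)) \<le> C' * (\<Prod>v\<leftarrow>replicate k h. norm v / r')"
          using M' unfolding power_series_at_def by blast
        finally show ?thesis by (simp add: map_replicate_const prod_list_replicate)
      qed
      then show "\<exists>N'. \<forall>k\<ge>N'. norm (N (replicate k h)) \<le> C' * (norm h / r') ^ k" by blast
      show "summable (\<lambda>k. C' * (norm h / r') ^ k)"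
        using h r' by (intro summable_mult summable_geometric) simp
    qed
    then show "(\<lambda>k. N (replicate k h)) sums \<phi> (0 + h)"
      by (simp add: \<phi>_def summable_sums)
  qed
  have \<phi>_half: "\<phi> h = q ((1/2) *\<^sub>R h) + 2 * \<phi> ((1/2) *\<^sub>R h)" if h: "norm h < r'" for h
  proof -
    have "(\<lambda>k. N (replicate k h) - 2 * N (replicate k ((1/2) *\<^sub>R h))) sums
        (\<phi> (0 + h) - 2 * \<phi> (0 + (1/2) *\<^sub>R h))"
      using N h by (intro sums_diff sums_mult) (auto simp: power_series_at_def)
    moreover have "N (replicate k h) - 2 * N (replicate k ((1/2) *\<^sub>R h)) =
        M' (replicate k ((1/2) *\<^sub>R h))" for k
    proof (cases "2 \<le> k")
      case True
      have hom: "M' (replicate k ((1/2) *\<^sub>R h)) = (1/2) ^ k * M' (replicate k h)"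
        using power_series_at_homogeneous[OF M', of "[]"] by simp
      have "d k * M' (replicate k h) - 2 * (d k * ((1/2) ^ k * M' (replicate k h))) =
          (1/2) ^ k * (d k * (2 ^ k - 2)) * M' (replicate k h)"
        by (simp add: algebra_simps power_divide)
      then show ?thesis using d(3)[OF True] by (simp add: N_def hom)
    next
      case False
      then have "k = 0 \<or> k = Suc 0" by auto
      then show ?thesis
        using power_series_at_Nil[OF M'] by (auto simp: N_def d_def q0 M'1)
    qed
    moreover have "(\<lambda>k. M' (replicate k ((1/2) *\<^sub>R h))) sums q (0 + (1/2) *\<^sub>R h)"
      using M' h by (simp add: power_series_at_def)
    ultimately show ?thesis by (simp add: sums_iff)
  qed
  have \<phi>_P: "\<phi> h = P n h + 2 ^ n * \<phi> ((1/2) ^ n *\<^sub>R h)" if h: "norm h < r'" for h n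
  proof (induction n)
    case (Suc n)
    have "norm ((1/2) ^ n *\<^sub>R h) \<le> norm h"
      by (simp add: mult_left_le_one_le power_le_one)
    then have "\<phi> ((1/2) ^ n *\<^sub>R h) = q ((1/2) ^ Suc n *\<^sub>R h) + 2 * \<phi> ((1/2) ^ Suc n *\<^sub>R h)"
      using \<phi>_half[of "(1/2) ^ n *\<^sub>R h"] h by simp
    then show ?case using Suc by (simp add: P_def algebra_simps)
  qed (simp add: P_def)
  have \<phi>0: "\<phi> 0 = 0"
    using power_series_at_Nil[OF N] by (simp add: N_def d_def)
  have \<phi>B: "\<bar>\<phi> h\<bar> \<le> (2 * C' / r'\<^sup>2) * (norm h)\<^sup>2" if "norm h < r' / 2" for h
    using power_series_at_quadratic_bound[OF N \<phi>0, of h] that by (simp add: N_def d_def)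
  \<comment> \<open>Both functions satisfy the same halving recursion; the rescaled remainder of
    \<open>\<phi>\<close> tends to 0 because \<open>\<phi>\<close> vanishes to second order.\<close>
  have \<phi>\<eta>: "\<phi> h = \<eta> h" if h: "norm h < r'" for h
  proof -
    have "(\<lambda>n. 2 ^ n * \<phi> ((1/2) ^ n *\<^sub>R h)) \<longlonglongrightarrow> 0"
      using dyadic_summable[of "r' / 2" \<phi> _ h, OF _ \<phi>B] r' by (intro summable_LIMSEQ_zero) auto
    from tendsto_add[OF Plim[of h] this] show ?thesis
      unfolding \<phi>_P[OF h, symmetric] by (simp add: LIMSEQ_const_iff)
  qed
  have \<eta>0: "real_analytic_at \<eta> 0"
  proof (rule real_analytic_at_cong)
    show "real_analytic_at \<phi> 0" using N by (auto simp: real_analytic_at_power_series)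
    show "\<forall>\<^sub>F h in nhds 0. \<phi> h = \<eta> h"
      using r' \<phi>\<eta> by (auto simp: eventually_nhds_metric)
  qed
  have "real_analytic_at \<eta> u" for u
  proof -
    have "real_analytic_at (\<lambda>v. \<eta> u + \<eta> (v - u) + K (u, v - u)) u"
    proof (intro real_analytic_at_add real_analytic_at_const)
      show "real_analytic_at (\<lambda>v. \<eta> (v - u)) u"
        by (rule real_analytic_at_compose_affine[OF \<eta>0 bounded_linear_ident]) simp
      show "real_analytic_at (\<lambda>v. K (u, v - u)) u"
        by (rule real_analytic_at_compose_affine[OF an[of "(u, 0)"], of "\<lambda>h. (0, h)"])
           (auto intro: bounded_linear_Pair bounded_linear_ident bounded_linear_zero)
    qed
    moreover have "(\<lambda>v. \<eta> u + \<eta> (v - u) + K (u, v - u)) = \<eta>"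
    proof
      show "\<eta> u + \<eta> (v - u) + K (u, v - u) = \<eta> v" for v
        using \<eta>[of u "v - u"] by simp
    qed
    ultimately show ?thesis by simp
  qed
  then show thesis using \<eta> that by blast
qed

section \<open>Linear maps on finite dimensional normed spaces\<close>

text \<open>The norm is arbitrary, so coordinates must be shown to be bounded. By induction the span
  of \<open>B\<close> is closed, hence a new basis vector \<open>b\<close> has positive distance
  \<open>d\<close> from it, and \<open>1 / d\<close> bounds the new coordinate.\<close>

lemma finite_independent_coordinates_bounded:
  fixes B :: "'a::real_normed_vector set"
  assumes "finite B" "independent B"
  shows "\<exists>c>0. \<forall>a. (\<Sum>b\<in>B. \<bar>a b\<bar>) \<le> c * norm (\<Sum>b\<in>B. a b *\<^sub>R b)"
  using assms
proof (induction B)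
  case empty
  then show ?case by (auto intro: exI[of _ 1])
next
  case (insert b B)
  then obtain c where c: "c > 0" "\<And>a. (\<Sum>b\<in>B. \<bar>a b\<bar>) \<le> c * norm (\<Sum>b\<in>B. a b *\<^sub>R b)"
    by (auto simp: independent_insert)
  have b: "b \<notin> span B" using insert by (simp add: independent_insert)
  \<comment> \<open>Otherwise vectors of \<open>span B\<close> converge to \<open>b\<close>; their
    coordinates are Cauchy by the induction hypothesis, and the limits express \<open>b\<close> in
    \<open>B\<close>.\<close>
  have "\<exists>d>0. \<forall>s\<in>span B. d \<le> norm (b - s)"
  proof (rule ccontr)
    assume neg: "\<not> ?thesis"
    have "\<exists>s\<in>span B. norm (b - s) < inverse (real (Suc n))" for n
    proof -
      have "0 < inverse (real (Suc n))" by simp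
      then have "\<not> (\<forall>s\<in>span B. inverse (real (Suc n)) \<le> norm (b - s))"
        using neg by blast
      then show ?thesis by (simp add: not_le)
    qed
    then obtain s where s: "\<And>n. s n \<in> span B" "\<And>n. norm (b - s n) < inverse (real (Suc n))"
      by metis
    have "(\<lambda>n. s n - b) \<longlonglongrightarrow> 0"
      by (rule Lim_null_comparison[OF _ LIMSEQ_inverse_real_of_nat])
         (use s(2) in \<open>auto simp: norm_minus_commute less_imp_le\<close>)
    then have lim: "s \<longlonglongrightarrow> b" by (simp add: LIM_zero_iff)
    obtain a where a: "\<And>n. s n = (\<Sum>v\<in>B. a n v *\<^sub>R v)"
      using s(1) insert.hyps(1) unfolding span_finite[OF insert.hyps(1)] image_iff by metis
    have "Cauchy (\<lambda>n. a n v)" if v: "v \<in> B" for v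
    proof (rule metric_CauchyI)
      fix e :: real assume e: "e > 0"
      obtain N where N: "\<And>m n. m \<ge> N \<Longrightarrow> n \<ge> N \<Longrightarrow> dist (s m) (s n) < e / c"
        using LIMSEQ_imp_Cauchy[OF lim] e c(1) by (meson divide_pos_pos metric_CauchyD)
      have "dist (a m v) (a n v) < e" if "m \<ge> N" "n \<ge> N" for m n
      proof -
        have "\<bar>a m v - a n v\<bar> \<le> (\<Sum>w\<in>B. \<bar>a m w - a n w\<bar>)"
          using v insert.hyps(1) by (intro member_le_sum) auto
        also have "\<dots> \<le> c * norm (s m - s n)"
          using c(2)[of "\<lambda>w. a m w - a n w"] by (simp add: a scaleR_diff_left sum_subtractf)
        also have "\<dots> < e"
          using N[OF that] c(1) by (simp add: dist_norm field_simps)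
        finally show ?thesis by (simp add: dist_real_def)
      qed
      then show "\<exists>N. \<forall>m\<ge>N. \<forall>n\<ge>N. dist (a m v) (a n v) < e" by blast
    qed
    then obtain l where l: "\<And>v. v \<in> B \<Longrightarrow> (\<lambda>n. a n v) \<longlonglongrightarrow> l v"
      unfolding Cauchy_convergent_iff convergent_def by metis
    have "s \<longlonglongrightarrow> (\<Sum>v\<in>B. l v *\<^sub>R v)"
      unfolding a[abs_def] by (intro tendsto_sum tendsto_scaleR l tendsto_const)
    then have "b = (\<Sum>v\<in>B. l v *\<^sub>R v)" using lim LIMSEQ_unique by blast
    then show False using b by (simp add: span_sum span_scale span_base)
  qed
  then obtain d where d: "d > 0" "\<And>s. s \<in> span B \<Longrightarrow> d \<le> norm (b - s)" by blast
  show ?case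
  proof (intro exI conjI allI)
    \<comment> \<open>With \<open>y = a b *\<^sub>R b + x\<close>, the coordinate of
      \<open>b\<close> is at most \<open>norm y / d\<close>, so \<open>norm x\<close> is at most
      \<open>(1 + norm b / d) * norm y\<close>, to which the bound \<open>c\<close> for
      \<open>B\<close> applies.\<close>
    show "1 / d + c * (1 + norm b / d) > 0" using c(1) d(1) by (simp add: add_pos_nonneg)
    fix a
    define x where "x = (\<Sum>v\<in>B. a v *\<^sub>R v)"
    define y where "y = a b *\<^sub>R b + x"
    have x: "x \<in> span B" by (simp add: x_def span_sum span_scale span_base)
    have t: "\<bar>a b\<bar> \<le> norm y / d"
    proof (cases "a b = 0")
      case False
      have "- (inverse (a b) *\<^sub>R x) \<in> span B" using x by (simp add: span_neg span_scale)
      from d(2)[OF this] have "d * \<bar>a b\<bar> \<le> norm (b + inverse (a b) *\<^sub>R x) * \<bar>a b\<bar>"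
        by (intro mult_right_mono) auto
      also have "\<dots> = norm (a b *\<^sub>R (b + inverse (a b) *\<^sub>R x))" by (simp add: mult.commute)
      also have "a b *\<^sub>R (b + inverse (a b) *\<^sub>R x) = y"
        using False by (simp add: y_def scaleR_add_right)
      finally show ?thesis using d(1) by (simp add: field_simps)
    qed (use d(1) in simp)
    have "norm x \<le> norm y + \<bar>a b\<bar> * norm b"
      using norm_triangle_ineq4[of y "a b *\<^sub>R b"] by (simp add: y_def)
    also have "\<dots> \<le> norm y + norm y / d * norm b"
      using t by (intro add_left_mono mult_right_mono) auto
    finally have "c * norm x \<le> c * (norm y + norm y / d * norm b)"
      using c(1) by simp
    then have "\<bar>a b\<bar> + (\<Sum>v\<in>B. \<bar>a v\<bar>) \<le> norm y / d + c * (norm y + norm y / d * norm b)"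
      using t c(2)[of a] by (simp add: x_def)
    also have "\<dots> = (1 / d + c * (1 + norm b / d)) * norm y"
      by (simp add: algebra_simps)
    finally show "(\<Sum>v\<in>insert b B. \<bar>a v\<bar>) \<le>
        (1 / d + c * (1 + norm b / d)) * norm (\<Sum>v\<in>insert b B. a v *\<^sub>R v)"
      using insert.hyps by (simp add: y_def x_def)
  qed
qed

lemma finite_dim_linear_imp_bounded_linear:
  fixes f :: "'a::real_normed_vector \<Rightarrow> 'b::real_normed_vector"
  assumes B: "finite B" "independent B" "span B = (UNIV :: 'a set)" and f: "linear f"
  shows "bounded_linear f"
proof -
  obtain c where c: "c > 0" "\<And>a. (\<Sum>b\<in>B. \<bar>a b\<bar>) \<le> c * norm (\<Sum>b\<in>B. a b *\<^sub>R b)"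
    using finite_independent_coordinates_bounded[OF B(1,2)] by blast
  define S where "S = (\<Sum>b\<in>B. norm (f b))"
  have "norm (f x) \<le> norm x * (c * S)" for x
  proof -
    obtain a where x: "x = (\<Sum>b\<in>B. a b *\<^sub>R b)"
      using B(3) span_finite[OF B(1)] by blast
    have "norm (f x) \<le> (\<Sum>b\<in>B. \<bar>a b\<bar> * norm (f b))"
      unfolding x linear_sum[OF f] by (rule order.trans[OF norm_sum]) (simp add: linear_scale[OF f])
    also have "\<dots> \<le> (\<Sum>b\<in>B. \<bar>a b\<bar> * S)"
      unfolding S_def using B(1) by (intro sum_mono mult_left_mono member_le_sum) auto
    also have "\<dots> = (\<Sum>b\<in>B. \<bar>a b\<bar>) * S" by (simp add: sum_distrib_right)
    also have "\<dots> \<le> (c * norm x) * S"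
      unfolding x using c(2) by (intro mult_right_mono) (auto simp: S_def sum_nonneg)
    finally show ?thesis by (simp add: mult_ac)
  qed
  then show ?thesis
    using f by (auto simp: bounded_linear_def bounded_linear_axioms_def)
qed

lemma finite_dim_bilinear_imp_bounded_bilinear:
  fixes h :: "'a::real_normed_vector \<Rightarrow> 'a \<Rightarrow> 'b::real_normed_vector"
  assumes B: "finite B" "independent B" "span B = (UNIV :: 'a set)" and h: "bilinear h"
  shows "bounded_bilinear h"
proof -
  obtain c where c: "c > 0" "\<And>a. (\<Sum>b\<in>B. \<bar>a b\<bar>) \<le> c * norm (\<Sum>b\<in>B. a b *\<^sub>R b)"
    using finite_independent_coordinates_bounded[OF B(1,2)] by blast
  have lin: "linear (h x)" "linear (\<lambda>x. h x y)" for x y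
    using h by (auto simp: bilinear_def)
  have "bounded_linear (h b)" for b
    by (rule finite_dim_linear_imp_bounded_linear[OF B lin(1)])
  then have "\<forall>b. \<exists>K>0. \<forall>y. norm (h b y) \<le> norm y * K"
    using bounded_linear.pos_bounded by blast
  then obtain K where K: "\<And>b. K b > 0" "\<And>b y. norm (h b y) \<le> norm y * K b"
    by metis
  define S where "S = (\<Sum>b\<in>B. K b)"
  have "norm (h x y) \<le> norm x * norm y * (c * S)" for x y
  proof -
    obtain a where x: "x = (\<Sum>b\<in>B. a b *\<^sub>R b)"
      using B(3) span_finite[OF B(1)] by blast
    have "norm (h x y) \<le> (\<Sum>b\<in>B. \<bar>a b\<bar> * norm (h b y))"
      unfolding x linear_sum[OF lin(2)]
      by (rule order.trans[OF norm_sum]) (simp add: linear_scale[OF lin(2)])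
    also have "\<dots> \<le> (\<Sum>b\<in>B. \<bar>a b\<bar> * (norm y * S))"
    proof (intro sum_mono mult_left_mono)
      fix b assume "b \<in> B"
      then have "norm y * K b \<le> norm y * S"
        unfolding S_def using B(1) K(1) by (intro mult_left_mono member_le_sum) (auto simp: less_imp_le)
      then show "norm (h b y) \<le> norm y * S" using K(2) order.trans by blast
    qed auto
    also have "\<dots> = (\<Sum>b\<in>B. \<bar>a b\<bar>) * (norm y * S)" by (simp add: sum_distrib_right)
    also have "\<dots> \<le> (c * norm x) * (norm y * S)"
      unfolding x using c(2) K(1) by (intro mult_right_mono) (auto simp: S_def sum_nonneg less_imp_le)
    finally show ?thesis by (simp add: mult_ac)
  qed
  then show ?thesis
    using h by (auto simp: bounded_bilinear_def bilinear_ladd bilinear_radd bilinear_lmul bilinear_rmul)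
qed

section \<open>Weak automorphisms in coordinates\<close>

lemma Theta'_simps [simp]:
  "carrier (G0 (Theta' L J)) = UNIV \<times> {1, -1}"
  "(x, \<epsilon>) \<otimes>\<^bsub>G0 (Theta' L J)\<^esub> (y, \<delta>) = (x + of_int \<epsilon> *\<^sub>R y, \<epsilon> * \<delta>)"
  "\<one>\<^bsub>G0 (Theta' L J)\<^esub> = (0, 1)"
  "carrier (G1 (Theta' L J)) = L \<times> UNIV"
  "(m, a) \<otimes>\<^bsub>G1 (Theta' L J)\<^esub> (n, b) = (m + n, a + b)"
  "\<one>\<^bsub>G1 (Theta' L J)\<^esub> = (0, 0)"
  "bd (Theta' L J) (m, a) = (m, 1)"
  "act (Theta' L J) (m, a) (x, \<epsilon>) = (of_int \<epsilon> *\<^sub>R m, a + circle_of (J m x))"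
  "charts1 (Theta' L J) = {\<lambda>s. (m, circle_of s) | m. m \<in> L}"
  "charts0 (Theta' L J) = {\<lambda>x. (x, \<epsilon>) | \<epsilon>. \<epsilon> \<in> {1, -1}}"
  by (auto simp: Theta'_def lattice_group_def circle_group_def semidirect_sign_group_def)

lemma inv_G0_Theta':
  "\<epsilon> \<in> {1, -1} \<Longrightarrow> inv\<^bsub>G0 (Theta' L J)\<^esub> (x, \<epsilon>) = (- (of_int \<epsilon> *\<^sub>R x), \<epsilon>)"
  using inv_semidirect_sign_group by (auto simp: Theta'_def)

lemma inv_G1_Theta':
  assumes "full_lattice L" "m \<in> L"
  shows "inv\<^bsub>G1 (Theta' L J)\<^esub> (m, a) = (- m, - a)"
proof -
  have "group (G1 (Theta' L J))"
    using assms(1) by (simp add: Theta'_def DirProd_group group_lattice_group group_circle_group)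
  then show ?thesis
    by (rule group.inv_equality) (use assms full_latticeD[OF assms(1)] in auto)
qed

lemma analytic_map_eventually:
  "analytic_map P Q F \<longleftrightarrow>
    (\<forall>p\<in>P. \<forall>u. \<exists>q\<in>Q. \<exists>g. real_analytic_at g u \<and> (\<forall>\<^sub>F v in nhds u. F (p v) = q (g v)))"
proof -
  have "(\<exists>e>0. A \<and> (\<forall>v\<in>ball u e. R v)) \<longleftrightarrow> A \<and> (\<forall>\<^sub>F v in nhds u. R v)"
    for A and R :: "'a \<Rightarrow> bool" and u
    by (auto simp: eventually_nhds_metric dist_commute)
  then show ?thesis unfolding analytic_map_def by (simp only:)
qed

section \<open>Coordinates \<open>(g, v, \<phi>, k)\<close> for weak automorphisms\<close>

abbreviation sd_mult :: "'t::real_vector \<times> int \<Rightarrow> 't \<times> int \<Rightarrow> 't \<times> int" (infixl \<open>\<star>\<close> 70) where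
  "p \<star> q \<equiv> p \<otimes>\<^bsub>semidirect_sign_group\<^esub> q"

lemma sd_mult_Pair [simp]: "(x, \<epsilon>) \<star> (y, \<delta>) = (x + of_int \<epsilon> *\<^sub>R y, \<epsilon> * \<delta>)"
  by (simp add: semidirect_sign_group_def)

lemma mult_G0_Theta': "p \<otimes>\<^bsub>G0 (Theta' L J)\<^esub> q = p \<star> q"
  by (simp add: Theta'_def)

text \<open>For linear \<open>g\<close> this is the endomorphism \<open>g\<close> of the semidirect
  product followed by conjugation with the translation by \<open>v/2\<close>, which moves only the
  component of \<open>-1\<close>.\<close>

definition affine_sd :: "('t::real_vector \<Rightarrow> 't) \<Rightarrow> 't \<Rightarrow> 't \<times> int \<Rightarrow> 't \<times> int" where
  "affine_sd g v p = (g (fst p) + (if snd p = -1 then v else 0), snd p)"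

lemma affine_sd_Pair [simp]:
  "affine_sd g v (x, 1) = (g x, 1)" "affine_sd g v (x, -1) = (g x + v, -1)"
  by (simp_all add: affine_sd_def)

lemma affine_sd_mult:
  assumes "linear g" "p \<in> UNIV \<times> {1, -1}" "q \<in> UNIV \<times> {1, -1}"
  shows "affine_sd g v (p \<star> q) = affine_sd g v p \<star> affine_sd g v q"
  using assms by (auto simp: linear_add linear_diff linear_neg)

lemma affine_sd_mem [simp]: "p \<in> UNIV \<times> {1, -1} \<Longrightarrow> affine_sd g v p \<in> UNIV \<times> {1, -1}"
  by (auto simp: affine_sd_def)

lemma sd_mult_mem [simp]:
  "p \<in> UNIV \<times> {1, -1} \<Longrightarrow> q \<in> UNIV \<times> {1, -1} \<Longrightarrow> p \<star> q \<in> UNIV \<times> {1, -1}"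
  by auto

lemma sd_mult_one [simp]: "p \<star> (0, 1) = p" "(0, 1) \<star> p = p"
  by (cases p; simp)+

text \<open>The coordinates determine the triple \<open>(f0, f1, \<kappa>)\<close>:
  \<open>f1\<close> shifts the circle by \<open>\<phi> m\<close> because it fixes the kernel of
  \<open>bd\<close>, and \<open>\<kappa>\<close> keeps only a circle component.\<close>

definition weak_map ::
    "'t::real_vector set \<Rightarrow> ('t \<Rightarrow> 't) \<Rightarrow> 't \<Rightarrow> ('t \<Rightarrow> circle) \<Rightarrow> ('t \<times> int \<Rightarrow> 't \<times> int \<Rightarrow> circle) \<Rightarrow>
      ('t \<times> circle, 't \<times> int) wmap" where
  "weak_map L g v \<phi> k =
    (\<lambda>p\<in>UNIV \<times> {1, -1}. affine_sd g v p,
     \<lambda>(m, a)\<in>L \<times> UNIV. (g m, a + \<phi> m),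
     \<lambda>(p, q)\<in>(UNIV \<times> {1, -1}) \<times> (UNIV \<times> {1, -1}). (0, k p q))"

text \<open>The pairs form four copies of a vector space; on each the cochain has to be
  analytic.\<close>

definition analytic_cochain :: "('t::real_normed_vector \<times> int \<Rightarrow> 't \<times> int \<Rightarrow> circle) \<Rightarrow> bool" where
  "analytic_cochain k \<longleftrightarrow>
    (\<forall>\<epsilon>\<in>{1, -1}. \<forall>\<delta>\<in>{1, -1}. circle_analytic (\<lambda>(u, v). k (u, \<epsilon>) (v, \<delta>)))"

lemma analytic_cochain_compose:
  assumes "analytic_cochain k" and g: "bounded_linear g"
  shows "analytic_cochain (\<lambda>p q. k (affine_sd g v p) (affine_sd g v q))"
  unfolding analytic_cochain_def
proof (intro ballI)
  fix \<epsilon> \<delta> :: int assume \<epsilon>\<delta>: "\<epsilon> \<in> {1, -1}" "\<delta> \<in> {1, -1}"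
  have A: "bounded_linear (\<lambda>z. (g (fst z), g (snd z)))"
    by (intro bounded_linear_Pair bounded_linear_compose[OF g] bounded_linear_fst bounded_linear_snd)
  have "circle_analytic (\<lambda>z. (\<lambda>(u, w). k (u, \<epsilon>) (w, \<delta>))
      (g (fst z) + (if \<epsilon> = -1 then v else 0), g (snd z) + (if \<delta> = -1 then v else 0)))"
    by (rule circle_analytic_compose_affine[OF _ A, where
          c = "(if \<epsilon> = -1 then v else 0, if \<delta> = -1 then v else 0)"])
       (use assms(1) \<epsilon>\<delta> in \<open>auto simp: analytic_cochain_def\<close>)
  then show "circle_analytic (\<lambda>(u, w). k (affine_sd g v (u, \<epsilon>)) (affine_sd g v (w, \<delta>)))"
    by (simp only: affine_sd_def case_prod_beta' fst_conv snd_conv)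
qed

lemma analytic_cochain_add:
  assumes "analytic_cochain k" "analytic_cochain k'"
  shows "analytic_cochain (\<lambda>p q. k p q + k' p q)"
  using assms unfolding analytic_cochain_def case_prod_beta by (simp add: circle_analytic_add)

lemma analytic_cochain_minus:
  assumes "analytic_cochain k"
  shows "analytic_cochain (\<lambda>p q. - k p q)"
  using assms unfolding analytic_cochain_def case_prod_beta by (simp add: circle_analytic_minus)

locale theta_data =
  fixes L :: "'t::real_normed_vector set" and J :: "'t \<Rightarrow> 't \<Rightarrow> real"
  assumes L: "full_lattice L" and J: "bilinear J"
    and J_Ints: "\<And>m n. m \<in> L \<Longrightarrow> n \<in> L \<Longrightarrow> J m n \<in> \<int>"
begin

abbreviation "\<Theta> \<equiv> Theta' L J"
abbreviation "W \<equiv> wAct_plus0 \<Theta>"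
abbreviation S :: "('t \<times> int) set" where "S \<equiv> UNIV \<times> {1, -1}"

lemmas L_closed = full_latticeD[OF L]

lemma L_0 [simp]: "0 \<in> L" and L_add [simp]: "m \<in> L \<Longrightarrow> n \<in> L \<Longrightarrow> m + n \<in> L"
  and L_minus [simp]: "m \<in> L \<Longrightarrow> - m \<in> L"
  by (rule L_closed | assumption)+

lemma J_simps [simp]:
  "J (x + y) z = J x z + J y z" "J z (x + y) = J z x + J z y"
  "J (x - y) z = J x z - J y z" "J z (x - y) = J z x - J z y"
  "J (- x) z = - J x z" "J z (- x) = - J z x" "J 0 z = 0" "J z 0 = 0"
  using J by (simp_all add: bilinear_ladd bilinear_radd bilinear_lsub bilinear_rsub bilinear_lneg
      bilinear_rneg bilinear_lzero bilinear_rzero)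

lemma circle_of_J [simp]: "m \<in> L \<Longrightarrow> n \<in> L \<Longrightarrow> circle_of (J m n) = 0"
  by (simp add: circle_of_Ints J_Ints)

lemma linear_bounded:
  assumes "linear (f :: 't \<Rightarrow> 'b::real_normed_vector)" shows "bounded_linear f"
  using L finite_dim_linear_imp_bounded_linear[OF _ _ _ assms] unfolding full_lattice_def by blast

lemma bilinear_bounded:
  assumes "bilinear (h :: 't \<Rightarrow> 't \<Rightarrow> 'b::real_normed_vector)" shows "bounded_bilinear h"
  using L finite_dim_bilinear_imp_bounded_bilinear[OF _ _ _ assms] unfolding full_lattice_def by blast

text \<open>
  The last three conditions are the circle components of the axioms for \<open>\<kappa>\<close>; the lattice
  component of \<open>\<kappa>\<close> is locally constant and turns out to vanish.
\<close>

definition weak_data :: "('t \<Rightarrow> 't) \<Rightarrow> 't \<Rightarrow> ('t \<Rightarrow> circle) \<Rightarrow> ('t \<times> int \<Rightarrow> 't \<times> int \<Rightarrow> circle) \<Rightarrow> bool"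
  where
  "weak_data g v \<phi> k \<longleftrightarrow>
     linear g \<and> bij g \<and> g ` L = L \<and> analytic_cochain k \<and> \<phi> 0 = 0 \<and>
     (\<forall>p\<in>S. \<forall>q\<in>S. \<forall>r\<in>S. k p q + k (p \<star> q) r = k q r + k p (q \<star> r)) \<and>
     (\<forall>m\<in>L. \<forall>n\<in>L. \<phi> m + \<phi> n + k (m, 1) (n, 1) = \<phi> (m + n)) \<and>
     (\<forall>m\<in>L. \<forall>y. \<forall>\<epsilon>\<in>{1, -1}.
        \<phi> m + circle_of (J (g m) (fst (affine_sd g v (y, \<epsilon>)))) + k (m, 1) (y, \<epsilon>) =
        \<phi> (of_int \<epsilon> *\<^sub>R m) + circle_of (J m y) + k (y, \<epsilon>) (of_int \<epsilon> *\<^sub>R m, 1))"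

lemma weak_dataD:
  assumes "weak_data g v \<phi> k"
  shows "linear g" "bij g" "g ` L = L" "analytic_cochain k" "\<phi> 0 = 0"
    "\<And>p q r. p \<in> S \<Longrightarrow> q \<in> S \<Longrightarrow> r \<in> S \<Longrightarrow> k p q + k (p \<star> q) r = k q r + k p (q \<star> r)"
    "\<And>m n. m \<in> L \<Longrightarrow> n \<in> L \<Longrightarrow> \<phi> m + \<phi> n + k (m, 1) (n, 1) = \<phi> (m + n)"
    "\<And>m y \<epsilon>. m \<in> L \<Longrightarrow> \<epsilon> \<in> {1, -1} \<Longrightarrow>
        \<phi> m + circle_of (J (g m) (fst (affine_sd g v (y, \<epsilon>)))) + k (m, 1) (y, \<epsilon>) =
        \<phi> (of_int \<epsilon> *\<^sub>R m) + circle_of (J m y) + k (y, \<epsilon>) (of_int \<epsilon> *\<^sub>R m, 1)"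
    "m \<in> L \<Longrightarrow> g m \<in> L" "g 0 = 0"
  using assms by (auto simp: weak_data_def linear_0)

text \<open>The condition for \<open>\<phi>\<close> at \<open>m = n = 0\<close> gives
  \<open>k (0, 1) (0, 1) = 0\<close>, and the cocycle identity spreads this to all pairs that
  contain the unit.\<close>

lemma weak_data_norm:
  assumes k: "weak_data g v \<phi> k" and p: "p \<in> S"
  shows "k p (0, 1) = 0" "k (0, 1) p = 0"
proof -
  have 1: "k (0, 1) (0, 1) = 0"
    using weak_dataD(7)[OF k, of 0 0] weak_dataD(5)[OF k] by simp
  show "k p (0, 1) = 0"
    using weak_dataD(6)[OF k, of p "(0, 1)" "(0, 1)"] p 1 by simp
  show "k (0, 1) p = 0"
    using weak_dataD(6)[OF k, of "(0, 1)" "(0, 1)" p] p 1 by simp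
qed

lemma scale_sign_mem [simp]: "m \<in> L \<Longrightarrow> \<epsilon> \<in> {1, -1} \<Longrightarrow> of_int \<epsilon> *\<^sub>R m \<in> L"
  by auto

lemma linear_inv_bij:
  assumes "linear (g :: 't \<Rightarrow> 't)" "bij g" shows "linear (inv_into UNIV g)"
proof (rule linearI)
  have inj: "inj g" using assms(2) by (rule bij_is_inj)
  have g: "g (inv_into UNIV g x) = x" for x
    using assms(2) by (simp add: bij_is_surj surj_f_inv_f)
  show "inv_into UNIV g (x + y) = inv_into UNIV g x + inv_into UNIV g y" for x y
    by (rule injD[OF inj]) (simp add: g linear_add[OF assms(1)])
  show "inv_into UNIV g (c *\<^sub>R x) = c *\<^sub>R inv_into UNIV g x" for c x
    by (rule injD[OF inj]) (simp add: g linear_scale[OF assms(1)])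
qed

lemma affine_sd_inv:
  assumes "linear (g :: 't \<Rightarrow> 't)" "bij g" "p \<in> S"
  shows "affine_sd (inv_into UNIV g) (- inv_into UNIV g v) (affine_sd g v p) = p"
    "affine_sd g v (affine_sd (inv_into UNIV g) (- inv_into UNIV g v) p) = p"
  using assms(3) linear_inv_bij[OF assms(1,2)] assms(1,2)
  by (auto simp: linear_add linear_diff linear_neg bij_is_inj bij_is_surj surj_f_inv_f)

lemma analytic_map_affine_sd:
  assumes "linear g" and f: "\<And>p. p \<in> S \<Longrightarrow> f p = affine_sd g v p"
  shows "analytic_map (charts0 \<Theta>) (charts0 \<Theta>) f"
  unfolding analytic_map_eventually
proof (intro ballI allI)
  fix p :: "'t \<Rightarrow> 't \<times> int" and u assume p: "p \<in> charts0 \<Theta>"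
  then obtain \<epsilon> where \<epsilon>: "p = (\<lambda>x. (x, \<epsilon>))" "\<epsilon> \<in> {1, -1}" by auto
  have "real_analytic_at (\<lambda>x. g x + (if \<epsilon> = -1 then v else 0)) u"
    by (intro real_analytic_at_affine linear_bounded assms)
  moreover have "f (p y) = p (g y + (if \<epsilon> = -1 then v else 0))" for y
    using \<epsilon>(2) f[of "p y"] unfolding \<epsilon>(1) affine_sd_def by auto
  ultimately show "\<exists>q\<in>charts0 \<Theta>. \<exists>h. real_analytic_at h u \<and> (\<forall>\<^sub>F y in nhds u. f (p y) = q (h y))"
    using p by (intro bexI[of _ p]) auto
qed

text \<open>A chart of \<open>G1\<close> fixes the lattice component \<open>m\<close>, so
  \<open>\<phi>\<close> enters only through the constant \<open>\<phi> m\<close> and may be any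
  function on \<open>L\<close>.\<close>

lemma analytic_map_G1:
  assumes "g ` L \<subseteq> L" and f: "\<And>m a. m \<in> L \<Longrightarrow> f (m, a) = (g m, a + \<phi> m)"
  shows "analytic_map (charts1 \<Theta>) (charts1 \<Theta>) f"
  unfolding analytic_map_eventually
proof (intro ballI allI)
  fix p :: "real \<Rightarrow> 't \<times> circle" and u assume p: "p \<in> charts1 \<Theta>"
  then obtain m where m: "p = (\<lambda>s. (m, circle_of s))" "m \<in> L" by auto
  obtain c where c: "\<phi> m = circle_of c" using circle_of_surj by blast
  have "real_analytic_at (\<lambda>s. s + c) u"
    using real_analytic_at_affine[OF bounded_linear_ident] .
  moreover have "f (p s) = (g m, circle_of (s + c))" for s
    using m by (simp add: f c circle_of_add)
  ultimately show "\<exists>q\<in>charts1 \<Theta>. \<exists>h. real_analytic_at h u \<and> (\<forall>\<^sub>F y in nhds u. f (p y) = q (h y))"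
    using m(2) assms(1) by (intro bexI[of _ "\<lambda>s. (g m, circle_of s)"]) auto
qed

text \<open>As \<open>\<kappa>\<close> has lattice component 0, the action leaves it fixed and its
  boundary is the unit. The axioms thereby reduce to their circle components, which are the
  conditions of \<open>weak_data\<close>, and to \<open>affine_sd\<close> being a
  homomorphism.\<close>

lemma weak_map_in_W:
  assumes d: "weak_data g v \<phi> k"
  shows "weak_map L g v \<phi> k \<in> carrier W"
proof -
  note D = weak_dataD[OF d]
  note N = weak_data_norm[OF d]
  define f0 where "f0 = (\<lambda>p\<in>S. affine_sd g v p)"
  define f1 where "f1 = (\<lambda>(m, a)\<in>L \<times> UNIV. (g m, a + \<phi> m))"
  define \<kappa> where "\<kappa> = (\<lambda>(p, q)\<in>S \<times> S. (0 :: 't, k p q))"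
  have f0: "f0 p = affine_sd g v p" if "p \<in> S" for p using that by (simp only: f0_def restrict_apply')
  have f1: "f1 (m, a) = (g m, a + \<phi> m)" if "m \<in> L" for m a using that by (simp add: f1_def)
  have \<kappa>: "\<kappa> (p, q) = (0, k p q)" if "p \<in> S" "q \<in> S" for p q using that by (simp add: \<kappa>_def)
  have bij0: "bij_betw f0 S S"
    by (rule bij_betw_byWitness[where f' = "affine_sd (inv_into UNIV g) (- inv_into UNIV g v)"])
       (auto simp del: mem_Sigma_iff insert_iff simp: f0 affine_sd_inv[OF D(1,2)] image_subset_iff)
  have inv: "inv_into UNIV g m \<in> L" if "m \<in> L" for m
    using that D(2,3) by (metis bij_is_inj image_iff inv_f_f)
  have bij1: "bij_betw f1 (L \<times> UNIV) (L \<times> UNIV)"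
  proof (rule bij_betw_byWitness[where f' = "\<lambda>(m, a). (inv_into UNIV g m, a - \<phi> (inv_into UNIV g m))"])
    show "\<forall>a\<in>L \<times> UNIV. (case f1 a of (m, a) \<Rightarrow> (inv_into UNIV g m, a - \<phi> (inv_into UNIV g m))) = a"
      using D(2) by (auto simp: f1 bij_is_inj)
    show "\<forall>a\<in>L \<times> UNIV. f1 (case a of (m, a) \<Rightarrow> (inv_into UNIV g m, a - \<phi> (inv_into UNIV g m))) = a"
      using D(2) by (auto simp: f1 inv bij_is_surj surj_f_inv_f)
    show "f1 ` (L \<times> UNIV) \<subseteq> L \<times> UNIV" using D(9) by (auto simp: f1)
    show "(\<lambda>(m, a). (inv_into UNIV g m, a - \<phi> (inv_into UNIV g m))) ` (L \<times> UNIV) \<subseteq> L \<times> UNIV" using inv by auto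
  qed
  have we: "(f0, f1, \<kappa>) \<in> weak_endos \<Theta>"
    unfolding weak_endos_def kappa3_def mem_Collect_eq prod.case
  proof (intro conjI ballI)
    show "f0 \<in> carrier (G0 \<Theta>) \<rightarrow>\<^sub>E carrier (G0 \<Theta>)"
      unfolding f0_def Theta'_simps by (intro restrict_PiE_iff[THEN iffD2] ballI affine_sd_mem)
    show "f1 \<in> carrier (G1 \<Theta>) \<rightarrow>\<^sub>E carrier (G1 \<Theta>)"
      using D(9) by (auto simp: f1_def)
    show "\<kappa> \<in> carrier (G0 \<Theta>) \<times> carrier (G0 \<Theta>) \<rightarrow>\<^sub>E carrier (G1 \<Theta>)"
      by (auto simp: \<kappa>_def)
    show "f0 \<one>\<^bsub>G0 \<Theta>\<^esub> = \<one>\<^bsub>G0 \<Theta>\<^esub>" by (simp add: f0 D)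
    show "f1 \<one>\<^bsub>G1 \<Theta>\<^esub> = \<one>\<^bsub>G1 \<Theta>\<^esub>" by (simp add: f1 D)
    fix \<alpha> assume "\<alpha> \<in> carrier (G1 \<Theta>)"
    then obtain m a where \<alpha>: "\<alpha> = (m, a)" "m \<in> L" by auto
    then show "f0 (bd \<Theta> \<alpha>) = bd \<Theta> (f1 \<alpha>)" by (simp add: f0 f1)
    {
      fix \<beta> assume "\<beta> \<in> carrier (G1 \<Theta>)"
      then obtain n b where \<beta>: "\<beta> = (n, b)" "n \<in> L" by auto
      show "f1 \<alpha> \<otimes>\<^bsub>G1 \<Theta>\<^esub> f1 \<beta> \<otimes>\<^bsub>G1 \<Theta>\<^esub> \<kappa> (bd \<Theta> \<alpha>, bd \<Theta> \<beta>) = f1 (\<alpha> \<otimes>\<^bsub>G1 \<Theta>\<^esub> \<beta>)"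
        using \<alpha>(2) \<beta>(2) D(7)[of m n] by (simp add: \<alpha>(1) \<beta>(1) f1 \<kappa> linear_add[OF D(1)] algebra_simps)
    next
      fix x assume "x \<in> carrier (G0 \<Theta>)"
      then obtain y \<epsilon> where x: "x = (y, \<epsilon>)" "\<epsilon> \<in> {1, -1}" by auto
      have \<kappa>x: "\<kappa> ((m, 1), y, \<epsilon>) = (0, k (m, 1) (y, \<epsilon>))"
        "\<kappa> ((y, \<epsilon>), of_int \<epsilon> *\<^sub>R m, 1) = (0, k (y, \<epsilon>) (of_int \<epsilon> *\<^sub>R m, 1))"
        using x(2) by (auto simp: \<kappa>)
      have f0x: "f0 (y, \<epsilon>) = (fst (affine_sd g v (y, \<epsilon>)), \<epsilon>)"
        using x(2) by (simp add: f0 affine_sd_def)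
      show "act \<Theta> (f1 \<alpha>) (f0 x) \<otimes>\<^bsub>G1 \<Theta>\<^esub> \<kappa> (bd \<Theta> \<alpha>, x) =
          f1 (act \<Theta> \<alpha> x) \<otimes>\<^bsub>G1 \<Theta>\<^esub> \<kappa> (x, bd \<Theta> (act \<Theta> \<alpha> x))"
        using \<alpha>(2) x(2) D(8)[of m \<epsilon> y] D(9) \<kappa>x
        by (simp add: x(1) \<alpha>(1) f1 f0x linear_scale[OF D(1)] add_ac del: insert_iff)
    }
  next
    fix x y z assume "x \<in> carrier (G0 \<Theta>)" "y \<in> carrier (G0 \<Theta>)"
    then have S: "x \<in> S" "y \<in> S" by simp_all
    then show "f0 x \<otimes>\<^bsub>G0 \<Theta>\<^esub> f0 y \<otimes>\<^bsub>G0 \<Theta>\<^esub> bd \<Theta> (\<kappa> (x, y)) = f0 (x \<otimes>\<^bsub>G0 \<Theta>\<^esub> y)"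
      by (simp add: f0 \<kappa> mult_G0_Theta' affine_sd_mult[OF D(1)] del: mem_Sigma_iff insert_iff)
    assume "z \<in> carrier (G0 \<Theta>)"
    then have z: "z \<in> S" by simp
    obtain w \<delta> where w: "f0 z = (w, \<delta>)" by fastforce
    show "act \<Theta> (\<kappa> (x, y)) (f0 z) \<otimes>\<^bsub>G1 \<Theta>\<^esub> \<kappa> (x \<otimes>\<^bsub>G0 \<Theta>\<^esub> y, z) =
        \<kappa> (y, z) \<otimes>\<^bsub>G1 \<Theta>\<^esub> \<kappa> (x, y \<otimes>\<^bsub>G0 \<Theta>\<^esub> z)"
      using S z D(6)[OF S z]
      by (simp add: \<kappa> mult_G0_Theta' w circle_of_0 del: mem_Sigma_iff insert_iff)
  qed
  have an0: "analytic_map (charts0 \<Theta>) (charts0 \<Theta>) f0"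
    using D(1) f0 by (rule analytic_map_affine_sd)
  have an0': "analytic_map (charts0 \<Theta>) (charts0 \<Theta>) (inv_into S f0)"
  proof (rule analytic_map_affine_sd[OF linear_inv_bij[OF D(1,2)]])
    fix p assume p: "p \<in> S"
    have "f0 (affine_sd (inv_into UNIV g) (- inv_into UNIV g v) p) = p"
      using p by (simp add: f0 affine_sd_inv[OF D(1,2)] del: mem_Sigma_iff insert_iff)
    then show "inv_into S f0 p = affine_sd (inv_into UNIV g) (- inv_into UNIV g v) p"
      using p bij0 by (intro inv_into_f_eq affine_sd_mem) (auto simp: bij_betw_def)
  qed
  have an1: "analytic_map (charts1 \<Theta>) (charts1 \<Theta>) f1"
    using D(3) f1 by (intro analytic_map_G1) auto
  have an1': "analytic_map (charts1 \<Theta>) (charts1 \<Theta>) (inv_into (L \<times> UNIV) f1)"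
  proof (rule analytic_map_G1)
    show "inv_into UNIV g ` L \<subseteq> L" using inv by auto
    fix m a assume m: "m \<in> L"
    show "inv_into (L \<times> UNIV) f1 (m, a) = (inv_into UNIV g m, a + - \<phi> (inv_into UNIV g m))"
      using m bij1 inv[OF m] D(2) by (intro inv_into_f_eq) (auto simp: bij_betw_def f1 bij_is_surj surj_f_inv_f)
  qed
  have an\<kappa>: "analytic_map (prod_charts (charts0 \<Theta>) (charts0 \<Theta>)) (charts1 \<Theta>) \<kappa>"
    unfolding analytic_map_eventually
  proof (intro ballI allI)
    fix p :: "'t \<times> 't \<Rightarrow> ('t \<times> int) \<times> ('t \<times> int)" and u
    assume "p \<in> prod_charts (charts0 \<Theta>) (charts0 \<Theta>)"
    then obtain \<epsilon> \<delta> where p: "p = map_prod (\<lambda>x. (x, \<epsilon>)) (\<lambda>x. (x, \<delta>))" "\<epsilon> \<in> {1, -1}" "\<delta> \<in> {1, -1}"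
      by (auto simp: prod_charts_def)
    then obtain h where h: "real_analytic_at h u"
      "\<forall>\<^sub>F z in nhds u. (\<lambda>(u, v). k (u, \<epsilon>) (v, \<delta>)) z = circle_of (h z)"
      using D(4) unfolding analytic_cochain_def circle_analytic_def by blast
    have "\<forall>\<^sub>F z in nhds u. \<kappa> (p z) = (0, circle_of (h z))"
      using h(2) by eventually_elim (use p in \<open>auto simp: \<kappa>\<close>)
    with h(1) show "\<exists>q\<in>charts1 \<Theta>. \<exists>h. real_analytic_at h u \<and> (\<forall>\<^sub>F y in nhds u. \<kappa> (p y) = q (h y))"
      by (intro bexI[of _ "\<lambda>s. (0, circle_of s)"]) auto
  qed
  have "\<forall>\<alpha>\<in>xmod_pi1 \<Theta>. f1 \<alpha> = \<alpha>"
    by (auto simp: xmod_pi1_def kernel_def f1 D)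
  moreover have "weak_map L g v \<phi> k = (f0, f1, \<kappa>)"
    by (simp add: weak_map_def f0_def f1_def \<kappa>_def)
  ultimately show ?thesis
    using we bij0 bij1 an0 an0' an1 an1' an\<kappa>
    by (simp only: wAct_plus0_def partial_object.simps mem_Collect_eq prod.case Theta'_simps)
qed

end

lemma weak_map_cong:
  assumes "\<And>x. g x = g' x" "v = v'" "\<And>m. m \<in> L \<Longrightarrow> \<phi> m = \<phi>' m"
    "\<And>p q. p \<in> UNIV \<times> {1, -1} \<Longrightarrow> q \<in> UNIV \<times> {1, -1} \<Longrightarrow> k p q = k' p q"
  shows "weak_map L g v \<phi> k = weak_map L g' v' \<phi>' k'"
proof -
  have "g = g'" using assms(1) by auto
  then show ?thesis
    using assms(2-) by (auto simp: weak_map_def fun_eq_iff restrict_def)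
qed

section \<open>Composition, inverses and normal form\<close>

context theta_data begin

text \<open>The third argument of \<open>kappa3\<close> is the unit, so by
  \<open>weak_data_norm\<close> this factor collapses to a value of \<open>k\<close>: cochains add
  after pulling back along the inner map.\<close>

lemma weak_comp_weak_map:
  assumes d: "weak_data g v \<phi> k" and d': "weak_data g' v' \<phi>' k'"
  shows "weak_comp \<Theta> (weak_map L g v \<phi> k) (weak_map L g' v' \<phi>' k') =
    weak_map L (\<lambda>x. g (g' x)) (g v' + v) (\<lambda>m. \<phi>' m + \<phi> (g' m))
      (\<lambda>p q. k' p q + k (affine_sd g' v' p) (affine_sd g' v' q))"
proof -
  note D = weak_dataD[OF d] and D' = weak_dataD[OF d']
  have 1: "compose S (\<lambda>p\<in>S. affine_sd g v p) (\<lambda>p\<in>S. affine_sd g' v' p) =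
      (\<lambda>p\<in>S. affine_sd (\<lambda>x. g (g' x)) (g v' + v) p)"
    by (auto simp: fun_eq_iff compose_def restrict_def linear_add[OF D(1)])
  have 2: "compose (L \<times> UNIV) (\<lambda>(m, a)\<in>L \<times> UNIV. (g m, a + \<phi> m)) (\<lambda>(m, a)\<in>L \<times> UNIV. (g' m, a + \<phi>' m)) =
      (\<lambda>(m, a)\<in>L \<times> UNIV. (g (g' m), a + (\<phi>' m + \<phi> (g' m))))"
    using D'(9) by (auto simp: fun_eq_iff compose_def restrict_def add.assoc)
  show ?thesis
    unfolding weak_comp_def weak_map_def kappa3_def prod.case Theta'_simps 1 2
    by (auto simp: fun_eq_iff restrict_def mult_G0_Theta' D weak_data_norm[OF d] circle_of_0)
qed

lemma weak_data_comp:
  assumes d: "weak_data g v \<phi> k" and d': "weak_data g' v' \<phi>' k'"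
  shows "weak_data (\<lambda>x. g (g' x)) (g v' + v) (\<lambda>m. \<phi>' m + \<phi> (g' m))
      (\<lambda>p q. k' p q + k (affine_sd g' v' p) (affine_sd g' v' q))"
  unfolding weak_data_def
proof (intro conjI ballI allI)
  note D = weak_dataD[OF d] and D' = weak_dataD[OF d']
  show "linear (\<lambda>x. g (g' x))" using linear_compose[OF D'(1) D(1)] by (simp add: o_def)
  show "bij (\<lambda>x. g (g' x))" using bij_comp[OF D'(2) D(2)] by (simp add: o_def)
  show "(\<lambda>x. g (g' x)) ` L = L" using D(3) D'(3) by (metis image_image)
  show "analytic_cochain (\<lambda>p q. k' p q + k (affine_sd g' v' p) (affine_sd g' v' q))"
    by (intro analytic_cochain_add analytic_cochain_compose D D' linear_bounded)
  show "\<phi>' 0 + \<phi> (g' 0) = 0" by (simp add: D D')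
  fix m assume m: "m \<in> L"
  {
    fix n assume n: "n \<in> L"
    show "\<phi>' m + \<phi> (g' m) + (\<phi>' n + \<phi> (g' n)) +
        (k' (m, 1) (n, 1) + k (affine_sd g' v' (m, 1)) (affine_sd g' v' (n, 1))) =
        \<phi>' (m + n) + \<phi> (g' (m + n))"
      using D(7)[OF D'(9)[OF m] D'(9)[OF n]] D'(7)[OF m n]
      by (simp add: linear_add[OF D'(1)] add_ac)
  next
    fix y and \<epsilon> :: int assume \<epsilon>: "\<epsilon> \<in> {1, -1}"
    define z where "z = fst (affine_sd g' v' (y, \<epsilon>))"
    have z: "affine_sd g' v' (y, \<epsilon>) = (z, \<epsilon>)" by (simp add: z_def affine_sd_def)
    have comp: "fst (affine_sd (\<lambda>x. g (g' x)) (g v' + v) (y, \<epsilon>)) = fst (affine_sd g v (z, \<epsilon>))"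
      by (simp add: z_def affine_sd_def linear_add[OF D(1)] D(10))
    have [simp]: "affine_sd g' v' (m, 1) = (g' m, 1)"
      "affine_sd g' v' (of_int \<epsilon> *\<^sub>R m, 1) = (of_int \<epsilon> *\<^sub>R g' m, 1)"
      by (simp_all add: linear_scale[OF D'(1)])
    show "\<phi>' m + \<phi> (g' m) +
        circle_of (J (g (g' m)) (fst (affine_sd (\<lambda>x. g (g' x)) (g v' + v) (y, \<epsilon>)))) +
        (k' (m, 1) (y, \<epsilon>) + k (affine_sd g' v' (m, 1)) (affine_sd g' v' (y, \<epsilon>))) =
        \<phi>' (of_int \<epsilon> *\<^sub>R m) + \<phi> (g' (of_int \<epsilon> *\<^sub>R m)) + circle_of (J m y) +
        (k' (y, \<epsilon>) (of_int \<epsilon> *\<^sub>R m, 1) +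
         k (affine_sd g' v' (y, \<epsilon>)) (affine_sd g' v' (of_int \<epsilon> *\<^sub>R m, 1)))"
      using D(8)[OF D'(9)[OF m] \<epsilon>, of z] D'(8)[OF m \<epsilon>, of y]
      unfolding z comp fst_conv by (simp add: linear_scale[OF D'(1)] algebra_simps)
  }
next
  note D = weak_dataD[OF d] and D' = weak_dataD[OF d']
  fix p q r assume S: "p \<in> S" "q \<in> S" "r \<in> S"
  let ?A = "affine_sd g' v'"
  show "k' p q + k (?A p) (?A q) + (k' (p \<star> q) r + k (?A (p \<star> q)) (?A r)) =
      k' q r + k (?A q) (?A r) + (k' p (q \<star> r) + k (?A p) (?A (q \<star> r)))"
    unfolding affine_sd_mult[OF D'(1) S(1,2)] affine_sd_mult[OF D'(1) S(2,3)]
    using D'(6)[OF S] D(6)[OF affine_sd_mem[OF S(1)] affine_sd_mem[OF S(2)] affine_sd_mem[OF S(3)], of g' v']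
    by (simp add: algebra_simps del: mem_Sigma_iff insert_iff)
qed

definition weak_one :: "('t \<times> circle, 't \<times> int) wmap" where
  "weak_one = weak_map L (\<lambda>x. x) 0 (\<lambda>_. 0) (\<lambda>_ _. 0)"

lemma weak_data_one: "weak_data (\<lambda>x. x) 0 (\<lambda>_. 0) (\<lambda>_ _. 0)"
  by (auto simp: weak_data_def linear_iff bij_id[unfolded id_def] analytic_cochain_def case_prod_beta'
      circle_analytic_const affine_sd_def)

text \<open>The data come from solving the composition formula for the identity;
  \<open>affine_sd h (- h v)\<close> is the inverse of \<open>affine_sd g v\<close>.\<close>

lemma weak_data_inverse:
  assumes d: "weak_data g v \<phi> k"
  defines "h \<equiv> inv_into UNIV g"
  shows "weak_data h (- h v) (\<lambda>m. - \<phi> (h m)) (\<lambda>p q. - k (affine_sd h (- h v) p) (affine_sd h (- h v) q))"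
  unfolding weak_data_def
proof (intro conjI ballI allI)
  let ?A = "affine_sd h (- h v)"
  note D = weak_dataD[OF d]
  have gh: "g (h x) = x" for x
    using D(2) by (simp add: h_def bij_is_surj surj_f_inv_f)
  have hL: "h m \<in> L" if "m \<in> L" for m
    using that D(3) D(2) unfolding h_def by (metis bij_is_inj image_iff inv_f_f)
  show h: "linear h" unfolding h_def by (rule linear_inv_bij[OF D(1,2)])
  show "bij h" unfolding h_def by (rule bij_imp_bij_inv[OF D(2)])
  show "h ` L = L"
  proof
    show "L \<subseteq> h ` L"
      using D(9) D(2) unfolding h_def by (metis bij_is_inj image_eqI inv_f_f subsetI)
  qed (use hL in auto)
  show "analytic_cochain (\<lambda>p q. - k (?A p) (?A q))"
    by (intro analytic_cochain_minus analytic_cochain_compose D h linear_bounded)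
  show "- \<phi> (h 0) = 0" by (simp add: linear_0[OF h] D)
  fix m assume m: "m \<in> L"
  {
    fix n assume n: "n \<in> L"
    show "- \<phi> (h m) + - \<phi> (h n) + - k (?A (m, 1)) (?A (n, 1)) =
        - \<phi> (h (m + n))"
      by (simp add: linear_add[OF h] flip: D(7)[OF hL[OF m] hL[OF n]])
  next
    fix y and \<epsilon> :: int assume \<epsilon>: "\<epsilon> \<in> {1, -1}"
    define z where "z = fst (?A (y, \<epsilon>))"
    have z: "?A (y, \<epsilon>) = (z, \<epsilon>)" by (simp add: z_def affine_sd_def)
    have y: "fst (affine_sd g v (z, \<epsilon>)) = y"
      using \<epsilon> by (auto simp: z_def affine_sd_def linear_diff[OF D(1)] linear_add[OF D(1)] linear_0[OF D(1)]
          linear_neg[OF D(1)] gh)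
    have [simp]: "?A (m, 1) = (h m, 1)"
      "?A (of_int \<epsilon> *\<^sub>R m, 1) = (of_int \<epsilon> *\<^sub>R h m, 1)"
      by (simp_all add: linear_scale[OF h])
    show "- \<phi> (h m) + circle_of (J (h m) (fst (?A (y, \<epsilon>)))) +
        - k (?A (m, 1)) (?A (y, \<epsilon>)) =
        - \<phi> (h (of_int \<epsilon> *\<^sub>R m)) + circle_of (J m y) +
        - k (?A (y, \<epsilon>)) (?A (of_int \<epsilon> *\<^sub>R m, 1))"
      using D(8)[OF hL[OF m] \<epsilon>, of z]
      unfolding z fst_conv y gh by (simp add: linear_scale[OF h] algebra_simps)
  }
next
  note D = weak_dataD[OF d]
  have h: "linear h" unfolding h_def by (rule linear_inv_bij[OF D(1,2)])
  fix p q r assume S: "p \<in> S" "q \<in> S" "r \<in> S"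
  let ?A = "affine_sd h (- h v)"
  show "- k (?A p) (?A q) + - k (?A (p \<star> q)) (?A r) = - k (?A q) (?A r) + - k (?A p) (?A (q \<star> r))"
    unfolding affine_sd_mult[OF h S(1,2)] affine_sd_mult[OF h S(2,3)]
    using D(6)[OF affine_sd_mem[OF S(1)] affine_sd_mem[OF S(2)] affine_sd_mem[OF S(3)], of h "- h v"]
    by (metis minus_add_distrib add.commute)
qed

abbreviation W_mult (infixl \<open>\<cdot>\<close> 70) where "F \<cdot> G \<equiv> F \<otimes>\<^bsub>W\<^esub> G"

lemma mult_W: "F \<cdot> G = weak_comp \<Theta> F G"
  by (simp add: wAct_plus0_def)

lemma one_W: "\<one>\<^bsub>W\<^esub> = weak_one"
  by (auto simp: wAct_plus0_def weak_one_def weak_map_def fun_eq_iff restrict_def affine_sd_def)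

text \<open>A chart fixes the discrete component, which is thus locally constant on a connected
  space.\<close>

lemma eventually_sheet_constant:
  fixes f :: "'a::real_normed_vector \<Rightarrow> 'b \<times> 'c"
  assumes "\<And>u. \<exists>h. \<exists>c. \<forall>\<^sub>F v in nhds u. f v = (h v, c)"
  shows "snd (f x) = snd (f y)"
proof (rule eventually_constant_imp_constant)
  fix x
  obtain h c where hc: "\<forall>\<^sub>F v in nhds x. f v = (h v, c)" using assms by blast
  then show "\<forall>\<^sub>F y in nhds x. snd (f y) = snd (f x)"
    using eventually_nhds_x_imp_x[OF hc] by (auto elim: eventually_mono)
qed

text \<open>Once the lattice component of \<open>\<kappa>\<close> is known to vanish,
  \<open>f0\<close> is a continuous homomorphism. It is then linear on the identity component, and
  the image of \<open>(0, -1)\<close> determines the other one.\<close>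

lemma W_E:
  assumes "F \<in> carrier W"
  obtains g v \<phi> k where "weak_data g v \<phi> k" "F = weak_map L g v \<phi> k"
proof -
  obtain f0 f1 \<kappa> where F: "F = (f0, f1, \<kappa>)" by (cases F) auto
  have we: "(f0, f1, \<kappa>) \<in> weak_endos \<Theta>"
    and bij0: "bij_betw f0 S S" and bij1: "bij_betw f1 (L \<times> UNIV) (L \<times> UNIV)"
    and pi1: "\<And>\<alpha>. \<alpha> \<in> xmod_pi1 \<Theta> \<Longrightarrow> f1 \<alpha> = \<alpha>"
    and an0: "analytic_map (charts0 \<Theta>) (charts0 \<Theta>) f0"
    and an\<kappa>: "analytic_map (prod_charts (charts0 \<Theta>) (charts0 \<Theta>)) (charts1 \<Theta>) \<kappa>"
    using assms unfolding F wAct_plus0_def by simp_all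
  note E = we[unfolded weak_endos_def kappa3_def mem_Collect_eq prod.case Theta'_simps(1,3,4,6)]
  have f0_mem: "f0 p \<in> S" if "p \<in> S" for p using E that by (auto dest: PiE_mem)
  have f1_mem: "f1 (m, a) \<in> L \<times> UNIV" if "m \<in> L" for m a
    using E that by (meson PiE_mem UNIV_I mem_Sigma_iff)
  have \<kappa>_mem: "\<kappa> (p, q) \<in> L \<times> UNIV" if "p \<in> S" "q \<in> S" for p q
    using E that by (meson PiE_mem mem_Sigma_iff)
  have f0_ext: "f0 \<in> extensional S" and f1_ext: "f1 \<in> extensional (L \<times> UNIV)"
    and \<kappa>_ext: "\<kappa> \<in> extensional (S \<times> S)"
    using E by (auto simp: PiE_def)
  have f0_1: "f0 (0, 1) = (0, 1)" and f1_1: "f1 (0, 0) = (0, 0)" using E by auto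
  have bd: "(fst (f1 (m, a)), 1) = f0 (m, 1)" if "m \<in> L" for m a
  proof -
    have "f0 (bd \<Theta> (m, a)) = bd \<Theta> (f1 (m, a))" using E that by blast
    then show ?thesis by (cases "f1 (m, a)") simp
  qed
  have f0_mult: "f0 p \<star> f0 q \<star> (fst (\<kappa> (p, q)), 1) = f0 (p \<star> q)" if "p \<in> S" "q \<in> S" for p q
  proof -
    have "f0 p \<otimes>\<^bsub>G0 \<Theta>\<^esub> f0 q \<otimes>\<^bsub>G0 \<Theta>\<^esub> bd \<Theta> (\<kappa> (p, q)) = f0 (p \<otimes>\<^bsub>G0 \<Theta>\<^esub> q)"
      using E that by blast
    then show ?thesis by (cases "\<kappa> (p, q)") (simp add: mult_G0_Theta')
  qed
  have f1_mult: "f1 (m, a) \<otimes>\<^bsub>G1 \<Theta>\<^esub> f1 (n, b) \<otimes>\<^bsub>G1 \<Theta>\<^esub> \<kappa> ((m, 1), (n, 1)) = f1 (m + n, a + b)"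
    if "m \<in> L" "n \<in> L" for m n a b
  proof -
    have "f1 (m, a) \<otimes>\<^bsub>G1 \<Theta>\<^esub> f1 (n, b) \<otimes>\<^bsub>G1 \<Theta>\<^esub> \<kappa> (bd \<Theta> (m, a), bd \<Theta> (n, b)) =
        f1 ((m, a) \<otimes>\<^bsub>G1 \<Theta>\<^esub> (n, b))"
      using E that by blast
    then show ?thesis by simp
  qed
  have cocycle: "act \<Theta> (\<kappa> (p, q)) (f0 r) \<otimes>\<^bsub>G1 \<Theta>\<^esub> \<kappa> (p \<star> q, r) = \<kappa> (q, r) \<otimes>\<^bsub>G1 \<Theta>\<^esub> \<kappa> (p, q \<star> r)"
    if "p \<in> S" "q \<in> S" "r \<in> S" for p q r
  proof -
    have "act \<Theta> (\<kappa> (p, q)) (f0 r) \<otimes>\<^bsub>G1 \<Theta>\<^esub> \<kappa> (p \<otimes>\<^bsub>G0 \<Theta>\<^esub> q, r) =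
        \<kappa> (q, r) \<otimes>\<^bsub>G1 \<Theta>\<^esub> \<kappa> (p, q \<otimes>\<^bsub>G0 \<Theta>\<^esub> r)"
      using E that by blast
    then show ?thesis by (simp add: mult_G0_Theta')
  qed
  have act: "act \<Theta> (f1 (m, a)) (f0 (y, \<epsilon>)) \<otimes>\<^bsub>G1 \<Theta>\<^esub> \<kappa> ((m, 1), (y, \<epsilon>)) =
      f1 (of_int \<epsilon> *\<^sub>R m, a + circle_of (J m y)) \<otimes>\<^bsub>G1 \<Theta>\<^esub> \<kappa> ((y, \<epsilon>), (of_int \<epsilon> *\<^sub>R m, 1))"
    if "m \<in> L" "\<epsilon> \<in> {1, -1}" for m a y \<epsilon>
  proof -
    have "(m, a) \<in> L \<times> UNIV" "(y, \<epsilon>) \<in> S" using that by auto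
    then have "act \<Theta> (f1 (m, a)) (f0 (y, \<epsilon>)) \<otimes>\<^bsub>G1 \<Theta>\<^esub> \<kappa> (bd \<Theta> (m, a), (y, \<epsilon>)) =
        f1 (act \<Theta> (m, a) (y, \<epsilon>)) \<otimes>\<^bsub>G1 \<Theta>\<^esub> \<kappa> ((y, \<epsilon>), bd \<Theta> (act \<Theta> (m, a) (y, \<epsilon>)))"
      using E by blast
    then show ?thesis by simp
  qed
  define k where "k p q = snd (\<kappa> (p, q))" for p q
  define g where "g x = fst (f0 (x, 1))" for x
  define v where "v = fst (f0 (0, -1))"
  define \<phi> where "\<phi> m = snd (f1 (m, 0))" for m

  have local0: "\<exists>h. real_analytic_at h u \<and> (\<exists>\<delta>. \<forall>\<^sub>F y in nhds u. f0 (y, \<epsilon>) = (h y, \<delta>))"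
    if "\<epsilon> \<in> {1, -1}" for \<epsilon> u
  proof -
    have "(\<lambda>x. (x, \<epsilon>)) \<in> charts0 \<Theta>" using that by auto
    from an0[unfolded analytic_map_eventually, THEN bspec, OF this, THEN spec, of u]
    show ?thesis by auto
  qed
  have local\<kappa>: "\<exists>h m. real_analytic_at h u \<and>
      (\<forall>\<^sub>F z in nhds u. \<kappa> ((fst z, \<epsilon>), (snd z, \<delta>)) = (m, circle_of (h z)))"
    if "\<epsilon> \<in> {1, -1}" "\<delta> \<in> {1, -1}" for \<epsilon> \<delta> u
  proof -
    have "map_prod (\<lambda>x. (x, \<epsilon>)) (\<lambda>x. (x, \<delta>)) \<in> prod_charts (charts0 \<Theta>) (charts0 \<Theta>)"
      using that unfolding prod_charts_def Theta'_simps by blast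
    from an\<kappa>[unfolded analytic_map_eventually, THEN bspec, OF this, THEN spec, of u]
    show ?thesis by (auto simp: map_prod_def case_prod_beta)
  qed
  \<comment> \<open>Reduces the lattice component of \<open>\<kappa>\<close> to its values at the
    four pairs of base points.\<close>
  have \<kappa>_const: "fst (\<kappa> ((x, \<epsilon>), (y, \<delta>))) = fst (\<kappa> ((0, \<epsilon>), (0, \<delta>)))"
    if "\<epsilon> \<in> {1, -1}" "\<delta> \<in> {1, -1}" for \<epsilon> \<delta> x y
  proof -
    note \<epsilon>\<delta> = that
    have "snd (prod.swap (\<kappa> ((fst z, \<epsilon>), (snd z, \<delta>)))) = snd (prod.swap (\<kappa> ((fst z', \<epsilon>), (snd z', \<delta>))))"
      for z z'
    proof (rule eventually_sheet_constant)
      fix u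
      obtain h m where "\<forall>\<^sub>F z in nhds u. \<kappa> ((fst z, \<epsilon>), (snd z, \<delta>)) = (m, circle_of (h z))"
        using local\<kappa>[OF \<epsilon>\<delta>] by blast
      then have "\<forall>\<^sub>F z in nhds u. prod.swap (\<kappa> ((fst z, \<epsilon>), (snd z, \<delta>))) = (circle_of (h z), m)"
        by eventually_elim simp
      then show "\<exists>h c. \<forall>\<^sub>F z in nhds u. prod.swap (\<kappa> ((fst z, \<epsilon>), (snd z, \<delta>))) = (h z, c)"
        by (intro exI[of _ "\<lambda>z. circle_of (h z)"] exI[of _ m])
    qed
    from this[of "(x, y)" "(0, 0)"] show ?thesis by simp
  qed
  have sheet: "snd (f0 (x, \<epsilon>)) = snd (f0 (0, \<epsilon>))" if "\<epsilon> \<in> {1, -1}" for \<epsilon> x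
    by (rule eventually_sheet_constant[of "\<lambda>x. f0 (x, \<epsilon>)"]) (use local0[OF that] in blast)
  have \<kappa>11: "\<kappa> ((0, 1), (0, 1)) = (0, 0)"
    using f1_mult[of 0 0 0 0] f1_1 by (cases "\<kappa> ((0, 1), (0, 1))") simp
  have \<kappa>1: "\<kappa> ((0, 1), p) = (0, 0)" if p: "p \<in> S" for p
  proof -
    obtain y \<epsilon> where fp: "f0 p = (y, \<epsilon>)" by fastforce
    obtain m a where mp: "\<kappa> ((0, 1), p) = (m, a)" by fastforce
    show ?thesis
      using cocycle[of "(0, 1)" "(0, 1)" p] p by (simp add: \<kappa>11 fp mp circle_of_0)
  qed
  \<comment> \<open>The action axiom for the trivial arrow exchanges the two arguments and so
    transports the normalisation \<open>\<kappa>1\<close> to the other side.\<close>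
  have \<kappa>1': "\<kappa> (p, (0, 1)) = (0, 0)" if p: "p \<in> S" for p
  proof -
    obtain y \<epsilon> where fp: "p = (y, \<epsilon>)" "\<epsilon> \<in> {1, -1}" using p by auto
    obtain z \<delta> where fz: "f0 p = (z, \<delta>)" by fastforce
    obtain m a where mp: "\<kappa> (p, (0, 1)) = (m, a)" by fastforce
    show ?thesis
      using act[of 0 \<epsilon> 0 y] fp(2) \<kappa>1[OF p] mp fz unfolding fp(1) by (simp add: f1_1 circle_of_0)
  qed
  have c1: "fst (\<kappa> ((x, 1), (y, \<delta>))) = 0" if "\<delta> \<in> {1, -1}" for x y \<delta>
    using \<kappa>_const[of 1 \<delta> x y] \<kappa>1[of "(0, \<delta>)"] that by auto
  have c2: "fst (\<kappa> ((x, \<delta>), (y, 1))) = 0" if "\<delta> \<in> {1, -1}" for x y \<delta>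
    using \<kappa>_const[of \<delta> 1 x y] \<kappa>1'[of "(0, \<delta>)"] that by auto
  have f0_pos: "f0 (x, 1) = (g x, 1)" for x
    using sheet[of 1 x] f0_1 by (simp add: g_def prod_eq_iff)
  \<comment> \<open>If \<open>f0\<close> sent the component of \<open>-1\<close> to the identity
    component, it could not be surjective.\<close>
  have s_neg: "snd (f0 (x, -1)) = -1" for x
  proof (rule ccontr)
    assume "snd (f0 (x, -1)) \<noteq> -1"
    moreover have "f0 (x, -1) \<in> S" by (rule f0_mem) simp
    ultimately have s: "snd (f0 (0, -1)) = 1" using sheet[of "-1" x] by (auto simp: mem_Times_iff)
    have "(0, -1) \<in> f0 ` S" using bij0 by (simp add: bij_betw_def)
    then obtain p where "(0, -1) = f0 p" "p \<in> S" by (rule imageE)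
    then obtain y \<epsilon> where "\<epsilon> = 1 \<or> \<epsilon> = -1" "f0 (y, \<epsilon>) = (0, -1)" by (cases p) auto
    then show False using s sheet[of "-1" y] f0_pos[of y] by auto
  qed
  have g_add: "g (x + y) = g x + g y" for x y
    using f0_mult[of "(x, 1)" "(y, 1)"] by (simp add: f0_pos c1)
  have f0_v: "f0 (0, -1) = (v, -1)" using s_neg[of 0] by (simp add: v_def prod_eq_iff)
  have f0_neg: "f0 (x, -1) = (g x + v, -1)" for x
    using f0_mult[of "(x, 1)" "(0, -1)"] by (simp add: f0_pos c1 f0_v)
  have f0: "f0 p = affine_sd g v p" if "p \<in> S" for p
    using that f0_pos f0_neg by auto
  \<comment> \<open>The last base point: \<open>(0, -1)\<close> and its image \<open>(v, -1)\<close>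
    are both involutions, so \<open>f0_mult\<close> leaves no room for a lattice component.\<close>
  have "fst (\<kappa> ((0, -1), (0, -1))) = 0"
    using f0_mult[of "(0, -1)" "(0, -1)"] by (simp add: f0_v f0_1)
  then have c3: "fst (\<kappa> ((x, -1), (y, -1))) = 0" for x y
    using \<kappa>_const[of "-1" "-1" x y] by simp
  have \<kappa>_fst: "fst (\<kappa> (p, q)) = 0" if pq_S: "p \<in> S" "q \<in> S" for p q
  proof -
    obtain x \<epsilon> y \<delta> where pq: "p = (x, \<epsilon>)" "q = (y, \<delta>)" "\<epsilon> \<in> {1, -1}" "\<delta> \<in> {1, -1}"
      using pq_S by (cases p, cases q) auto
    consider "\<epsilon> = 1" | "\<delta> = 1" | "\<epsilon> = -1" "\<delta> = -1" using pq(3,4) by auto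
    then show ?thesis
      by cases (use c1[OF pq(4)] c2[OF pq(3)] c3 in \<open>simp_all add: pq(1,2)\<close>)
  qed
  then have \<kappa>: "\<kappa> (p, q) = (0, k p q)" if "p \<in> S" "q \<in> S" for p q
    using that by (simp add: k_def prod_eq_iff)
  have "continuous_on UNIV g"
    unfolding continuous_on_eq_continuous_at[OF open_UNIV]
  proof
    fix u
    obtain h \<delta> where h: "real_analytic_at h u" "\<forall>\<^sub>F y in nhds u. f0 (y, 1) = (h y, \<delta>)"
      using local0[of 1 u] by auto
    have "\<forall>\<^sub>F y in nhds u. h y = g y"
      using h(2) by eventually_elim (simp add: g_def)
    then have "real_analytic_at g u" by (rule real_analytic_at_cong[OF h(1)])
    then show "isCont g u" by (rule real_analytic_at_imp_isCont)
  qed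
  then have lin: "linear g" using g_add by (rule continuous_additive_imp_linear)
  have f1_fst: "fst (f1 (m, a)) = g m" if "m \<in> L" for m a
    using bd[OF that, of a] by (simp add: f0_pos)
  \<comment> \<open>Here the automorphism being centre preserving enters: the kernel of
    \<open>bd\<close> is the circle over \<open>0\<close>.\<close>
  have f1_0: "f1 (0, a) = (0, a)" for a
    by (rule pi1) (simp add: xmod_pi1_def kernel_def)
  have f1: "f1 (m, a) = (g m, a + \<phi> m)" if m: "m \<in> L" for m a
  proof -
    have "f1 (m, 0) = (g m, \<phi> m)" using f1_fst[OF m] by (simp add: \<phi>_def prod_eq_iff)
    then show ?thesis
      using f1_mult[OF m, of 0 0 a] m \<kappa>1'[of "(m, 1)"] by (simp add: f1_0 add.commute)
  qed
  have gL: "g m \<in> L" if "m \<in> L" for m using f1_mem[OF that, of 0] f1[OF that] by simp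
  have "weak_data g v \<phi> k"
    unfolding weak_data_def
  proof (intro conjI ballI allI)
    show "linear g" by (rule lin)
    have "inj g"
    proof (rule injI)
      fix x y assume "g x = g y"
      then have "f0 (x, 1) = f0 (y, 1)" by (simp add: f0_pos)
      then show "x = y" using bij0 by (auto simp: bij_betw_def dest: inj_onD)
    qed
    moreover have "\<exists>x. g x = y" for y
    proof -
      have "(y, 1) \<in> f0 ` S" using bij0 by (auto simp: bij_betw_def)
      then obtain p where "(y, 1) = f0 p" "p \<in> S" by (rule imageE)
      then show ?thesis using f0_pos f0_neg by auto
    qed
    ultimately show "bij g" by (metis bijI surjI surj_def)
    show "g ` L = L"
    proof
      show "L \<subseteq> g ` L"
      proof
        fix m assume "m \<in> L"
        then have "(m, 0) \<in> f1 ` (L \<times> UNIV)" using bij1 by (auto simp: bij_betw_def)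
        then show "m \<in> g ` L" using f1 by auto
      qed
    qed (use gL in auto)
    show "analytic_cochain k"
      unfolding analytic_cochain_def circle_analytic_def
    proof (intro ballI allI)
      fix \<epsilon> \<delta> :: int and u assume "\<epsilon> \<in> {1, -1}" "\<delta> \<in> {1, -1}"
      then obtain h m where h: "real_analytic_at h u"
        "\<forall>\<^sub>F z in nhds u. \<kappa> ((fst z, \<epsilon>), (snd z, \<delta>)) = (m, circle_of (h z))"
        using local\<kappa> by meson
      have "\<forall>\<^sub>F z in nhds u. (case z of (u, v) \<Rightarrow> k (u, \<epsilon>) (v, \<delta>)) = circle_of (h z)"
        using h(2) by eventually_elim (simp add: k_def case_prod_beta)
      with h(1) show "\<exists>h. real_analytic_at h u \<and>
          (\<forall>\<^sub>F z in nhds u. (case z of (u, v) \<Rightarrow> k (u, \<epsilon>) (v, \<delta>)) = circle_of (h z))"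
        by blast
    qed
    show "\<phi> 0 = 0" by (simp add: \<phi>_def f1_1)
    show "k p q + k (p \<star> q) r = k q r + k p (q \<star> r)" if S: "p \<in> S" "q \<in> S" "r \<in> S" for p q r
    proof -
      obtain y \<epsilon> where "f0 r = (y, \<epsilon>)" by fastforce
      then show ?thesis
        using cocycle[OF S] S
        by (simp add: \<kappa> circle_of_0 del: mem_Sigma_iff insert_iff)
    qed
    show "\<phi> m + \<phi> n + k (m, 1) (n, 1) = \<phi> (m + n)" if "m \<in> L" "n \<in> L" for m n
      using f1_mult[OF that, of 0 0] that by (simp add: f1 \<kappa>)
    show "\<phi> m + circle_of (J (g m) (fst (affine_sd g v (y, \<epsilon>)))) + k (m, 1) (y, \<epsilon>) =
        \<phi> (of_int \<epsilon> *\<^sub>R m) + circle_of (J m y) + k (y, \<epsilon>) (of_int \<epsilon> *\<^sub>R m, 1)"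
      if m: "m \<in> L" and \<epsilon>: "\<epsilon> \<in> {1, -1}" for m y \<epsilon>
    proof -
      have S: "(y, \<epsilon>) \<in> S" "(m, 1) \<in> S" "(of_int \<epsilon> *\<^sub>R m, 1) \<in> S" using \<epsilon> by auto
      have "f0 (y, \<epsilon>) = (fst (affine_sd g v (y, \<epsilon>)), \<epsilon>)"
        using S(1) by (simp add: f0 affine_sd_def del: mem_Sigma_iff insert_iff)
      then show ?thesis
        using act[OF m \<epsilon>, of 0 y] m \<epsilon> scale_sign_mem[OF m \<epsilon>]
        by (simp add: f1 \<kappa>[OF S(2,1)] \<kappa>[OF S(1,3)] add_ac del: insert_iff)
    qed
  qed
  moreover have "F = weak_map L g v \<phi> k"
  proof -
    have "f0 = (\<lambda>p\<in>S. affine_sd g v p)"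
      by (rule extensionalityI[OF f0_ext]) (use f0 in auto)
    moreover have "f1 = (\<lambda>(m, a)\<in>L \<times> UNIV. (g m, a + \<phi> m))"
      by (rule extensionalityI[OF f1_ext]) (use f1 in auto)
    moreover have "\<kappa> = (\<lambda>(p, q)\<in>S \<times> S. (0, k p q))"
      by (rule extensionalityI[OF \<kappa>_ext]) (use \<kappa> in auto)
    ultimately show ?thesis by (simp add: F weak_map_def)
  qed
  ultimately show thesis by (rule that)
qed

end

section \<open>The group of weak automorphisms and its inner part\<close>

lemma affine_sd_affine_sd:
  assumes "linear g" "p \<in> UNIV \<times> {1, -1}"
  shows "affine_sd g v (affine_sd g' v' p) = affine_sd (\<lambda>x. g (g' x)) (g v' + v) p"
  using assms(2) by (auto simp: linear_add[OF assms(1)])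

text \<open>The circle component of a pointed map \<open>\<eta>\<close>, whose lattice component is
  a single vector \<open>l\<close> attached to the component of \<open>-1\<close>.\<close>

definition analytic_potential :: "('t::real_normed_vector \<times> int \<Rightarrow> circle) \<Rightarrow> bool" where
  "analytic_potential c \<longleftrightarrow> c (0, 1) = 0 \<and> (\<forall>\<epsilon>\<in>{1, -1}. circle_analytic (\<lambda>u. c (u, \<epsilon>)))"

lemma analytic_potential_compose:
  assumes "analytic_potential c" and g: "bounded_linear g"
  shows "analytic_potential (\<lambda>p. c (affine_sd g v p))"
  unfolding analytic_potential_def
proof (intro conjI ballI)
  show "c (affine_sd g v (0, 1)) = 0"
    using assms by (simp add: analytic_potential_def linear_0 bounded_linear.linear)
  fix \<epsilon> :: int assume "\<epsilon> \<in> {1, -1}"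
  then have "circle_analytic (\<lambda>u. c (u, \<epsilon>))" using assms(1) by (auto simp: analytic_potential_def)
  then have "circle_analytic (\<lambda>u. (\<lambda>u. c (u, \<epsilon>)) (g u + (if \<epsilon> = -1 then v else 0)))"
    by (rule circle_analytic_compose_affine[OF _ g]) simp
  then show "circle_analytic (\<lambda>u. c (affine_sd g v (u, \<epsilon>)))"
    by (simp only: affine_sd_def fst_conv snd_conv)
qed

lemma analytic_potential_add:
  "analytic_potential c \<Longrightarrow> analytic_potential d \<Longrightarrow> analytic_potential (\<lambda>p. c p + d p)"
  by (simp add: analytic_potential_def circle_analytic_add)

lemma analytic_potential_minus:
  "analytic_potential c \<Longrightarrow> analytic_potential (\<lambda>p. - c p)"
  by (simp add: analytic_potential_def circle_analytic_minus)

lemma analytic_cochain_coboundary: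
  fixes c :: "'t::real_normed_vector \<times> int \<Rightarrow> circle"
  assumes "analytic_potential c"
  shows "analytic_cochain (\<lambda>p q. c (p \<star> q) - c p - c q)"
  unfolding analytic_cochain_def
proof (intro ballI)
  fix \<epsilon> \<delta> :: int assume \<epsilon>\<delta>: "\<epsilon> \<in> {1, -1}" "\<delta> \<in> {1, -1}"
  then have "\<epsilon> * \<delta> \<in> {1, -1}" by auto
  then have c: "circle_analytic (\<lambda>u. c (u, \<epsilon>))" "circle_analytic (\<lambda>u. c (u, \<delta>))"
    "circle_analytic (\<lambda>u. c (u, \<epsilon> * \<delta>))"
    using assms \<epsilon>\<delta> unfolding analytic_potential_def by blast+
  have "circle_analytic (\<lambda>z :: 't \<times> 't. c (fst z + of_int \<epsilon> *\<^sub>R snd z, \<epsilon> * \<delta>))"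
    by (rule circle_analytic_compose_affine[OF c(3), where c = 0 and A = "\<lambda>z. fst z + of_int \<epsilon> *\<^sub>R snd z"])
       (auto intro!: bounded_linear_add bounded_linear_fst bounded_linear_snd
         bounded_linear_compose[OF bounded_linear_scaleR_right])
  moreover have "circle_analytic (\<lambda>z :: 't \<times> 't. c (fst z, \<epsilon>))"
    by (rule circle_analytic_compose_affine[OF c(1) bounded_linear_fst, where c = 0]) simp
  moreover have "circle_analytic (\<lambda>z :: 't \<times> 't. c (snd z, \<delta>))"
    by (rule circle_analytic_compose_affine[OF c(2) bounded_linear_snd, where c = 0]) simp
  ultimately show "circle_analytic (\<lambda>(u, v). c ((u, \<epsilon>) \<star> (v, \<delta>)) - c (u, \<epsilon>) - c (v, \<delta>))"
    by (simp only: sd_mult_Pair case_prod_beta' circle_analytic_diff)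
qed

context theta_data begin

lemma group_W: "group W"
proof (rule groupI)
  fix F assume "F \<in> carrier W"
  then obtain g v \<phi> k where d: "weak_data g v \<phi> k" and F: "F = weak_map L g v \<phi> k" by (rule W_E)
  note D = weak_dataD[OF d]
  note inv = weak_data_inverse[OF d]
  have inv_g: "inv_into UNIV g (g x) = x" for x using D(2) by (simp add: bij_is_inj)
  show "\<one>\<^bsub>W\<^esub> \<cdot> F = F"
    unfolding F one_W mult_W weak_one_def weak_comp_weak_map[OF weak_data_one d]
    by (rule weak_map_cong) auto
  have "weak_comp \<Theta> (weak_map L (inv_into UNIV g) (- inv_into UNIV g v) (\<lambda>m. - \<phi> (inv_into UNIV g m))
      (\<lambda>p q. - k (affine_sd (inv_into UNIV g) (- inv_into UNIV g v) p)
                  (affine_sd (inv_into UNIV g) (- inv_into UNIV g v) q))) F = weak_one"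
    unfolding F weak_one_def weak_comp_weak_map[OF inv d]
    by (rule weak_map_cong) (simp_all only: inv_g affine_sd_inv[OF D(1,2)] add.right_inverse)
  then show "\<exists>G\<in>carrier W. G \<cdot> F = \<one>\<^bsub>W\<^esub>"
    unfolding mult_W one_W using weak_map_in_W[OF inv] by blast
  fix G assume "G \<in> carrier W"
  then obtain g' v' \<phi>' k' where d': "weak_data g' v' \<phi>' k'" and G: "G = weak_map L g' v' \<phi>' k'"
    by (rule W_E)
  show "F \<cdot> G \<in> carrier W"
    unfolding F G mult_W weak_comp_weak_map[OF d d'] by (rule weak_map_in_W[OF weak_data_comp[OF d d']])
  fix H assume "H \<in> carrier W"
  then obtain g'' v'' \<phi>'' k'' where d'': "weak_data g'' v'' \<phi>'' k''" and H: "H = weak_map L g'' v'' \<phi>'' k''"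
    by (rule W_E)
  note D' = weak_dataD[OF d'] and D'' = weak_dataD[OF d'']
  show "F \<cdot> G \<cdot> H = F \<cdot> (G \<cdot> H)"
    unfolding F G H mult_W weak_comp_weak_map[OF d d'] weak_comp_weak_map[OF d' d'']
      weak_comp_weak_map[OF weak_data_comp[OF d d'] d''] weak_comp_weak_map[OF d weak_data_comp[OF d' d'']]
    by (rule weak_map_cong) (simp_all only: linear_add[OF D(1)] add.assoc affine_sd_affine_sd[OF D'(1)])
next
  show "\<one>\<^bsub>W\<^esub> \<in> carrier W"
    unfolding one_W weak_one_def by (rule weak_map_in_W[OF weak_data_one])
qed

section \<open>The image of \<delta> in coordinates, and its normality\<close>

interpretation W: group W by (rule group_W)

text \<open>The circle component of the cochain that \<delta> assigns to
  \<open>\<eta> = (l, c)\<close>: a coboundary, corrected by the circle shift that the action of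
  \<open>q\<close> produces on the lattice component \<open>l\<close> of
  \<open>\<eta> p\<close>.\<close>

definition delta_cochain :: "'t \<Rightarrow> ('t \<times> int \<Rightarrow> circle) \<Rightarrow> 't \<times> int \<Rightarrow> 't \<times> int \<Rightarrow> circle" where
  "delta_cochain l c p q =
     c (p \<star> q) - c p - c q - circle_of (if snd p = -1 then J l (fst q) else 0)"

text \<open>The shift is \<open>- l\<close> because
  \<open>(x, -1) \<star> (l, 1) = (x - l, -1)\<close>.\<close>

definition delta_map :: "'t \<Rightarrow> ('t \<times> int \<Rightarrow> circle) \<Rightarrow> ('t \<times> circle, 't \<times> int) wmap" where
  "delta_map l c = weak_map L (\<lambda>x. x) (- l) (\<lambda>m. c (m, 1)) (delta_cochain l c)"

definition delta_image :: "('t \<times> circle, 't \<times> int) wmap set" where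
  "delta_image = {delta_map l c | l c. l \<in> L \<and> analytic_potential c}"

lemma delta_map_cong:
  assumes "l = l'" "\<And>p. p \<in> S \<Longrightarrow> c p = c' p"
  shows "delta_map l c = delta_map l' c'"
  unfolding delta_map_def
proof (rule weak_map_cong)
  show "delta_cochain l c p q = delta_cochain l' c' p q" if "p \<in> S" "q \<in> S" for p q
    using that assms(2)[OF sd_mult_mem[OF that]] assms by (simp add: delta_cochain_def)
qed (use assms in auto)

text \<open>The summand with \<open>J l\<close> is itself a cocycle, being additive in
  \<open>q\<close> and supported on the component of \<open>-1\<close>. In the last condition the
  terms \<open>J m l\<close> and \<open>J l m\<close> are integers and disappear.\<close>

lemma weak_data_delta:
  assumes l: "l \<in> L" and c: "analytic_potential c"
  shows "weak_data (\<lambda>x. x) (- l) (\<lambda>m. c (m, 1)) (delta_cochain l c)"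
  unfolding weak_data_def
proof (intro conjI ballI allI)
  show "linear (\<lambda>x :: 't. x)" by (simp add: linear_iff)
  show "bij (\<lambda>x :: 't. x)" by (rule bij_id[unfolded id_def])
  show "c (0, 1) = 0" using c by (simp add: analytic_potential_def)
  have lin: "linear (J l)" using J by (simp add: bilinear_def)
  have "analytic_cochain (\<lambda>p q. - circle_of (if snd p = -1 then J l (fst q) else 0))"
    unfolding analytic_cochain_def
  proof (intro ballI)
    fix \<epsilon> \<delta> :: int
    have "circle_analytic (\<lambda>z :: 't \<times> 't. circle_of (J l (snd z) + 0))"
      by (intro circle_analytic_circle_of real_analytic_at_affine
          bounded_linear_compose[OF linear_bounded[OF lin]] bounded_linear_snd)
    from circle_analytic_minus[OF this]
    show "circle_analytic (\<lambda>(u :: 't, v). - circle_of (if snd (u, \<epsilon>) = -1 then J l (fst (v, \<delta>)) else 0))"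
      by (cases "\<epsilon> = -1") (simp_all add: case_prod_beta' circle_of_0 circle_analytic_const)
  qed
  from analytic_cochain_add[OF analytic_cochain_coboundary[OF c] this]
  show "analytic_cochain (delta_cochain l c)"
    by (simp add: delta_cochain_def[abs_def])
  show "delta_cochain l c p q + delta_cochain l c (p \<star> q) r = delta_cochain l c q r + delta_cochain l c p (q \<star> r)"
    if "p \<in> S" "q \<in> S" "r \<in> S" for p q r
    using that
    by (auto simp: delta_cochain_def circle_of_add circle_of_diff circle_of_0 circle_of_minus algebra_simps)
  show "c (m, 1) + c (n, 1) + delta_cochain l c (m, 1) (n, 1) = c (m + n, 1)" for m n
    by (simp add: delta_cochain_def circle_of_0)
  show "c (m, 1) + circle_of (J m (fst (affine_sd (\<lambda>x. x) (- l) (y, \<epsilon>)))) + delta_cochain l c (m, 1) (y, \<epsilon>) =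
      c (of_int \<epsilon> *\<^sub>R m, 1) + circle_of (J m y) + delta_cochain l c (y, \<epsilon>) (of_int \<epsilon> *\<^sub>R m, 1)"
    if "m \<in> L" "\<epsilon> \<in> {1, -1}" for m y \<epsilon>
    using that l
    by (auto simp: delta_cochain_def circle_of_0 circle_of_diff circle_of_minus add.commute algebra_simps)
qed simp

lemma delta_image_subset: "delta_image \<subseteq> carrier W"
  unfolding delta_image_def delta_map_def using weak_map_in_W[OF weak_data_delta] by auto

text \<open>The product of the pointed maps in coordinates. The translation by \<open>l'\<close>
  does not affect the summand with \<open>J l\<close>, since \<open>J l l'\<close> is an
  integer.\<close>

lemma delta_map_mult:
  assumes l: "l \<in> L" and c: "analytic_potential c" and l': "l' \<in> L" and c': "analytic_potential c'"
  shows "delta_map l c \<cdot> delta_map l' c' =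
      delta_map (l + l') (\<lambda>p. c' p + c (affine_sd (\<lambda>x. x) (- l') p))"
  unfolding mult_W delta_map_def weak_comp_weak_map[OF weak_data_delta[OF l c] weak_data_delta[OF l' c']]
proof (rule weak_map_cong)
  let ?T = "affine_sd (\<lambda>x. x) (- l')"
  fix p q assume pq: "p \<in> S" "q \<in> S"
  have lin: "linear (\<lambda>x :: 't. x)" by (simp add: linear_iff)
  have "circle_of (if snd (?T p) = -1 then J l (fst (?T q)) else 0) =
      circle_of (if snd p = -1 then J l (fst q) else 0)"
    using l l' by (auto simp: affine_sd_def circle_of_diff)
  then show "delta_cochain l' c' p q + delta_cochain l c (?T p) (?T q) =
      delta_cochain (l + l') (\<lambda>p. c' p + c (?T p)) p q"
    unfolding delta_cochain_def affine_sd_mult[OF lin pq]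
    by (simp add: circle_of_add circle_of_0 del: mem_Sigma_iff insert_iff)
qed auto

lemma delta_image_subgroup: "subgroup delta_image W"
proof (rule W.subgroupI[OF delta_image_subset])
  have bl: "bounded_linear (\<lambda>x :: 't. x)" by (rule bounded_linear_ident)
  have one: "delta_map 0 (\<lambda>_. 0) = weak_one"
    unfolding delta_map_def weak_one_def
    by (rule weak_map_cong) (auto simp: delta_cochain_def circle_of_0)
  have pot0: "analytic_potential (\<lambda>_. 0)"
    by (simp add: analytic_potential_def circle_analytic_const)
  then have "delta_map 0 (\<lambda>_. 0) \<in> delta_image"
    unfolding delta_image_def using L_0 by blast
  then show "delta_image \<noteq> {}" by blast
  fix F assume "F \<in> delta_image"
  then obtain l c where F: "F = delta_map l c" and l: "l \<in> L" and c: "analytic_potential c"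
    by (auto simp: delta_image_def)
  {
    fix G assume "G \<in> delta_image"
    then obtain l' c' where G: "G = delta_map l' c'" and l': "l' \<in> L" and c': "analytic_potential c'"
      by (auto simp: delta_image_def)
    show "F \<cdot> G \<in> delta_image"
      unfolding F G delta_map_mult[OF l c l' c'] delta_image_def
      using L_add[OF l l'] analytic_potential_add[OF c' analytic_potential_compose[OF c bl]]
      by blast
  next
    define c' where "c' = (\<lambda>p. - c (affine_sd (\<lambda>x. x) l p))"
    have c': "analytic_potential c'"
      unfolding c'_def by (intro analytic_potential_minus analytic_potential_compose c bl)
    have l': "- l \<in> L" using l by simp
    have "delta_map (- l) c' \<cdot> F = \<one>\<^bsub>W\<^esub>"
      unfolding F delta_map_mult[OF l' c' l c] one_W one[symmetric]
      by (rule delta_map_cong) (auto simp: c'_def)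
    moreover have mem: "delta_map (- l) c' \<in> delta_image"
      using l' c' by (auto simp: delta_image_def)
    ultimately have "inv\<^bsub>W\<^esub> F = delta_map (- l) c'"
      using \<open>F \<in> delta_image\<close> delta_image_subset by (intro W.inv_equality) auto
    then show "inv\<^bsub>W\<^esub> F \<in> delta_image" using mem by simp
  }
qed

text \<open>
  Applying \<open>F\<close> to the arrow \<open>\<eta> x\<close> from \<open>x\<close> gives \<open>f\<^sub>1 (\<eta> x) \<kappa> (x, bd (\<eta> x))\<close> as the arrow from \<open>f\<^sub>0 x\<close>;
  its circle component is the function \<open>e\<close> below.
\<close>

lemma delta_map_conj:
  assumes d: "weak_data g v \<phi> k" and l: "l \<in> L" and c: "analytic_potential c"
  obtains c' where "analytic_potential c'"
    "weak_map L g v \<phi> k \<cdot> delta_map l c = delta_map (g l) c' \<cdot> weak_map L g v \<phi> k"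
proof -
  note D = weak_dataD[OF d] and N = weak_data_norm[OF d]
  define A where "A = affine_sd g v"
  define h where "h = inv_into UNIV g"
  \<comment> \<open>The lattice component of the pointed map \<open>\<eta>\<close>; thus
    \<open>?T p\<close> below is \<open>p \<star> (\<sigma> p, 1)\<close>.\<close>
  define \<sigma> where "\<sigma> p = (if snd p = -1 then l else 0)" for p :: "'t \<times> int"
  define e where "e p = c p + \<phi> (\<sigma> p) + k p (\<sigma> p, 1)" for p
  define c' where "c' p = e (affine_sd h (- h v) p)" for p
  have h: "linear h" unfolding h_def by (rule linear_inv_bij[OF D(1,2)])
  have c'A: "c' (A p) = e p" if "p \<in> S" for p
    using affine_sd_inv[OF D(1,2) that] by (simp add: c'_def A_def h_def)
  have "analytic_potential e"
    unfolding analytic_potential_def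
  proof (intro conjI ballI)
    show "e (0, 1) = 0" using c N D by (simp add: e_def \<sigma>_def analytic_potential_def)
    fix \<epsilon> :: int assume \<epsilon>: "\<epsilon> \<in> {1, -1}"
    define m where "m = (if \<epsilon> = -1 then l else 0)"
    have "circle_analytic (\<lambda>(u, v). k (u, \<epsilon>) (v, 1))"
      using D(4) \<epsilon> by (auto simp: analytic_cochain_def)
    then have "circle_analytic (\<lambda>u. (\<lambda>(u, v). k (u, \<epsilon>) (v, 1)) (u, m))"
      by (rule circle_analytic_compose_affine[where A = "\<lambda>u. (u, 0)" and c = "(0, m)"])
         (auto intro: bounded_linear_Pair bounded_linear_ident bounded_linear_zero)
    moreover have "circle_analytic (\<lambda>u. c (u, \<epsilon>))"
      using c \<epsilon> by (auto simp: analytic_potential_def)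
    ultimately show "circle_analytic (\<lambda>u. e (u, \<epsilon>))"
      unfolding e_def \<sigma>_def snd_conv m_def[symmetric] prod.case
      by (intro circle_analytic_add circle_analytic_const)
  qed
  then have c': "analytic_potential c'"
    unfolding c'_def by (intro analytic_potential_compose linear_bounded h)
  have gl: "g l \<in> L" using D(9)[OF l] .
  let ?T = "affine_sd (\<lambda>x. x) (- l)"
  \<comment> \<open>Eliminates the intermediate values \<open>a3\<close>, \<open>a4\<close>,
    \<open>b2\<close>, \<open>c4\<close> from the four cocycle identities applied below.\<close>
  have combine: "a2 = d1 + d2 - a1 - b3 + b1 - c1 + c3"
    if "a1 + a2 = a3 + a4" "b1 + b2 = b3 + a3" "c1 + b2 = c3 + c4" "d1 + d2 = c4 + a4"
    for a1 a2 a3 a4 b1 b2 b3 c1 c3 c4 d1 d2 :: circle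
  proof -
    have "a2 = a3 + a4 - a1" "a3 = b1 + b2 - b3" "b2 = c3 + c4 - c1" "a4 = d1 + d2 - c4"
      using that by (simp_all add: algebra_simps)
    then show ?thesis by simp
  qed
  have "weak_map L g v \<phi> k \<cdot> delta_map l c = delta_map (g l) c' \<cdot> weak_map L g v \<phi> k"
    unfolding mult_W delta_map_def weak_comp_weak_map[OF d weak_data_delta[OF l c]]
      weak_comp_weak_map[OF weak_data_delta[OF gl c'] d]
  proof (rule weak_map_cong)
    show "g (- l) + v = v + - g l" by (simp add: linear_neg[OF D(1)])
    show "c (m, 1) + \<phi> m = \<phi> m + c' (g m, 1)" for m
      using c'A[of "(m, 1)"] N[of "(m, 1)"] by (simp add: e_def \<sigma>_def A_def D)
    fix x y assume xy: "x \<in> S" "y \<in> S"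
    \<comment> \<open>The elements by which \<open>?T\<close> shifts \<open>x\<close> and
      \<open>y\<close>; moving \<open>p\<close> past \<open>y\<close> turns it into
      \<open>p'\<close>, and \<open>p' \<star> q\<close> is the shift of
      \<open>x \<star> y\<close>.\<close>
    define p q p' where "p = (\<sigma> x, 1::int)" and "q = (\<sigma> y, 1::int)"
      and "p' = (of_int (snd y) *\<^sub>R \<sigma> x, 1::int)"
    have \<sigma>L: "\<sigma> x \<in> L" "\<sigma> y \<in> L" "of_int (snd y) *\<^sub>R \<sigma> x \<in> L"
      using l xy by (auto simp: \<sigma>_def)
    have S: "p \<in> S" "q \<in> S" "p' \<in> S" "x \<star> y \<in> S" "y \<star> q \<in> S" "x \<star> p \<in> S" "p' \<star> q \<in> S"
      using xy by (auto simp: p_def q_def p'_def)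
    have T: "?T x = x \<star> p" "?T y = y \<star> q" "p \<star> y = y \<star> p'" "p \<star> (y \<star> q) = y \<star> (p' \<star> q)"
      "x \<star> (p \<star> (y \<star> q)) = x \<star> (y \<star> (p' \<star> q))" "(p \<star> y) \<star> q = p \<star> (y \<star> q)"
      "(x \<star> p) \<star> (y \<star> q) = x \<star> (p \<star> (y \<star> q))" "(y \<star> p') \<star> q = y \<star> (p' \<star> q)"
      "p' \<star> q = (\<sigma> (x \<star> y), 1)"
      using xy by (auto simp: p_def q_def p'_def \<sigma>_def algebra_simps)
    have "k x p + k (x \<star> p) (y \<star> q) = k p (y \<star> q) + k x (p \<star> (y \<star> q))"
      by (rule D(6)) fact+
    moreover have "k p y + k (p \<star> y) q = k y q + k p (y \<star> q)"
      by (rule D(6)) fact+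
    moreover have "k y p' + k (y \<star> p') q = k p' q + k y (p' \<star> q)"
      by (rule D(6)) fact+
    moreover have "k x y + k (x \<star> y) (p' \<star> q) = k y (p' \<star> q) + k x (y \<star> (p' \<star> q))"
      by (rule D(6)) fact+
    ultimately have 1: "k (?T x) (?T y) =
        k x y + k (x \<star> y) (\<sigma> (x \<star> y), 1) - k x p - k y q + k p y - k y p' + k p' q"
      unfolding T by (rule combine)
    have 2: "k p' q = \<phi> (\<sigma> (x \<star> y)) - \<phi> (of_int (snd y) *\<^sub>R \<sigma> x) - \<phi> (\<sigma> y)"
      using D(7)[OF \<sigma>L(3,2)] T(9) by (simp add: p'_def q_def algebra_simps)
    \<comment> \<open>The last condition of \<open>weak_data\<close> swaps a lattice translation
      with \<open>y\<close>; its two \<open>J\<close> terms turn the \<open>J l\<close> of the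
      source into the \<open>J (g l)\<close> of the target.\<close>
    have 3: "k p y = k y p' + \<phi> (of_int (snd y) *\<^sub>R \<sigma> x) - \<phi> (\<sigma> x) +
        circle_of (J (\<sigma> x) (fst y)) - circle_of (J (g (\<sigma> x)) (fst (A y)))"
    proof -
      have "snd y \<in> {1, -1}" using xy by auto
      from D(8)[OF \<sigma>L(1) this, of "fst y"] show ?thesis
        by (simp add: A_def p_def p'_def algebra_simps)
    qed
    have 4: "circle_of (if snd x = -1 then J l (fst y) else 0) = circle_of (J (\<sigma> x) (fst y))"
      "circle_of (if snd (A x) = -1 then J (g l) (fst (A y)) else 0) = circle_of (J (g (\<sigma> x)) (fst (A y)))"
      by (auto simp: \<sigma>_def A_def affine_sd_def D)
    show "delta_cochain l c x y + k (?T x) (?T y) =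
        k x y + delta_cochain (g l) c' (affine_sd g v x) (affine_sd g v y)"
      unfolding A_def[symmetric] delta_cochain_def 4
      unfolding A_def affine_sd_mult[OF D(1) xy, symmetric]
      unfolding A_def[symmetric] c'A[OF xy(1)] c'A[OF xy(2)] c'A[OF S(4)] e_def 1 2 3
      unfolding p_def q_def by (simp add: algebra_simps)
  qed auto
  then show thesis using c' that by blast
qed

lemma delta_image_normal: "delta_image \<lhd> W"
  unfolding W.normal_inv_iff
proof (intro conjI ballI delta_image_subgroup)
  fix F n assume F: "F \<in> carrier W" and n: "n \<in> delta_image"
  obtain g v \<phi> k where d: "weak_data g v \<phi> k" and F': "F = weak_map L g v \<phi> k"
    using F by (rule W_E)
  obtain l c where n': "n = delta_map l c" and l: "l \<in> L" and c: "analytic_potential c"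
    using n by (auto simp: delta_image_def)
  obtain c' where c': "analytic_potential c'" "F \<cdot> n = delta_map (g l) c' \<cdot> F"
    using delta_map_conj[OF d l c] unfolding F' n' by blast
  have mem: "delta_map (g l) c' \<in> delta_image"
    using c'(1) weak_dataD(9)[OF d l] by (auto simp: delta_image_def)
  then have "delta_map (g l) c' \<in> carrier W" using delta_image_subset by blast
  then have "F \<cdot> n \<cdot> inv\<^bsub>W\<^esub> F = delta_map (g l) c'"
    unfolding c'(2) using F by (simp add: W.m_assoc)
  then show "F \<cdot> n \<cdot> inv\<^bsub>W\<^esub> F \<in> delta_image" using mem by simp
qed

end

lemma circle_of_double: "circle_of (2 * s) = circle_of s + circle_of s"
  by (metis circle_of_add mult_2)

section \<open>The structure map \<delta> and conjugations in coordinates\<close>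

context theta_data begin

interpretation W: group W by (rule group_W)

lemma delta_map_raw:
  assumes l: "l \<in> L"
  shows "wAct_delta \<Theta> (\<lambda>p\<in>S. (if snd p = -1 then l else 0, c p)) = delta_map l c"
proof -
  let ?\<eta> = "\<lambda>p\<in>S. (if snd p = -1 then l else 0, c p)"
  have 1: "(\<lambda>x\<in>S. x \<otimes>\<^bsub>G0 \<Theta>\<^esub> bd \<Theta> (?\<eta> x)) = (\<lambda>p\<in>S. affine_sd (\<lambda>x. x) (- l) p)"
    by (auto simp: fun_eq_iff restrict_def)
  have 2: "(\<lambda>\<alpha>\<in>L \<times> UNIV. \<alpha> \<otimes>\<^bsub>G1 \<Theta>\<^esub> ?\<eta> (bd \<Theta> \<alpha>)) = (\<lambda>(m, a)\<in>L \<times> UNIV. (m, a + c (m, 1)))"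
    by (auto simp: fun_eq_iff restrict_def)
  have 3: "inv\<^bsub>G1 \<Theta>\<^esub> (?\<eta> y) \<otimes>\<^bsub>G1 \<Theta>\<^esub> inv\<^bsub>G1 \<Theta>\<^esub> (act \<Theta> (?\<eta> x) y) \<otimes>\<^bsub>G1 \<Theta>\<^esub> ?\<eta> (x \<otimes>\<^bsub>G0 \<Theta>\<^esub> y) =
      (0, delta_cochain l c x y)" if "x \<in> S" "y \<in> S" for x y
    using that l
    by (auto simp: mult_G0_Theta' inv_G1_Theta'[OF L] delta_cochain_def circle_of_0 algebra_simps)
  have 4: "(\<lambda>(x, y)\<in>S \<times> S. inv\<^bsub>G1 \<Theta>\<^esub> (?\<eta> y) \<otimes>\<^bsub>G1 \<Theta>\<^esub> inv\<^bsub>G1 \<Theta>\<^esub> (act \<Theta> (?\<eta> x) y) \<otimes>\<^bsub>G1 \<Theta>\<^esub>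
      ?\<eta> (x \<otimes>\<^bsub>G0 \<Theta>\<^esub> y)) = (\<lambda>(p, q)\<in>S \<times> S. (0, delta_cochain l c p q))"
  proof (rule restrict_ext)
    fix z assume "z \<in> S \<times> S"
    then obtain x y where "z = (x, y)" "x \<in> S" "y \<in> S" by blast
    then show "(case z of (x, y) \<Rightarrow> inv\<^bsub>G1 \<Theta>\<^esub> (?\<eta> y) \<otimes>\<^bsub>G1 \<Theta>\<^esub> inv\<^bsub>G1 \<Theta>\<^esub> (act \<Theta> (?\<eta> x) y) \<otimes>\<^bsub>G1 \<Theta>\<^esub>
      ?\<eta> (x \<otimes>\<^bsub>G0 \<Theta>\<^esub> y)) = (case z of (p, q) \<Rightarrow> (0, delta_cochain l c p q))"
      using 3 by (simp only: prod.case)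
  qed
  show ?thesis
    unfolding wAct_delta_def Theta'_simps(1,4) 1 2 4 delta_map_def weak_map_def by simp
qed

text \<open>The lattice component of \<open>\<eta>\<close> is constant on both components and
  vanishes on the identity component because \<open>\<eta>\<close> is pointed.\<close>

lemma pointed_maps_E:
  assumes "\<eta> \<in> carrier (pointed_maps \<Theta>)"
  obtains l c where "l \<in> L" "analytic_potential c" "\<eta> = (\<lambda>p\<in>S. (if snd p = -1 then l else 0, c p))"
proof -
  have \<eta>: "\<eta> \<in> S \<rightarrow>\<^sub>E L \<times> UNIV" "\<eta> (0, 1) = (0, 0)" "analytic_map (charts0 \<Theta>) (charts1 \<Theta>) \<eta>"
    using assms by (auto simp: pointed_maps_def)
  have loc: "\<exists>h m. real_analytic_at h u \<and> (\<forall>\<^sub>F y in nhds u. \<eta> (y, \<epsilon>) = (m, circle_of (h y)))"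
    if "\<epsilon> \<in> {1, -1}" for \<epsilon> u
  proof -
    have "(\<lambda>x. (x, \<epsilon>)) \<in> charts0 \<Theta>" using that by auto
    from \<eta>(3)[unfolded analytic_map_eventually, THEN bspec, OF this, THEN spec, of u]
    show ?thesis by auto
  qed
  have const: "fst (\<eta> (x, \<epsilon>)) = fst (\<eta> (0, \<epsilon>))" if "\<epsilon> \<in> {1, -1}" for x \<epsilon>
  proof -
    note \<epsilon> = that
    have "snd (prod.swap (\<eta> (x, \<epsilon>))) = snd (prod.swap (\<eta> (0, \<epsilon>)))"
    proof (rule eventually_sheet_constant[of "\<lambda>x. prod.swap (\<eta> (x, \<epsilon>))"])
      fix u
      obtain h m where "\<forall>\<^sub>F z in nhds u. \<eta> (z, \<epsilon>) = (m, circle_of (h z))"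
        using loc[OF \<epsilon>] by blast
      then have "\<forall>\<^sub>F z in nhds u. prod.swap (\<eta> (z, \<epsilon>)) = (circle_of (h z), m)"
        by eventually_elim simp
      then show "\<exists>h c. \<forall>\<^sub>F z in nhds u. prod.swap (\<eta> (z, \<epsilon>)) = (h z, c)"
        by (intro exI[of _ "\<lambda>z. circle_of (h z)"] exI[of _ m])
    qed
    then show ?thesis by simp
  qed
  define l where "l = fst (\<eta> (0, -1))"
  define c where "c p = snd (\<eta> p)" for p
  have "analytic_potential c"
    unfolding analytic_potential_def circle_analytic_def
  proof (intro conjI ballI allI)
    show "c (0, 1) = 0" by (simp add: c_def \<eta>)
    fix \<epsilon> :: int and u assume "\<epsilon> \<in> {1, -1}"
    from loc[OF this, of u] obtain h m where h: "real_analytic_at h u"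
      "\<forall>\<^sub>F y in nhds u. \<eta> (y, \<epsilon>) = (m, circle_of (h y))" by blast
    have "\<forall>\<^sub>F y in nhds u. c (y, \<epsilon>) = circle_of (h y)"
      using h(2) by eventually_elim (simp add: c_def)
    with h(1) show "\<exists>h. real_analytic_at h u \<and> (\<forall>\<^sub>F y in nhds u. c (y, \<epsilon>) = circle_of (h y))"
      by blast
  qed
  moreover have "\<eta> (0, -1) \<in> L \<times> UNIV" using \<eta>(1) by (rule PiE_mem) simp
  then have "l \<in> L" by (auto simp: l_def)
  moreover have "\<eta> = (\<lambda>p\<in>S. (if snd p = -1 then l else 0, c p))"
  proof (rule extensionalityI[of _ S])
    show "\<eta> \<in> extensional S" using \<eta>(1) by (auto simp: PiE_def)
    fix p assume "p \<in> S"
    then show "\<eta> p = (\<lambda>p\<in>S. (if snd p = -1 then l else 0, c p)) p"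
      using const[of 1 "fst p"] const[of "-1" "fst p"] \<eta>(2) by (auto simp: c_def l_def prod_eq_iff)
  qed simp
  ultimately show thesis using that by blast
qed

lemma pointed_maps_I:
  assumes l: "l \<in> L" and c: "analytic_potential c"
  shows "(\<lambda>p\<in>S. (if snd p = -1 then l else 0, c p)) \<in> carrier (pointed_maps \<Theta>)"
    (is "?\<eta> \<in> _")
proof -
  have "analytic_map (charts0 \<Theta>) (charts1 \<Theta>) ?\<eta>"
    unfolding analytic_map_eventually
  proof (intro ballI allI)
    fix p :: "'t \<Rightarrow> 't \<times> int" and u assume "p \<in> charts0 \<Theta>"
    then obtain \<epsilon> where \<epsilon>: "p = (\<lambda>x. (x, \<epsilon>))" "\<epsilon> \<in> {1, -1}" by auto
    then have "circle_analytic (\<lambda>u. c (u, \<epsilon>))"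
      using c unfolding analytic_potential_def by blast
    then obtain h where h: "real_analytic_at h u" "\<forall>\<^sub>F y in nhds u. c (y, \<epsilon>) = circle_of (h y)"
      unfolding circle_analytic_def by blast
    have "\<forall>\<^sub>F y in nhds u. ?\<eta> (p y) = (if \<epsilon> = -1 then l else 0, circle_of (h y))"
      using h(2) by eventually_elim (use \<epsilon> in auto)
    moreover have "(\<lambda>s. (if \<epsilon> = -1 then l else 0, circle_of s)) \<in> charts1 \<Theta>"
      using l by (cases "\<epsilon> = -1") auto
    ultimately show "\<exists>q\<in>charts1 \<Theta>. \<exists>h. real_analytic_at h u \<and> (\<forall>\<^sub>F y in nhds u. ?\<eta> (p y) = q (h y))"
      using h(1) by (intro bexI[of _ "\<lambda>s. (if \<epsilon> = -1 then l else 0, circle_of s)"] exI[of _ h] conjI)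
  qed
  then show ?thesis
    using l c by (auto simp: pointed_maps_def analytic_potential_def)
qed

lemma pointed_maps_mult:
  "(\<lambda>p\<in>S. (if snd p = -1 then l else 0, c p)) \<otimes>\<^bsub>pointed_maps \<Theta>\<^esub>
   (\<lambda>p\<in>S. (if snd p = -1 then l' else 0, c' p)) =
   (\<lambda>p\<in>S. (if snd p = -1 then l + l' else 0, c' p + c (affine_sd (\<lambda>x. x) (- l') p)))"
  by (auto simp: pointed_maps_def fun_eq_iff restrict_def add.commute)

text \<open>Every pointed map \<open>(l, c)\<close> is a unit: its inverse has lattice component
  \<open>- l\<close>, and circle component \<open>- c\<close> translated by \<open>l\<close> on the
  component of \<open>-1\<close>.\<close>

lemma wAct_delta_image: "wAct_delta \<Theta> ` carrier (wAct_plus1 \<Theta>) = delta_image"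
proof (intro equalityI subsetI)
  fix F assume "F \<in> wAct_delta \<Theta> ` carrier (wAct_plus1 \<Theta>)"
  then obtain \<eta> where F: "F = wAct_delta \<Theta> \<eta>" and "\<eta> \<in> carrier (pointed_maps \<Theta>)"
    by (auto simp: wAct_plus1_def units_of_carrier Units_def)
  then obtain l c where "l \<in> L" "analytic_potential c" "\<eta> = (\<lambda>p\<in>S. (if snd p = -1 then l else 0, c p))"
    using pointed_maps_E by blast
  then show "F \<in> delta_image" unfolding F delta_image_def using delta_map_raw by blast
next
  fix F assume "F \<in> delta_image"
  then obtain l c where F: "F = delta_map l c" and l: "l \<in> L" and c: "analytic_potential c"
    by (auto simp: delta_image_def)
  let ?\<eta> = "\<lambda>p\<in>S. (if snd p = -1 then l else 0, c p)"
  define c' where "c' = (\<lambda>p. - c (affine_sd (\<lambda>x. x) l p))"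
  let ?\<eta>' = "\<lambda>p\<in>S. (if snd p = -1 then - l else 0, c' p)"
  have c': "analytic_potential c'"
    unfolding c'_def by (intro analytic_potential_minus analytic_potential_compose c bounded_linear_ident)
  have "?\<eta>' \<otimes>\<^bsub>pointed_maps \<Theta>\<^esub> ?\<eta> = \<one>\<^bsub>pointed_maps \<Theta>\<^esub>" "?\<eta> \<otimes>\<^bsub>pointed_maps \<Theta>\<^esub> ?\<eta>' = \<one>\<^bsub>pointed_maps \<Theta>\<^esub>"
    unfolding pointed_maps_mult
    by (auto simp: pointed_maps_def c'_def fun_eq_iff restrict_def)
  then have "?\<eta> \<in> carrier (wAct_plus1 \<Theta>)"
    using pointed_maps_I[OF l c] pointed_maps_I[OF L_minus[OF l] c']
    unfolding wAct_plus1_def units_of_carrier Units_def by blast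
  then show "F \<in> wAct_delta \<Theta> ` carrier (wAct_plus1 \<Theta>)"
    unfolding F delta_map_raw[OF l, symmetric] by (rule imageI)
qed

text \<open>Conjugating \<open>(y, -1)\<close> by \<open>(w, \<sigma>)\<close> adds \<open>w\<close>
  from the left and again \<open>w\<close> from the right, as \<open>-1\<close> inverts
  translations. The cochain is the shift by which the inverse of \<open>(w, \<sigma>)\<close>
  acts.\<close>

lemma weak_data_Ad:
  assumes "\<sigma> = 1 \<or> \<sigma> = -1"
  shows "weak_data (\<lambda>x. of_int \<sigma> *\<^sub>R x) (2 *\<^sub>R w) (\<lambda>m. - circle_of (of_int \<sigma> * J m w)) (\<lambda>_ _. 0)"
  unfolding weak_data_def
proof (intro conjI ballI allI)
  show "linear (\<lambda>x :: 't. of_int \<sigma> *\<^sub>R x)" by (simp add: linear_iff scaleR_add_right)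
  show "bij (\<lambda>x :: 't. of_int \<sigma> *\<^sub>R x)"
    using assms by (intro o_bij[of "\<lambda>x. of_int \<sigma> *\<^sub>R x"]) (auto simp: fun_eq_iff)
  show "(\<lambda>x. of_int \<sigma> *\<^sub>R x) ` L = L"
    using assms by (auto simp: image_iff intro!: bexI[of _ "- x" for x])
  show "analytic_cochain (\<lambda>_ _. 0)"
    by (simp add: analytic_cochain_def case_prod_beta' circle_analytic_const)
  show "- circle_of (of_int \<sigma> * J m w) + circle_of (J (of_int \<sigma> *\<^sub>R m)
      (fst (affine_sd (\<lambda>x. of_int \<sigma> *\<^sub>R x) (2 *\<^sub>R w) (y, \<epsilon>)))) + 0 =
      - circle_of (of_int \<sigma> * J (of_int \<epsilon> *\<^sub>R m) w) + circle_of (J m y) + 0"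
    if "\<epsilon> \<in> {1, -1}" for m y \<epsilon>
    using that assms
    by (auto simp: scaleR_2 circle_of_add circle_of_minus circle_of_diff circle_of_double)
qed (auto simp: circle_of_0 circle_of_add distrib_left)

lemma Ad_plus_weak_map:
  assumes "\<sigma> = 1 \<or> \<sigma> = -1"
  shows "Ad_plus \<Theta> (w, \<sigma>) =
    weak_map L (\<lambda>x. of_int \<sigma> *\<^sub>R x) (2 *\<^sub>R w) (\<lambda>m. - circle_of (of_int \<sigma> * J m w)) (\<lambda>_ _. 0)"
proof -
  have \<sigma>: "\<sigma> \<in> {1, -1}" using assms by simp
  have 1: "(w, \<sigma>) \<otimes>\<^bsub>G0 \<Theta>\<^esub> p \<otimes>\<^bsub>G0 \<Theta>\<^esub> (- (of_int \<sigma> *\<^sub>R w), \<sigma>) =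
      affine_sd (\<lambda>x. of_int \<sigma> *\<^sub>R x) (2 *\<^sub>R w) p" if "p \<in> S" for p
    using that assms by (auto simp: scaleR_2)
  have 2: "act \<Theta> (m, a) (- (of_int \<sigma> *\<^sub>R w), \<sigma>) =
      (of_int \<sigma> *\<^sub>R m, a + - circle_of (of_int \<sigma> * J m w))" for m a
    using assms by (auto simp: circle_of_minus)
  show ?thesis
    unfolding Ad_plus_def inv_G0_Theta'[OF \<sigma>] weak_map_def Theta'_simps(1,4,6)
    using 1 2 by (auto simp: fun_eq_iff restrict_def simp del: Theta'_simps(2,8))
qed

lemma Ad_plus_mem: "p \<in> S \<Longrightarrow> Ad_plus \<Theta> p \<in> carrier W"
  using Ad_plus_weak_map weak_map_in_W[OF weak_data_Ad] by (cases p) auto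

lemma Ad_plus_mult:
  assumes "p \<in> S" "q \<in> S"
  shows "Ad_plus \<Theta> (p \<star> q) = Ad_plus \<Theta> p \<cdot> Ad_plus \<Theta> q"
proof -
  obtain w \<sigma> w' \<sigma>' where p: "p = (w, \<sigma>)" "q = (w', \<sigma>')" by (cases p, cases q) auto
  have \<sigma>: "\<sigma> = 1 \<or> \<sigma> = -1" "\<sigma>' = 1 \<or> \<sigma>' = -1" "\<sigma> * \<sigma>' = 1 \<or> \<sigma> * \<sigma>' = -1"
    using assms by (auto simp: p)
  show ?thesis
    unfolding p sd_mult_Pair Ad_plus_weak_map[OF \<sigma>(1)] Ad_plus_weak_map[OF \<sigma>(2)]
      Ad_plus_weak_map[OF \<sigma>(3)] mult_W weak_comp_weak_map[OF weak_data_Ad[OF \<sigma>(1)] weak_data_Ad[OF \<sigma>(2)]]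
    by (rule weak_map_cong)
       (use \<sigma> in \<open>auto simp: scaleR_add_right circle_of_add circle_of_diff circle_of_minus\<close>)
qed

text \<open>With \<open>\<alpha>\<close> over \<open>m\<close>, conjugation by
  \<open>bd \<alpha>\<close> is isomorphic to the identity through the pointed map sending
  \<open>y\<close> to the quotient of \<open>act \<alpha> y\<close> by \<open>\<alpha>\<close>. Its
  lattice component on the component of \<open>-1\<close> is \<open>-2m\<close>, its circle
  component \<open>J m y\<close>. Hence \<open>Ad_plus\<close> descends to \<pi>0.\<close>

lemma Ad_plus_bd:
  assumes m: "m \<in> L"
  shows "Ad_plus \<Theta> (m, 1) \<in> delta_image"
proof -
  have lin: "linear (\<lambda>x. J m x)" using J by (simp add: bilinear_def)
  define c where "c = (\<lambda>p :: 't \<times> int. circle_of (J m (fst p)))"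
  have c: "analytic_potential c"
    unfolding analytic_potential_def c_def
    using circle_analytic_circle_of[OF real_analytic_at_affine[OF linear_bounded[OF lin], of 0]]
    by (simp add: circle_of_0)
  have l: "- (2 *\<^sub>R m) \<in> L" using L_minus[OF L_add[OF m m]] by (simp only: scaleR_2)
  have "Ad_plus \<Theta> (m, 1) = delta_map (- (2 *\<^sub>R m)) c"
    unfolding Ad_plus_weak_map[OF disjI1[OF refl]] delta_map_def
    by (rule weak_map_cong)
       (use m in \<open>auto simp: c_def delta_cochain_def circle_of_0 circle_of_add circle_of_diff
          circle_of_minus circle_of_double scaleR_2\<close>)
  then show ?thesis using l c by (auto simp: delta_image_def)
qed

end

section \<open>The kernel of the action on the lattice\<close>

lemma full_lattice_basis:
  fixes L :: "'t::real_vector set"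
  assumes "full_lattice L"
  obtains B where "finite B" "independent B" "span B = UNIV" "B \<subseteq> L"
    "L = range (\<lambda>c :: 't \<Rightarrow> int. \<Sum>b\<in>B. of_int (c b) *\<^sub>R b)"
proof -
  obtain B where B: "finite B" "independent B" "span B = UNIV"
    "L = range (\<lambda>c :: 't \<Rightarrow> int. \<Sum>b\<in>B. of_int (c b) *\<^sub>R b)"
    using assms by (auto simp: full_lattice_def)
  have "b \<in> L" if b: "b \<in> B" for b
    unfolding B(4)
  proof (rule range_eqI)
    have "(\<Sum>b'\<in>B. of_int (if b' = b then 1 else 0) *\<^sub>R b') = (\<Sum>b'\<in>B. if b' = b then b' else 0)"
      by (rule sum.cong) auto
    then show "b = (\<Sum>b'\<in>B. of_int ((\<lambda>b'. if b' = b then 1 else 0) b') *\<^sub>R b')"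
      using B(1) b by simp
  qed
  then show thesis using B that by blast
qed

lemma linear_eq_on_lattice:
  fixes f g :: "'t::real_vector \<Rightarrow> 'b::real_vector"
  assumes L: "full_lattice L" and f: "linear f" and g: "linear g"
    and eq: "\<And>m. m \<in> L \<Longrightarrow> f m = g m"
  shows "f x = g x"
proof -
  obtain B where "B \<subseteq> L" "span B = UNIV" using L by (rule full_lattice_basis)
  then show ?thesis
    using linear_eq_on_span[OF f g, of B x] eq by auto
qed

text \<open>\<open>L\<close> is free on a basis of the space: choose preimages of the basis values
  under \<open>p\<close> and extend linearly; the defect is additive on \<open>L\<close> and zero on
  the basis. The case \<open>p = circle_of\<close> lifts characters, the case of the identity
  extends lattice automorphisms.\<close>

lemma lattice_hom_extension:
  fixes \<tau> :: "'t::real_vector \<Rightarrow> 'b::ab_group_add" and p :: "'c::real_vector \<Rightarrow> 'b"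
  assumes L: "full_lattice L"
    and \<tau>: "\<And>m n. m \<in> L \<Longrightarrow> n \<in> L \<Longrightarrow> \<tau> (m + n) = \<tau> m + \<tau> n"
    and p: "\<And>s t. p (s + t) = p s + p t" "surj p"
  obtains f where "linear f" "\<And>m. m \<in> L \<Longrightarrow> \<tau> m = p (f m)"
proof -
  obtain B where B: "finite B" "independent B" "L = range (\<lambda>c :: 't \<Rightarrow> int. \<Sum>b\<in>B. of_int (c b) *\<^sub>R b)"
    and BL: "\<And>b. b \<in> B \<Longrightarrow> b \<in> L"
    by (rule full_lattice_basis[OF L]) blast
  note LD = full_latticeD[OF L]
  obtain f where f: "linear f" "\<And>b. b \<in> B \<Longrightarrow> f b = inv_into UNIV p (\<tau> b)"
    using linear_independent_extend[OF B(2), of "\<lambda>b. inv_into UNIV p (\<tau> b)"] by blast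
  have pf: "p (f b) = \<tau> b" if "b \<in> B" for b
    using f(2)[OF that] p(2) by (simp add: surj_f_inv_f)
  define \<delta> where "\<delta> m = \<tau> m - p (f m)" for m
  have \<delta>_add: "\<delta> (m + n) = \<delta> m + \<delta> n" if "m \<in> L" "n \<in> L" for m n
    using that by (simp add: \<delta>_def \<tau> linear_add[OF f(1)] p)
  have \<delta>_0: "\<delta> 0 = 0" using \<delta>_add[of 0 0] LD(1) by simp
  have \<delta>_uminus: "\<delta> (- m) = - \<delta> m" if "m \<in> L" for m
    using \<delta>_add[of m "- m"] LD that \<delta>_0 by (simp add: eq_neg_iff_add_eq_0 add.commute)
  have nat: "of_nat k *\<^sub>R b \<in> L \<and> \<delta> (of_nat k *\<^sub>R b) = 0" if "b \<in> B" for k b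
  proof (induction k)
    case (Suc k)
    have "\<delta> b = 0" using pf[OF that] by (simp add: \<delta>_def)
    then show ?case
      using Suc \<delta>_add[of b "of_nat k *\<^sub>R b"] BL[OF that] LD by (simp add: scaleR_add_left)
  qed (use LD \<delta>_0 in auto)
  have int: "of_int k *\<^sub>R b \<in> L \<and> \<delta> (of_int k *\<^sub>R b) = 0" if "b \<in> B" for k b
  proof (cases "k \<ge> 0")
    case False
    then have "of_int k *\<^sub>R b = - (of_nat (nat (- k)) *\<^sub>R b)" by simp
    then show ?thesis
      using nat[OF that, of "nat (- k)"] LD(3) \<delta>_uminus by (metis neg_0_equal_iff_equal)
  qed (use nat[OF that, of "nat k"] in simp)
  have sum: "(\<Sum>b\<in>F. of_int (c b) *\<^sub>R b) \<in> L \<and> \<delta> (\<Sum>b\<in>F. of_int (c b) *\<^sub>R b) = 0"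
    if "F \<subseteq> B" for F c
    using finite_subset[OF that B(1)] that
  proof (induction F)
    case (insert b F)
    then show ?case using int[of b "c b"] LD(2) \<delta>_add by simp
  qed (use LD(1) \<delta>_0 in auto)
  have "\<tau> m = p (f m)" if "m \<in> L" for m
    using that sum[of B] unfolding B(3) \<delta>_def by auto
  then show thesis using f(1) that by blast
qed

section \<open>Real lifts of the cocycle and its trivialisation\<close>

context theta_data begin

interpretation W: group W by (rule group_W)

text \<open>Each relation for \<open>k\<close> holds for the lift \<open>K\<close> up to an integer
  that is constant in the real arguments and zero at the origin. In the last relation
  \<open>m\<close> stays fixed in \<open>L\<close> and only \<open>y\<close> moves;
  \<open>\<phi> m\<close> cancels because the sign is \<open>1\<close>.\<close>

lemma real_lift:
  assumes d: "weak_data g v \<phi> k"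
  obtains K where "\<And>u. real_analytic_at K u" "\<And>x y. k (x, 1) (y, 1) = circle_of (K (x, y))"
    "\<And>x. K (x, 0) = 0" "\<And>x. K (0, x) = 0"
    "\<And>x y z. K (x, y) + K (x + y, z) = K (y, z) + K (x, y + z)"
    "\<And>m y. m \<in> L \<Longrightarrow> J (g m) (g y) + K (m, y) = J m y + K (y, m)"
proof -
  note D = weak_dataD[OF d] and N = weak_data_norm[OF d]
  have "circle_analytic (\<lambda>(x, y). k (x, 1) (y, 1))"
    using D(4) by (simp add: analytic_cochain_def)
  moreover have "(case 0 of (x, y) \<Rightarrow> k (x, 1) (y, 1)) = 0"
    using N[of "(0, 1)"] by (simp add: zero_prod_def)
  ultimately obtain K where K: "\<And>u. real_analytic_at K u"
    "\<And>z. (case z of (x, y) \<Rightarrow> k (x, 1) (y, 1)) = circle_of (K z)" "K 0 = 0"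
    by (rule circle_analytic_lift) blast
  have k: "k (x, 1) (y, 1) = circle_of (K (x, y))" for x y
    using K(2)[of "(x, y)"] by simp
  have cont: "continuous_on UNIV K"
    using real_analytic_at_imp_isCont[OF K(1)] by (simp add: continuous_on_eq_continuous_at)
  note cont' = continuous_on_compose2[OF cont _ subset_UNIV]
  have K0: "K (x, 0) = 0" for x
  proof -
    have "K (x, 0) = K (0, 0)"
      by (rule continuous_Ints_valued_constant[of "\<lambda>x. K (x, 0)"])
         (use k[of _ 0] N[of "(_, 1)"] in \<open>auto intro!: cont' continuous_intros simp: circle_of_eq_0_iff\<close>)
    then show ?thesis using K(3) by (simp add: zero_prod_def)
  qed
  have K0': "K (0, x) = 0" for x
  proof -
    have "K (0, x) = K (0, 0)"
      by (rule continuous_Ints_valued_constant[of "\<lambda>x. K (0, x)"])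
         (use k[of 0] N[of "(_, 1)"] in \<open>auto intro!: cont' continuous_intros simp: circle_of_eq_0_iff\<close>)
    then show ?thesis using K(3) by (simp add: zero_prod_def)
  qed
  have "K (x, y) + K (x + y, z) = K (y, z) + K (x, y + z)" for x y z
  proof -
    define h where "h w = K (fst w, fst (snd w)) + K (fst w + fst (snd w), snd (snd w)) -
      K (fst (snd w), snd (snd w)) - K (fst w, fst (snd w) + snd (snd w))" for w
    have "h (x, y, z) = h (0, 0, 0)"
    proof (rule continuous_Ints_valued_constant[of h])
      show "continuous_on UNIV h"
        unfolding h_def by (intro continuous_intros cont')
      fix w :: "'t \<times> 't \<times> 't"
      obtain x y z where w: "w = (x, y, z)" by (cases w) auto
      have "circle_of (h w) = 0"
        using D(6)[of "(x, 1)" "(y, 1)" "(z, 1)"]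
        by (simp add: w h_def circle_of_add circle_of_diff k algebra_simps)
      then show "h w \<in> \<int>" by (simp add: circle_of_eq_0_iff)
    qed
    then show ?thesis by (simp add: h_def K0)
  qed
  moreover have "J (g m) (g y) + K (m, y) = J m y + K (y, m)" if m: "m \<in> L" for m y
  proof -
    have lin: "linear (\<lambda>y. J (g m) (g y))" "linear (J m)"
      using J linear_compose[OF D(1), of "J (g m)"] by (auto simp: bilinear_def o_def)
    define h where "h y = J (g m) (g y) + K (m, y) - J m y - K (y, m)" for y
    have "h y = h 0"
    proof (rule continuous_Ints_valued_constant[of h])
      show "continuous_on UNIV h"
        unfolding h_def
        by (intro continuous_intros cont' linear_continuous_on linear_bounded lin)
      fix y
      have "circle_of (h y) = 0"
        using D(8)[OF m, of 1 y]
        by (simp add: h_def circle_of_add circle_of_diff k algebra_simps)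
      then show "h y \<in> \<int>" by (simp add: circle_of_eq_0_iff)
    qed
    then show ?thesis by (simp add: h_def K0 K0' D)
  qed
  ultimately show thesis using that K(1) k K0 K0' by blast
qed

text \<open>Adding the last relation of \<open>real_lift\<close> for \<open>(m, n)\<close> and for
  \<open>(n, m)\<close> cancels the values of \<open>K\<close>.\<close>

lemma weak_data_orthogonal:
  assumes "weak_data g v \<phi> k" "m \<in> L" "n \<in> L"
  shows "symmetrization J (g m) (g n) = symmetrization J m n"
proof -
  obtain K where K: "\<And>m y. m \<in> L \<Longrightarrow> J (g m) (g y) + K (m, y) = J m y + K (y, m)"
    by (rule real_lift[OF assms(1)]) blast
  show ?thesis
    using K[OF assms(2), of n] K[OF assms(3), of m] by (simp add: symmetrization_def)
qed

text \<open>For \<open>g = id\<close> the last relation of \<open>real_lift\<close> makes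
  \<open>K\<close> symmetric when one argument lies in \<open>L\<close>. The antisymmetrisation of a
  cocycle is additive in each variable, hence linear by continuity, so it vanishes on the span of
  \<open>L\<close>.\<close>

lemma restricted_coboundary:
  assumes d: "weak_data (\<lambda>x. x) 0 \<phi> k"
  obtains \<eta> where "\<And>x. real_analytic_at \<eta> x" "\<eta> 0 = 0"
    "\<And>x y. k (x, 1) (y, 1) = circle_of (\<eta> (x + y)) - circle_of (\<eta> x) - circle_of (\<eta> y)"
proof -
  obtain K where K: "\<And>u. real_analytic_at K u" "\<And>x y. k (x, 1) (y, 1) = circle_of (K (x, y))"
    "\<And>x. K (x, 0) = 0" "\<And>x. K (0, x) = 0"
    "\<And>x y z. K (x, y) + K (x + y, z) = K (y, z) + K (x, y + z)"
    "\<And>m y. m \<in> L \<Longrightarrow> J m y + K (m, y) = J m y + K (y, m)"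
    by (rule real_lift[OF d]) blast
  have cont: "continuous_on UNIV K"
    using real_analytic_at_imp_isCont[OF K(1)] by (simp add: continuous_on_eq_continuous_at)
  note cont' = continuous_on_compose2[OF cont _ subset_UNIV]
  have sym: "K (x, z) = K (z, x)" for x z
  proof -
    have "linear (\<lambda>x. K (x, z) - K (z, x))"
    proof (rule continuous_additive_imp_linear)
      show "continuous_on UNIV (\<lambda>x. K (x, z) - K (z, x))"
        by (intro continuous_intros cont')
      show "K (x + y, z) - K (z, x + y) = K (x, z) - K (z, x) + (K (y, z) - K (z, y))" for x y
        using K(5)[of x y z] K(5)[of x z y] K(5)[of z x y] by (simp add: add.commute)
    qed
    then have "K (x, z) - K (z, x) = 0"
      by (rule linear_eq_on_lattice[OF L _ linear_zero]) (use K(6) in simp)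
    then show ?thesis by simp
  qed
  obtain \<eta> where \<eta>: "\<And>u. real_analytic_at \<eta> u" "\<And>x y. \<eta> (x + y) = \<eta> x + \<eta> y + K (x, y)"
    using symmetric_cocycle_is_coboundary[of K, OF K(1) sym K(5) K(3)] by blast
  show thesis
  proof (rule that[OF \<eta>(1)])
    show "\<eta> 0 = 0" using \<eta>(2)[of 0 0] K(3) by simp
    show "k (x, 1) (y, 1) = circle_of (\<eta> (x + y)) - circle_of (\<eta> x) - circle_of (\<eta> y)" for x y
      by (simp add: K(2) \<eta>(2) circle_of_add)
  qed
qed

text \<open>After a coboundary has been removed from the identity component, the freedom left in
  \<open>c\<close> on the component of \<open>-1\<close> is spent on the pairs involving
  \<open>(0, -1)\<close>. What remains is an additive function of the second argument.\<close>

lemma kernel_cochain: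
  assumes d: "weak_data (\<lambda>x. x) 0 \<phi> k"
  obtains c \<Lambda> where "analytic_potential c" "linear \<Lambda>"
    "\<And>p q. p \<in> S \<Longrightarrow> q \<in> S \<Longrightarrow>
        k p q = c (p \<star> q) - c p - c q + circle_of (if snd p = -1 then \<Lambda> (fst q) else 0)"
proof -
  note D = weak_dataD[OF d] and N = weak_data_norm[OF d]
  obtain \<eta> where \<eta>: "\<And>x. real_analytic_at \<eta> x" "\<eta> 0 = 0"
    "\<And>x y. k (x, 1) (y, 1) = circle_of (\<eta> (x + y)) - circle_of (\<eta> x) - circle_of (\<eta> y)"
    using restricted_coboundary[OF d] by blast
  obtain s where s: "k (0, -1) (0, -1) = circle_of s" using circle_of_surj by blast
  \<comment> \<open>The value of \<open>c\<close> at the involution \<open>(0, -1)\<close>: its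
    coboundary there is \<open>- (b + b)\<close>, so \<open>b\<close> has to be a half of
    \<open>- k (0, -1) (0, -1)\<close>, and halving is done on a real representative.\<close>
  define b where "b = circle_of (- s / 2)"
  have b: "b + b = - k (0, -1) (0, -1)"
    by (simp add: b_def s flip: circle_of_add circle_of_minus)
  \<comment> \<open>The choices make \<open>k - \<delta>c\<close> vanish on the identity component, at \<open>((x, 1), (0, -1))\<close> and at
    \<open>((0, -1), (0, -1))\<close>; the cocycle identity then leaves only \<open>\<psi>\<close>.\<close>
  define c :: "'t \<times> int \<Rightarrow> circle"
    where "c p = circle_of (\<eta> (fst p)) + (if snd p = -1 then k (fst p, 1) (0, -1) + b else 0)" for p
  have c: "analytic_potential c"
    unfolding analytic_potential_def
  proof (intro conjI ballI)
    show "c (0, 1) = 0" by (simp add: c_def \<eta> circle_of_0)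
    fix \<epsilon> :: int assume \<epsilon>: "\<epsilon> \<in> {1, -1}"
    have "circle_analytic (\<lambda>(u, v). k (u, 1) (v, -1))"
      using D(4) by (simp add: analytic_cochain_def)
    then have "circle_analytic (\<lambda>u. (\<lambda>(u, v). k (u, 1) (v, -1)) (u, 0))"
      by (rule circle_analytic_compose_affine[where A = "\<lambda>u. (u, 0)" and c = 0])
         (auto intro: bounded_linear_Pair bounded_linear_ident bounded_linear_zero)
    then have "circle_analytic (\<lambda>u. circle_of (\<eta> u) + (k (u, 1) (0, -1) + b))"
      by (intro circle_analytic_add circle_analytic_const circle_analytic_circle_of \<eta>) simp
    moreover have "circle_analytic (\<lambda>u. circle_of (\<eta> u))"
      by (intro circle_analytic_circle_of \<eta>)
    ultimately show "circle_analytic (\<lambda>u. c (u, \<epsilon>))"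
      using \<epsilon> by (auto simp: c_def)
  qed
  define k' where "k' p q = k p q - (c (p \<star> q) - c p - c q)" for p q
  have cocycle: "k' p q + k' (p \<star> q) r = k' q r + k' p (q \<star> r)" if S: "p \<in> S" "q \<in> S" "r \<in> S" for p q r
  proof -
    have "p \<star> q \<star> r = p \<star> (q \<star> r)" using S by (auto simp: algebra_simps)
    then show ?thesis using D(6)[OF S] by (simp add: k'_def algebra_simps)
  qed
  have pp: "k' (x, 1) (y, 1) = 0" for x y
    by (simp add: k'_def c_def \<eta>(3))
  have c_neg: "c (0, -1) = b" using N[of "(0, -1)"] by (simp add: c_def \<eta> circle_of_0)
  have pn0: "k' (x, 1) (0, -1) = 0" for x
    by (simp add: k'_def c_neg) (simp add: c_def)
  have nn0: "k' (0, -1) (0, -1) = 0"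
    using b by (simp add: k'_def c_neg) (simp add: c_def \<eta> circle_of_0 eq_neg_iff_add_eq_0 algebra_simps)
  define \<psi> where "\<psi> y = k' (0, -1) (y, 1)" for y
  have pos: "k' (x, 1) (y, \<delta>) = 0" if "\<delta> = 1 \<or> \<delta> = -1" for x y \<delta>
  proof -
    have "k' (x, 1) (y, -1) = 0"
      using cocycle[of "(x, 1)" "(y, 1)" "(0, -1)"] by (simp add: pp pn0)
    then show ?thesis using that pp by blast
  qed
  have "k' (x, -1) (0, -1) = 0" for x
    using cocycle[of "(x, 1)" "(0, -1)" "(0, -1)"] pos nn0 by simp
  then have n0n: "k' (0, -1) (y, -1) = \<psi> y" for y
    using cocycle[of "(0, -1)" "(y, 1)" "(0, -1)"] pos by (simp add: \<psi>_def)
  have neg: "k' (x, -1) (y, \<delta>) = \<psi> y" if "\<delta> = 1 \<or> \<delta> = -1" for x y \<delta>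
  proof -
    have "k' (x, -1) (y, 1) = \<psi> y"
      using cocycle[of "(x, 1)" "(0, -1)" "(y, 1)"] by (simp add: pos \<psi>_def)
    moreover have "k' (x, -1) (y, -1) = \<psi> y"
      using cocycle[of "(x, 1)" "(0, -1)" "(y, -1)"] by (simp add: pos n0n)
    ultimately show ?thesis using that by blast
  qed
  have \<psi>_add: "\<psi> (x + y) = \<psi> x + \<psi> y" for x y
    using cocycle[of "(0, -1)" "(x, 1)" "(y, 1)"] by (simp add: pos neg)
  have "analytic_cochain k'"
    using analytic_cochain_add[OF D(4) analytic_cochain_minus[OF analytic_cochain_coboundary[OF c]]]
    by (simp add: k'_def[abs_def] algebra_simps)
  then have "circle_analytic (\<lambda>(u, v). k' (u, -1) (v, 1))"
    by (simp add: analytic_cochain_def)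
  then have "circle_analytic (\<lambda>y. (\<lambda>(u, v). k' (u, -1) (v, 1)) (0, y))"
    by (rule circle_analytic_compose_affine[where A = "\<lambda>u. (0, u)" and c = 0])
       (auto intro: bounded_linear_Pair bounded_linear_ident bounded_linear_zero)
  then have "circle_analytic \<psi>" by (simp add: \<psi>_def[abs_def])
  moreover have "\<psi> 0 = 0" using \<psi>_add[of 0 0] by simp
  ultimately obtain \<Lambda> where \<Lambda>: "\<And>x. real_analytic_at \<Lambda> x" "\<And>x. \<psi> x = circle_of (\<Lambda> x)" "\<Lambda> 0 = 0"
    by (rule circle_analytic_lift) blast
  have cont: "continuous_on UNIV \<Lambda>"
    using real_analytic_at_imp_isCont[OF \<Lambda>(1)] by (simp add: continuous_on_eq_continuous_at)
  have \<Lambda>_lin: "linear \<Lambda>"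
  proof (rule continuous_additive_imp_linear[OF cont])
    fix x y
    \<comment> \<open>\<open>\<Lambda>\<close> lifts the additive \<open>\<psi>\<close>, so its
      defect of additivity is integer valued, hence constant, and zero at the origin.\<close>
    define h where "h w = \<Lambda> (fst w + snd w) - \<Lambda> (fst w) - \<Lambda> (snd w)" for w
    have "h (x, y) = h (0, 0)"
    proof (rule continuous_Ints_valued_constant[of h])
      show "continuous_on UNIV h"
        unfolding h_def by (intro continuous_intros continuous_on_compose2[OF cont _ subset_UNIV])
      have "circle_of (h w) = 0" for w
        by (simp add: h_def circle_of_diff \<psi>_add flip: \<Lambda>(2))
      then show "h w \<in> \<int>" for w by (simp add: circle_of_eq_0_iff)
    qed
    then show "\<Lambda> (x + y) = \<Lambda> x + \<Lambda> y" by (simp add: h_def \<Lambda>)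
  qed
  show thesis
  proof (rule that[OF c \<Lambda>_lin])
    fix p q assume pq: "p \<in> S" "q \<in> S"
    have "k' p q = circle_of (if snd p = -1 then \<Lambda> (fst q) else 0)"
      using pq pos neg by (auto simp: circle_of_0 \<Lambda>(2))
    then show "k p q = c (p \<star> q) - c p - c q + circle_of (if snd p = -1 then \<Lambda> (fst q) else 0)"
      by (simp add: k'_def algebra_simps)
  qed
qed

end

text \<open>Unimodularity in the form in which the kernel computation calls for it: an integral
  functional is represented by a lattice vector.\<close>

locale unimodular_theta_data = theta_data +
  assumes unimodular: "\<And>\<xi>. linear \<xi> \<Longrightarrow> (\<And>m. m \<in> L \<Longrightarrow> \<xi> m \<in> \<int>) \<Longrightarrow>
      \<exists>l\<in>L. \<forall>m\<in>L. symmetrization J l m = \<xi> m"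
begin

interpretation W: group W by (rule group_W)

text \<open>Modulo the coboundary of \<open>c\<close>, \<open>\<phi>\<close> becomes a character
  \<open>\<phi>'\<close> of \<open>L\<close> whose double is minus the class of
  \<open>\<Lambda>\<close>. A linear lift \<open>f\<close> of \<open>\<phi>'\<close> then makes
  \<open>2 f + \<Lambda>\<close> integral on \<open>L\<close>, and the vector representing it gives
  the conjugating element.\<close>

lemma weak_map_kernel:
  assumes d: "weak_data (\<lambda>x. x) 0 \<phi> k"
  shows "\<exists>n\<in>delta_image. \<exists>p\<in>S. weak_map L (\<lambda>x. x) 0 \<phi> k = n \<cdot> Ad_plus \<Theta> p"
proof -
  note D = weak_dataD[OF d] and N = weak_data_norm[OF d]
  obtain c \<Lambda> where c: "analytic_potential c" and \<Lambda>: "linear \<Lambda>"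
    and k: "\<And>p q. p \<in> S \<Longrightarrow> q \<in> S \<Longrightarrow>
        k p q = c (p \<star> q) - c p - c q + circle_of (if snd p = -1 then \<Lambda> (fst q) else 0)"
    using kernel_cochain[OF d] by blast
  define \<phi>' where "\<phi>' m = \<phi> m - c (m, 1)" for m
  have \<phi>'_add: "\<phi>' (m + n) = \<phi>' m + \<phi>' n" if "m \<in> L" "n \<in> L" for m n
    using D(7)[OF that] k[of "(m, 1)" "(n, 1)"] by (simp add: \<phi>'_def circle_of_0 algebra_simps)
  have \<phi>'_0: "\<phi>' 0 = 0" using \<phi>'_add[of 0 0] by simp
  have \<phi>'_double: "\<phi>' m + \<phi>' m = - circle_of (\<Lambda> m)" if m: "m \<in> L" for m
  proof -
    have "\<phi>' m + \<phi>' (- m) = 0" using \<phi>'_add[of m "- m"] m \<phi>'_0 by simp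
    then have "\<phi>' (- m) = - \<phi>' m" by (simp add: eq_neg_iff_add_eq_0 add.commute)
    \<comment> \<open>The last condition of \<open>weak_data\<close> at \<open>(0, -1)\<close>,
      which compares \<open>m\<close> with \<open>- m\<close> and thereby ties
      \<open>\<phi>'\<close> to \<open>\<Lambda>\<close>.\<close>
    moreover have "\<phi>' m = \<phi>' (- m) + circle_of (\<Lambda> (- m))"
      using D(8)[OF m, of "-1" 0] k[of "(m, 1)" "(0, -1)"] k[of "(0, -1)" "(- m, 1)"]
      by (simp add: \<phi>'_def circle_of_0 algebra_simps)
    ultimately have "\<phi>' m + \<phi>' m = \<phi>' m + (- \<phi>' m - circle_of (\<Lambda> m))"
      by (simp add: linear_neg[OF \<Lambda>] circle_of_minus)
    then show ?thesis by simp
  qed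
  obtain f where f: "linear f" "\<And>m. m \<in> L \<Longrightarrow> \<phi>' m = circle_of (f m)"
    using lattice_hom_extension[OF L \<phi>'_add, of circle_of] circle_of_add circle_of_surj
    by (metis surjI surj_def)
  define \<xi> where "\<xi> m = - (2 * f m + \<Lambda> m)" for m
  have "linear \<xi>"
    unfolding \<xi>_def by (simp add: linear_iff linear_add[OF f(1)] linear_add[OF \<Lambda>]
        linear_scale[OF f(1)] linear_scale[OF \<Lambda>] algebra_simps)
  moreover have "\<xi> m \<in> \<int>" if "m \<in> L" for m
  proof -
    have "circle_of (\<xi> m) = - (\<phi>' m + \<phi>' m + circle_of (\<Lambda> m))"
      unfolding \<xi>_def circle_of_minus circle_of_add circle_of_double f(2)[OF that] ..
    then show ?thesis using \<phi>'_double[OF that] by (simp add: circle_of_eq_0_iff)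
  qed
  ultimately obtain l where l: "l \<in> L" "\<And>m. m \<in> L \<Longrightarrow> symmetrization J l m = \<xi> m"
    using unimodular by blast
  \<comment> \<open>On the component of \<open>-1\<close> the coboundary of \<open>\<zeta>\<close>
    is \<open>-2 \<zeta>\<close>, so the first requirement is
    \<open>-2 \<zeta> - J l = \<Lambda>\<close>. By the choice of \<open>\<xi>\<close> the second
    one, \<open>\<zeta> m - J m l / 2 = f m\<close> on \<open>L\<close>, holds as well.\<close>
  define \<zeta> where "\<zeta> x = - (1/2) * (\<Lambda> x + J l x)" for x
  have lin_J: "linear (J l)" using J by (simp add: bilinear_def)
  have \<zeta>: "linear \<zeta>"
    unfolding \<zeta>_def by (simp add: linear_iff linear_add[OF \<Lambda>] linear_scale[OF \<Lambda>]
        linear_scale[OF lin_J] algebra_simps add_divide_distrib)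
  define c' where "c' p = c p + circle_of (\<zeta> (fst p))" for p
  have "analytic_potential (\<lambda>p. circle_of (\<zeta> (fst p)))"
    using circle_analytic_circle_of[OF real_analytic_at_affine[OF linear_bounded[OF \<zeta>], of 0]]
    by (simp add: analytic_potential_def circle_of_0 linear_0[OF \<zeta>])
  then have c': "analytic_potential c'"
    unfolding c'_def[abs_def] by (intro analytic_potential_add c)
  \<comment> \<open>The composition formula pulls the potential back along conjugation by
    \<open>l/2\<close>, a shift by \<open>l\<close>; the opposite shift is built in
    beforehand.\<close>
  define c'' where "c'' p = c' (affine_sd (\<lambda>x. x) (- l) p)" for p
  have c'': "analytic_potential c''"
    unfolding c''_def by (intro analytic_potential_compose c' bounded_linear_ident)
  have one: "(1 :: int) = 1 \<or> (1 :: int) = -1" by simp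
  have "delta_map l c'' \<cdot> Ad_plus \<Theta> ((1/2) *\<^sub>R l, 1) = weak_map L (\<lambda>x. x) 0 \<phi> k"
    unfolding delta_map_def Ad_plus_weak_map[OF one] mult_W
      weak_comp_weak_map[OF weak_data_delta[OF l(1) c''] weak_data_Ad[OF one]]
  proof (rule weak_map_cong)
    fix m assume m: "m \<in> L"
    have "\<zeta> m - (1/2) * J m l = f m"
      using l(2)[OF m] by (simp add: \<zeta>_def \<xi>_def symmetrization_def field_simps)
    then have "circle_of (f m) = circle_of (\<zeta> m) - circle_of ((1/2) * J m l)"
      by (simp flip: circle_of_diff)
    moreover have Jm: "J m ((1/2) *\<^sub>R l) = (1/2) * J m l"
      using J by (simp add: bilinear_rmul)
    ultimately show "- circle_of (of_int 1 * J m ((1/2) *\<^sub>R l)) + c'' (of_int 1 *\<^sub>R m, 1) = \<phi> m"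
      unfolding Jm using f(2)[OF m] by (simp add: c''_def c'_def \<phi>'_def algebra_simps)
  next
    fix p q assume pq: "p \<in> S" "q \<in> S"
    let ?A = "affine_sd (\<lambda>x. of_int 1 *\<^sub>R x) (2 *\<^sub>R (1/2) *\<^sub>R l)"
    have A: "c'' (?A p) = c' p" if "p \<in> S" for p
      using that by (auto simp: c''_def)
    have mult: "?A p \<star> ?A q = ?A (p \<star> q)"
      by (rule affine_sd_mult[OF _ pq, symmetric]) (simp add: linear_iff)
    have Jq: "circle_of (J l (fst (?A q))) = circle_of (J l (fst q))"
      using l(1) by (auto simp: affine_sd_def circle_of_add)
    have \<zeta>2: "- 2 * \<zeta> x - J l x = \<Lambda> x" for x by (simp add: \<zeta>_def field_simps)
    have "circle_of (\<zeta> (fst (p \<star> q))) - circle_of (\<zeta> (fst p)) - circle_of (\<zeta> (fst q)) -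
        circle_of (if snd p = -1 then J l (fst q) else 0) =
        circle_of (if snd p = -1 then \<Lambda> (fst q) else 0)"
      using pq \<zeta>2 by (auto simp: linear_add[OF \<zeta>] linear_diff[OF \<zeta>] simp flip: circle_of_diff)
    moreover have Jeq: "circle_of (if snd (?A p) = -1 then J l (fst (?A q)) else 0) =
        circle_of (if snd p = -1 then J l (fst q) else 0)"
      using Jq by (simp add: affine_sd_def)
    ultimately show "0 + delta_cochain l c'' (?A p) (?A q) = k p q"
      unfolding delta_cochain_def mult A[OF pq(1)] A[OF pq(2)] A[OF sd_mult_mem[OF pq]] k[OF pq] Jeq
      by (simp add: c'_def algebra_simps)
  qed auto
  moreover have "delta_map l c'' \<in> delta_image" using l(1) c'' by (auto simp: delta_image_def)
  moreover have "((1/2) *\<^sub>R l, 1) \<in> S" by simp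
  ultimately show ?thesis by metis
qed

lemma W_kernel:
  assumes d: "weak_data g v \<phi> k" and g: "g = (\<lambda>x. x) \<or> g = (\<lambda>x. - x)"
  shows "\<exists>n\<in>delta_image. \<exists>p\<in>S. weak_map L g v \<phi> k = n \<cdot> Ad_plus \<Theta> p"
proof -
  define \<sigma> :: int where "\<sigma> = (if g = (\<lambda>x. x) then 1 else -1)"
  have g': "g x = of_int \<sigma> *\<^sub>R x" and \<sigma>: "\<sigma> = 1 \<or> \<sigma> = -1" for x
    using g by (auto simp: \<sigma>_def)
  let ?F = "weak_map L g v \<phi> k"
  \<comment> \<open>Chosen so that composing with \<open>Ad_plus\<close> of \<open>a\<close> turns
    \<open>g\<close> into the identity and \<open>v\<close> into 0; \<open>b\<close> is the inverse
    of \<open>a\<close>.\<close>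
  define a where "a = (- (of_int \<sigma> * (1/2)) *\<^sub>R v, \<sigma>)"
  define b where "b = ((1/2) *\<^sub>R v, \<sigma>)"
  have ab: "a \<in> S" "b \<in> S" "a \<star> b = (0, 1)" using \<sigma> by (auto simp: a_def b_def)
  have F: "?F \<in> carrier W" by (rule weak_map_in_W[OF d])
  note Ad = weak_data_Ad[OF \<sigma>]
  have comp: "?F \<cdot> Ad_plus \<Theta> a \<in> {weak_map L (\<lambda>x. x) 0 \<phi>' k' | \<phi>' k'. weak_data (\<lambda>x. x) 0 \<phi>' k'}"
  proof -
    have 1: "(\<lambda>x. g (of_int \<sigma> *\<^sub>R x)) = (\<lambda>x. x)" using \<sigma> by (auto simp: g')
    have 2: "g (2 *\<^sub>R (- (of_int \<sigma> * (1/2)) *\<^sub>R v)) + v = 0" using \<sigma> by (auto simp: g')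
    show ?thesis
      unfolding a_def Ad_plus_weak_map[OF \<sigma>] mult_W weak_comp_weak_map[OF d Ad]
      using weak_data_comp[OF d Ad, of "- (of_int \<sigma> * (1/2)) *\<^sub>R v"] unfolding 1 2 by blast
  qed
  then obtain \<phi>' k' where d': "weak_data (\<lambda>x. x) 0 \<phi>' k'"
    and F': "?F \<cdot> Ad_plus \<Theta> a = weak_map L (\<lambda>x. x) 0 \<phi>' k'" by blast
  obtain n p where n: "n \<in> delta_image" and p: "p \<in> S"
    and eq: "?F \<cdot> Ad_plus \<Theta> a = n \<cdot> Ad_plus \<Theta> p"
    using weak_map_kernel[OF d'] unfolding F' by blast
  have nW: "n \<in> carrier W" using n delta_image_subset by blast
  have "Ad_plus \<Theta> (0, 1) = \<one>\<^bsub>W\<^esub>"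
    using Ad_plus_weak_map[of 1 0] by (simp add: one_W weak_one_def circle_of_0)
  then have "?F = ?F \<cdot> Ad_plus \<Theta> (a \<star> b)" using F ab(3) by simp
  also have "\<dots> = ?F \<cdot> Ad_plus \<Theta> a \<cdot> Ad_plus \<Theta> b"
    using F Ad_plus_mem[OF ab(1)] Ad_plus_mem[OF ab(2)] by (simp only: Ad_plus_mult[OF ab(1,2)] W.m_assoc)
  also have "\<dots> = n \<cdot> Ad_plus \<Theta> (p \<star> b)"
    unfolding eq using nW Ad_plus_mem[OF p] Ad_plus_mem[OF ab(2)]
    by (simp only: Ad_plus_mult[OF p ab(2)] W.m_assoc)
  finally show ?thesis using n sd_mult_mem[OF p ab(2)] by (intro bexI)
qed

end

section \<open>Orthogonal automorphisms and the quotient\<close>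

text \<open>\<open>C\<close> is the strictly upper triangular part of the matrix of \<open>A\<close>
  in a lattice basis, ordered by \<open>idx\<close>. Its entries are entries of \<open>A\<close> or
  0, which keeps it integral.\<close>

lemma alternating_eq_skew:
  fixes L :: "'t::real_normed_vector set" and A :: "'t \<Rightarrow> 't \<Rightarrow> real"
  assumes L: "full_lattice L" and A: "bilinear A"
    and alt: "\<And>m n. m \<in> L \<Longrightarrow> n \<in> L \<Longrightarrow> A m n = - A n m"
    and Ints: "\<And>m n. m \<in> L \<Longrightarrow> n \<in> L \<Longrightarrow> A m n \<in> \<int>"
  obtains C where "bilinear C" "\<And>x y. A x y = C x y - C y x"
    "\<And>m n. m \<in> L \<Longrightarrow> n \<in> L \<Longrightarrow> C m n \<in> \<int>"
proof -
  obtain B where B: "finite B" "independent B" "span B = UNIV"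
    "L = range (\<lambda>c :: 't \<Rightarrow> int. \<Sum>b\<in>B. of_int (c b) *\<^sub>R b)"
    and BL: "\<And>b. b \<in> B \<Longrightarrow> b \<in> L"
    by (rule full_lattice_basis[OF L]) blast
  obtain idx :: "'t \<Rightarrow> nat" where idx: "inj_on idx B"
    using finite_imp_inj_to_nat_seg[OF B(1)] by blast
  have A_lin: "linear (A x)" "linear (\<lambda>x. A x y)" for x y
    using A by (auto simp: bilinear_def)
  \<comment> \<open>Skew symmetry passes from \<open>L\<close> to its span in one variable at a
    time.\<close>
  have alt': "A x y = - A y x" for x y
  proof -
    have 1: "A m y = - A y m" if "m \<in> L" for m y
      by (rule linear_eq_on_lattice[OF L A_lin(1) linear_compose_neg[OF A_lin(2)]]) (rule alt[OF that])
    show ?thesis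
      by (rule linear_eq_on_lattice[OF L A_lin(2) linear_compose_neg[OF A_lin(1)]]) (rule 1)
  qed
  define R where "R x b = representation B x b" for x b
  have R_lin: "linear (\<lambda>x. R x b)" for b
    unfolding R_def using B by (simp add: linear_iff representation_add representation_scale)
  have R_sum: "x = (\<Sum>b\<in>B. R x b *\<^sub>R b)" for x
    unfolding R_def using B by (simp add: sum_representation_eq)
  have R_Ints: "R m b \<in> \<int>" if m: "m \<in> L" for m b
  proof (cases "b \<in> B")
    case True
    obtain c :: "'t \<Rightarrow> int" where c: "m = (\<Sum>b\<in>B. of_int (c b) *\<^sub>R b)" using m B(4) by auto
    have "R m b = (\<Sum>b'\<in>B. of_int (c b') * R b' b)"
      unfolding c linear_sum[OF R_lin] by (simp add: linear_scale[OF R_lin])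
    also have "\<dots> = (\<Sum>b'\<in>B. if b' = b then of_int (c b') else 0)"
      using B(2) by (intro sum.cong) (auto simp: R_def representation_basis)
    finally show ?thesis using B(1) True by simp
  next
    case False
    then have "R m b = 0" using representation_ne_zero[of B m b] by (auto simp: R_def)
    then show ?thesis by simp
  qed
  define a where "a b b' = (if idx b < idx b' then A b b' else 0)" for b b'
  define C where "C x y = (\<Sum>b\<in>B. \<Sum>b'\<in>B. R x b * R y b' * a b b')" for x y
  have "bilinear C"
    unfolding bilinear_def C_def
    by (auto simp: linear_iff linear_add[OF R_lin] linear_scale[OF R_lin] algebra_simps
        sum.distrib sum_distrib_left)
  moreover have "A x y = C x y - C y x" for x y
  proof -
    have "A x y = (\<Sum>b\<in>B. \<Sum>b'\<in>B. R x b * R y b' * A b b')"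
    proof -
      have "A x y = (\<Sum>b\<in>B. R x b * A b y)"
        by (subst R_sum[of x]) (simp add: linear_sum[OF A_lin(2)] linear_scale[OF A_lin(2)])
      moreover have "A b y = (\<Sum>b'\<in>B. R y b' * A b b')" for b
        by (subst R_sum[of y]) (simp add: linear_sum[OF A_lin(1)] linear_scale[OF A_lin(1)])
      ultimately show ?thesis by (simp add: sum_distrib_left mult.assoc)
    qed
    also have "\<dots> = (\<Sum>b\<in>B. \<Sum>b'\<in>B. R x b * R y b' * a b b' - R x b * R y b' * a b' b)"
    proof (intro sum.cong refl)
      fix b b' assume b: "b \<in> B" "b' \<in> B"
      have "A b b' = a b b' - a b' b"
      proof (cases "idx b = idx b'")
        case True
        \<comment> \<open>On the diagonal \<open>a\<close> is zero, and so is \<open>A b b\<close>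
          by skew symmetry.\<close>
        then have "b = b'" using idx b by (auto dest: inj_onD)
        then show ?thesis using alt'[of b b] by simp
      next
        case False
        then show ?thesis using alt'[of b b'] by (simp add: a_def)
      qed
      then show "R x b * R y b' * A b b' = R x b * R y b' * a b b' - R x b * R y b' * a b' b"
        by (simp only: right_diff_distrib)
    qed
    also have "\<dots> = C x y - (\<Sum>b\<in>B. \<Sum>b'\<in>B. R x b * R y b' * a b' b)"
      by (simp add: C_def sum_subtractf)
    also have "(\<Sum>b\<in>B. \<Sum>b'\<in>B. R x b * R y b' * a b' b) = C y x"
      unfolding C_def by (subst sum.swap) (simp add: mult_ac)
    finally show ?thesis .
  qed
  moreover have "C m n \<in> \<int>" if "m \<in> L" "n \<in> L" for m n
    unfolding C_def a_def using that by (intro Ints_sum Ints_mult R_Ints) (auto intro: Ints BL)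
  ultimately show thesis using that by blast
qed

section \<open>The homomorphism from \<open>W\<close> to the orthogonal group\<close>

context theta_data begin

interpretation W: group W by (rule group_W)

abbreviation "OG \<equiv> orthogonal_lattice_group L (symmetrization J)"

lemma OG_carrier: "g \<in> carrier OG \<longleftrightarrow>
    g \<in> extensional L \<and> bij_betw g L L \<and> (\<forall>m\<in>L. \<forall>n\<in>L. g (m + n) = g m + g n) \<and>
    (\<forall>m\<in>L. \<forall>n\<in>L. symmetrization J (g m) (g n) = symmetrization J m n)"
  by (auto simp: orthogonal_lattice_group_def auto_def lattice_group_def hom_def Bij_def
      bij_betw_def Pi_def)

lemma OG_mult: "g \<in> carrier OG \<Longrightarrow> h \<in> carrier OG \<Longrightarrow> g \<otimes>\<^bsub>OG\<^esub> h = compose L g h"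
  by (simp add: orthogonal_lattice_group_def auto_def lattice_group_def AutoGroup_def BijGroup_def)

lemma OG_one: "\<one>\<^bsub>OG\<^esub> = (\<lambda>m\<in>L. m)"
  by (simp add: orthogonal_lattice_group_def AutoGroup_def BijGroup_def lattice_group_def)

lemma OG_mem: "g \<in> carrier OG \<Longrightarrow> m \<in> L \<Longrightarrow> g m \<in> L"
  by (auto simp: OG_carrier dest: bij_betwE)

lemma group_OG: "group OG"
proof (rule groupI)
  have one: "(\<lambda>m\<in>L. m) \<in> carrier OG"
    by (auto simp: OG_carrier bij_betw_def inj_on_def)
  then show "\<one>\<^bsub>OG\<^esub> \<in> carrier OG" by (simp add: OG_one)
  fix g assume g: "g \<in> carrier OG"
  show "\<one>\<^bsub>OG\<^esub> \<otimes>\<^bsub>OG\<^esub> g = g"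
    using g OG_mem[OF g] one by (auto simp: OG_one OG_mult compose_def fun_eq_iff OG_carrier extensional_def)
  have closed: "compose L g h \<in> carrier OG" if "h \<in> carrier OG" for h
    using g that OG_mem[OF g] OG_mem[OF that] unfolding OG_carrier
    by (auto simp: compose_extensional bij_betw_compose compose_eq)
  fix h assume h: "h \<in> carrier OG"
  show gh: "g \<otimes>\<^bsub>OG\<^esub> h \<in> carrier OG" using closed[OF h] by (simp add: OG_mult g h)
  fix k assume k: "k \<in> carrier OG"
  have hk: "compose L h k \<in> carrier OG"
    using h k OG_mem[OF h] OG_mem[OF k] unfolding OG_carrier
    by (auto simp: compose_extensional bij_betw_compose compose_eq)
  show "g \<otimes>\<^bsub>OG\<^esub> h \<otimes>\<^bsub>OG\<^esub> k = g \<otimes>\<^bsub>OG\<^esub> (h \<otimes>\<^bsub>OG\<^esub> k)"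
    unfolding OG_mult[OF g h] OG_mult[OF h k] OG_mult[OF closed[OF h] k] OG_mult[OF g hk]
    using OG_mem[OF k] by (auto simp: compose_def fun_eq_iff)
next
  fix g assume g: "g \<in> carrier OG"
  define h where "h = (\<lambda>m\<in>L. inv_into L g m)"
  have bij: "bij_betw g L L" using g by (simp add: OG_carrier)
  have hg: "h (g m) = m" if "m \<in> L" for m
    using that bij OG_mem[OF g that] by (simp add: h_def bij_betw_def inv_into_f_f)
  have gh: "g (h m) = m" and hL: "h m \<in> L" if "m \<in> L" for m
    using that bij by (auto simp: h_def bij_betw_def f_inv_into_f inv_into_into)
  have "bij_betw h L L" by (rule bij_betw_byWitness[where f' = g]) (use gh hg hL OG_mem[OF g] in auto)
  moreover have "h (m + n) = h m + h n" if "m \<in> L" "n \<in> L" for m n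
    using hg[of "h m + h n"] that g gh hL by (simp add: OG_carrier)
  moreover have "symmetrization J (h m) (h n) = symmetrization J m n" if "m \<in> L" "n \<in> L" for m n
    using g hL[OF that(1)] hL[OF that(2)] gh[OF that(1)] gh[OF that(2)] unfolding OG_carrier by metis
  ultimately have h: "h \<in> carrier OG" by (simp add: OG_carrier h_def)
  moreover have "h \<otimes>\<^bsub>OG\<^esub> g = \<one>\<^bsub>OG\<^esub>"
    using g h hg by (auto simp: OG_mult OG_one compose_def fun_eq_iff restrict_def)
  ultimately show "\<exists>h\<in>carrier OG. h \<otimes>\<^bsub>OG\<^esub> g = \<one>\<^bsub>OG\<^esub>" by blast
qed

interpretation OG: group OG by (rule group_OG)

definition plus_minus :: "('t \<Rightarrow> 't) set" where
  "plus_minus = {\<lambda>m\<in>L. m, \<lambda>m\<in>L. - m}"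

lemma plus_minus_mult:
  "(\<lambda>m\<in>L. - m) \<in> carrier OG" "(\<lambda>m\<in>L. - m) \<otimes>\<^bsub>OG\<^esub> (\<lambda>m\<in>L. - m) = \<one>\<^bsub>OG\<^esub>"
  "g \<in> carrier OG \<Longrightarrow> g \<otimes>\<^bsub>OG\<^esub> (\<lambda>m\<in>L. - m) = (\<lambda>m\<in>L. - m) \<otimes>\<^bsub>OG\<^esub> g"
proof -
  have "bij_betw (\<lambda>m\<in>L. - m) L L"
    by (rule bij_betw_byWitness[where f' = uminus]) auto
  then show neg: "(\<lambda>m\<in>L. - m) \<in> carrier OG"
    by (auto simp: OG_carrier symmetrization_def)
  then show "(\<lambda>m\<in>L. - m) \<otimes>\<^bsub>OG\<^esub> (\<lambda>m\<in>L. - m) = \<one>\<^bsub>OG\<^esub>"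
    by (auto simp: OG_mult OG_one compose_def fun_eq_iff restrict_def)
  assume g: "g \<in> carrier OG"
  have add: "g (m + n) = g m + g n" if "m \<in> L" "n \<in> L" for m n
    using g that by (simp add: OG_carrier)
  have "g 0 = 0" using add[of 0 0] by simp
  then have "g (- m) = - g m" if "m \<in> L" for m
    using add[of m "- m"] that by (simp add: eq_neg_iff_add_eq_0 add.commute)
  then show "g \<otimes>\<^bsub>OG\<^esub> (\<lambda>m\<in>L. - m) = (\<lambda>m\<in>L. - m) \<otimes>\<^bsub>OG\<^esub> g"
    using g neg OG_mem[OF g] by (auto simp: OG_mult compose_def fun_eq_iff restrict_def)
qed

text \<open>The nontrivial element is a central involution.\<close>

lemma plus_minus_normal: "plus_minus \<lhd> OG"
  unfolding OG.normal_inv_iff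
proof (intro conjI ballI)
  note neg = plus_minus_mult(1,2)
  have pm: "plus_minus = {\<one>\<^bsub>OG\<^esub>, \<lambda>m\<in>L. - m}" by (simp add: plus_minus_def OG_one)
  have inv: "inv\<^bsub>OG\<^esub> (\<lambda>m\<in>L. - m) = (\<lambda>m\<in>L. - m)"
    using OG.inv_equality neg by blast
  show "subgroup plus_minus OG"
    by (rule OG.subgroupI) (use neg inv in \<open>auto simp: pm\<close>)
  fix g h assume g: "g \<in> carrier OG" and h: "h \<in> plus_minus"
  then have "g \<otimes>\<^bsub>OG\<^esub> h = h \<otimes>\<^bsub>OG\<^esub> g" "h \<in> carrier OG"
    using plus_minus_mult(3)[OF g] neg by (auto simp: pm)
  then have "g \<otimes>\<^bsub>OG\<^esub> h \<otimes>\<^bsub>OG\<^esub> inv\<^bsub>OG\<^esub> g = h" using g by (simp add: OG.m_assoc)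
  then show "g \<otimes>\<^bsub>OG\<^esub> h \<otimes>\<^bsub>OG\<^esub> inv\<^bsub>OG\<^esub> g \<in> plus_minus" using h by simp
qed

definition lattice_part :: "('t \<times> circle, 't \<times> int) wmap \<Rightarrow> 't \<Rightarrow> 't" where
  "lattice_part F = (\<lambda>m\<in>L. fst (fst F (m, 1)))"

lemma lattice_part_weak_map: "lattice_part (weak_map L g v \<phi> k) = (\<lambda>m\<in>L. g m)"
  by (auto simp: lattice_part_def weak_map_def)

lemma lattice_part_mem:
  assumes d: "weak_data g v \<phi> k"
  shows "(\<lambda>m\<in>L. g m) \<in> carrier OG"
proof -
  note D = weak_dataD[OF d]
  have "bij_betw g L L"
    using D(2,3) by (auto simp: bij_betw_def dest: bij_is_inj intro: inj_on_subset)
  then have "bij_betw (\<lambda>m\<in>L. g m) L L" by (simp cong: bij_betw_cong)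
  then show ?thesis
    using weak_data_orthogonal[OF d] by (simp add: OG_carrier linear_add[OF D(1)])
qed

lemma lattice_part_hom: "lattice_part \<in> hom W OG"
proof (rule homI)
  fix F assume "F \<in> carrier W"
  then obtain g v \<phi> k where d: "weak_data g v \<phi> k" and F: "F = weak_map L g v \<phi> k" by (rule W_E)
  show "lattice_part F \<in> carrier OG"
    unfolding F lattice_part_weak_map by (rule lattice_part_mem[OF d])
  fix G assume "G \<in> carrier W"
  then obtain g' v' \<phi>' k' where d': "weak_data g' v' \<phi>' k'" and G: "G = weak_map L g' v' \<phi>' k'" by (rule W_E)
  show "lattice_part (F \<cdot> G) = lattice_part F \<otimes>\<^bsub>OG\<^esub> lattice_part G"
    unfolding F G mult_W weak_comp_weak_map[OF d d'] lattice_part_weak_map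
      OG_mult[OF lattice_part_mem[OF d] lattice_part_mem[OF d']]
    using weak_dataD(9)[OF d'] by (auto simp: compose_def fun_eq_iff restrict_def)
qed

text \<open>With \<open>C\<close> integral on \<open>L\<close>, the cocycle built from it vanishes
  on \<open>L\<close>, so it can be paired with \<open>\<phi> = 0\<close>; the relation between
  \<open>C\<close> and \<open>J \<circ> g - J\<close> is then exactly the last condition of
  \<open>weak_data\<close>.\<close>

lemma lattice_part_surj:
  assumes g: "g \<in> carrier OG"
  shows "\<exists>F\<in>carrier W. lattice_part F = g"
proof -
  have bij: "bij_betw g L L" and add: "\<And>m n. m \<in> L \<Longrightarrow> n \<in> L \<Longrightarrow> g (m + n) = g m + g n"
    and ext: "g \<in> extensional L" using g by (auto simp: OG_carrier)
  \<comment> \<open>The lattice automorphism has to be extended to the whole space, since weak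
    automorphisms act there.\<close>
  have lift: "\<exists>f. linear f \<and> (\<forall>m\<in>L. f m = h m)" if h: "h \<in> carrier OG" for h
    using lattice_hom_extension[OF L, of h "\<lambda>x. x"] h by (auto simp: OG_carrier) metis
  obtain f where f: "linear f" "\<And>m. m \<in> L \<Longrightarrow> f m = g m" using lift[OF g] by blast
  define h where "h = inv\<^bsub>OG\<^esub> g"
  have h: "h \<in> carrier OG" unfolding h_def using g by simp
  have gh: "g (h m) = m" "h (g m) = m" if m: "m \<in> L" for m
  proof -
    have "compose L g h = (\<lambda>m\<in>L. m)" "compose L h g = (\<lambda>m\<in>L. m)"
      using OG_mult[OF g h] OG_mult[OF h g] g by (simp_all add: h_def OG_one)
    then show "g (h m) = m" "h (g m) = m"
      using m by (metis compose_eq restrict_apply')+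
  qed
  obtain f' where f': "linear f'" "\<And>m. m \<in> L \<Longrightarrow> f' m = h m" using lift[OF h] by blast
  have id_lin: "linear (\<lambda>x :: 't. x)" by (simp add: linear_iff)
  have "f (f' x) = x" for x
    by (rule linear_eq_on_lattice[OF L linear_compose[OF f'(1) f(1), unfolded o_def] id_lin])
       (simp add: f f' OG_mem[OF h] gh)
  moreover have "f' (f x) = x" for x
    by (rule linear_eq_on_lattice[OF L linear_compose[OF f(1) f'(1), unfolded o_def] id_lin])
       (simp add: f f' OG_mem[OF g] gh)
  ultimately have bij_f: "bij f" by (intro o_bij[of f']) (auto simp: fun_eq_iff)
  have fL: "f ` L = L" using bij f(2) by (auto simp: bij_betw_def image_iff)
  define A where "A x y = J (f x) (f y) - J x y" for x y
  have J_lin: "linear (J x)" "linear (\<lambda>x. J x y)" for x y using J by (auto simp: bilinear_def)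
  have A: "bilinear A"
    unfolding bilinear_def A_def
    by (auto intro!: linear_compose_sub J_lin linear_compose[OF f(1), unfolded o_def])
  have orth: "symmetrization J (f m) (f n) = symmetrization J m n" if "m \<in> L" "n \<in> L" for m n
    using g that by (simp add: OG_carrier f)
  have alt: "A m n = - A n m" if "m \<in> L" "n \<in> L" for m n
    using orth[OF that] by (simp add: A_def symmetrization_def)
  have "A m n \<in> \<int>" if "m \<in> L" "n \<in> L" for m n
    unfolding A_def using that fL by (intro Ints_diff J_Ints) auto
  from alternating_eq_skew[OF L A alt this] obtain C where C: "bilinear C" "\<And>x y. A x y = C x y - C y x"
    "\<And>m n. m \<in> L \<Longrightarrow> n \<in> L \<Longrightarrow> C m n \<in> \<int>" by blast
  \<comment> \<open>The bilinear cocycle of \<open>C\<close>, twisted by the sign of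
    \<open>p\<close> to match the semidirect product; the cocycle identity uses that
    \<open>C\<close> is unchanged when both arguments change sign.\<close>
  define k where "k p q = circle_of (- C (fst p) (of_int (snd p) *\<^sub>R fst q))" for p q :: "'t \<times> int"
  note C_simps = bilinear_ladd[OF C(1)] bilinear_radd[OF C(1)] bilinear_lneg[OF C(1)]
    bilinear_rneg[OF C(1)] bilinear_lsub[OF C(1)] bilinear_rsub[OF C(1)] bilinear_lmul[OF C(1)]
    bilinear_rmul[OF C(1)] bilinear_lzero[OF C(1)] bilinear_rzero[OF C(1)]
  have "weak_data f 0 (\<lambda>_. 0) k"
    unfolding weak_data_def
  proof (intro conjI ballI allI f(1) bij_f fL)
    show "analytic_cochain k"
      unfolding analytic_cochain_def
    proof (intro ballI)
      fix \<epsilon> \<delta> :: int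
      have "bounded_bilinear (\<lambda>x y. - of_int \<epsilon> * C x y)"
      proof (rule bilinear_bounded)
        show "bilinear (\<lambda>x y. - of_int \<epsilon> * C x y)"
          by (auto simp: bilinear_def linear_iff C_simps algebra_simps)
      qed
      from circle_analytic_circle_of[OF real_analytic_at_bilinear[OF this]]
      show "circle_analytic (\<lambda>(u, v). k (u, \<epsilon>) (v, \<delta>))"
        by (simp add: k_def case_prod_beta' C_simps)
    qed
    show "k p q + k (p \<star> q) r = k q r + k p (q \<star> r)" if "p \<in> S" "q \<in> S" "r \<in> S" for p q r
      using that by (auto simp: k_def C_simps circle_of_add circle_of_diff circle_of_minus)
    show "0 + 0 + k (m, 1) (n, 1) = 0" if "m \<in> L" "n \<in> L" for m n
      using C(3)[OF that] by (simp add: k_def circle_of_Ints)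
    show "0 + circle_of (J (f m) (fst (affine_sd f 0 (y, \<epsilon>)))) + k (m, 1) (y, \<epsilon>) =
        0 + circle_of (J m y) + k (y, \<epsilon>) (of_int \<epsilon> *\<^sub>R m, 1)"
      if "m \<in> L" "\<epsilon> \<in> {1, -1}" for m y \<epsilon>
    proof -
      have "J (f m) (f y) - C m y = J m y - C y m"
        using C(2)[of m y] by (simp add: A_def algebra_simps)
      then have "circle_of (J (f m) (f y)) - circle_of (C m y) = circle_of (J m y) - circle_of (C y m)"
        by (simp flip: circle_of_diff)
      then show ?thesis using that(2) by (auto simp: k_def affine_sd_def C_simps circle_of_minus)
    qed
  qed simp
  from weak_map_in_W[OF this] have "weak_map L f 0 (\<lambda>_. 0) k \<in> carrier W" .
  moreover have "lattice_part (weak_map L f 0 (\<lambda>_. 0) k) = g"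
    unfolding lattice_part_weak_map by (rule extensionalityI[OF _ ext]) (auto simp: f)
  ultimately show ?thesis by blast
qed

text \<open>By \<open>Ad_plus_bd\<close> the class of \<open>Ad_plus\<close> is constant on a coset
  of the lattice, so the set inside \<open>the_elem\<close> is a singleton.\<close>

lemma pi0_Ad_plus_coset:
  assumes x: "x \<in> S"
  shows "pi0_Ad_plus \<Theta> ((bd \<Theta> ` carrier (G1 \<Theta>)) #>\<^bsub>G0 \<Theta>\<^esub> x) = delta_image #>\<^bsub>W\<^esub> Ad_plus \<Theta> x"
proof -
  have coset: "(bd \<Theta> ` carrier (G1 \<Theta>)) #>\<^bsub>G0 \<Theta>\<^esub> x = (\<lambda>m. (m, 1) \<star> x) ` L"
    by (auto simp: r_coset_def mult_G0_Theta')
  have sub: "subgroup delta_image W" by (rule delta_image_subgroup)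
  have "delta_image #>\<^bsub>W\<^esub> Ad_plus \<Theta> ((m, 1) \<star> x) = delta_image #>\<^bsub>W\<^esub> Ad_plus \<Theta> x" if m: "m \<in> L" for m
  proof -
    have mS: "(m, 1) \<in> S" by simp
    have "delta_image #>\<^bsub>W\<^esub> Ad_plus \<Theta> ((m, 1) \<star> x) =
        (delta_image #>\<^bsub>W\<^esub> Ad_plus \<Theta> (m, 1)) #>\<^bsub>W\<^esub> Ad_plus \<Theta> x"
      unfolding Ad_plus_mult[OF mS x]
      by (rule W.coset_mult_assoc[symmetric, OF delta_image_subset Ad_plus_mem[OF mS] Ad_plus_mem[OF x]])
    also have "delta_image #>\<^bsub>W\<^esub> Ad_plus \<Theta> (m, 1) = delta_image"
      by (rule W.coset_join2[OF Ad_plus_mem[OF mS] sub Ad_plus_bd[OF m]])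
    finally show ?thesis .
  qed
  then have "(\<lambda>m. delta_image #>\<^bsub>W\<^esub> Ad_plus \<Theta> ((m, 1) \<star> x)) ` L =
      (\<lambda>m. delta_image #>\<^bsub>W\<^esub> Ad_plus \<Theta> x) ` L"
    by (rule image_cong[OF refl])
  then have "(\<lambda>y. delta_image #>\<^bsub>W\<^esub> Ad_plus \<Theta> y) ` ((\<lambda>m. (m, 1) \<star> x) ` L) =
      {delta_image #>\<^bsub>W\<^esub> Ad_plus \<Theta> x}"
    unfolding image_image by (simp only: image_constant[OF L_0])
  then show ?thesis
    unfolding pi0_Ad_plus_def wAct_delta_image coset by simp
qed

lemma pi0_Ad_plus_image:
  "pi0_Ad_plus \<Theta> ` carrier (xmod_pi0 \<Theta>) = (\<lambda>x. delta_image #>\<^bsub>W\<^esub> Ad_plus \<Theta> x) ` S"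
  unfolding xmod_pi0_def cokernel_def carrier_FactGroup image_image
  by (rule image_cong) (auto simp: pi0_Ad_plus_coset simp del: Theta'_simps(4))

end

section \<open>The kernel and the isomorphism\<close>

context unimodular_theta_data begin

interpretation W: group W by (rule group_W)
interpretation OG: group OG by (rule group_OG)

lemma lattice_part_kernel:
  assumes F: "F \<in> carrier W"
  shows "lattice_part F \<in> plus_minus \<longleftrightarrow> (\<exists>n\<in>delta_image. \<exists>p\<in>S. F = n \<cdot> Ad_plus \<Theta> p)"
proof
  obtain g v \<phi> k where d: "weak_data g v \<phi> k" and F': "F = weak_map L g v \<phi> k" using F by (rule W_E)
  note D = weak_dataD[OF d]
  assume "lattice_part F \<in> plus_minus"
  then consider "(\<lambda>m\<in>L. g m) = (\<lambda>m\<in>L. m)" | "(\<lambda>m\<in>L. g m) = (\<lambda>m\<in>L. - m)"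
    unfolding F' lattice_part_weak_map plus_minus_def by blast
  then have "g = (\<lambda>x. x) \<or> g = (\<lambda>x. - x)"
  proof cases
    case 1
    have "g x = x" for x
      by (rule linear_eq_on_lattice[OF L D(1)]) (use 1 in \<open>auto simp: linear_iff dest: fun_cong split: if_splits\<close>)
    then show ?thesis by blast
  next
    case 2
    have "g x = - x" for x
      by (rule linear_eq_on_lattice[OF L D(1)]) (use 2 in \<open>auto simp: linear_iff dest: fun_cong split: if_splits\<close>)
    then show ?thesis by blast
  qed
  then show "\<exists>n\<in>delta_image. \<exists>p\<in>S. F = n \<cdot> Ad_plus \<Theta> p"
    unfolding F' by (rule W_kernel[OF d])
next
  assume "\<exists>n\<in>delta_image. \<exists>p\<in>S. F = n \<cdot> Ad_plus \<Theta> p"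
  then obtain n p where n: "n \<in> delta_image" and p: "p \<in> S" and F': "F = n \<cdot> Ad_plus \<Theta> p" by blast
  have nW: "n \<in> carrier W" using n delta_image_subset by blast
  obtain w \<sigma> where p': "p = (w, \<sigma>)" "\<sigma> = 1 \<or> \<sigma> = -1" using p by (cases p) auto
  have "lattice_part n = \<one>\<^bsub>OG\<^esub>"
    using n by (auto simp: delta_image_def delta_map_def lattice_part_weak_map OG_one)
  moreover have "lattice_part (Ad_plus \<Theta> p) \<in> plus_minus"
    unfolding p'(1) Ad_plus_weak_map[OF p'(2)] lattice_part_weak_map
    using p'(2) by (auto simp: plus_minus_def)
  moreover have "lattice_part (Ad_plus \<Theta> p) \<in> carrier OG"
    using lattice_part_hom Ad_plus_mem[OF p] by (auto simp: hom_def)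
  ultimately show "lattice_part F \<in> plus_minus"
    unfolding F' hom_mult[OF lattice_part_hom nW Ad_plus_mem[OF p]] by simp
qed

text \<open>\<open>pi0_Out_plus\<close> is an iterated quotient, so the first isomorphism theorem is
  applied to the map induced on \<open>W Mod delta_image\<close>; by
  \<open>lattice_part_kernel\<close> its kernel consists of the cosets of conjugations.\<close>

theorem pi0_Out_plus_iso:
  "pi0_Out_plus \<Theta> \<cong> projective_orthogonal_lattice_group L (symmetrization J)"
proof -
  let ?P = "OG Mod plus_minus"
  let ?\<rho> = "\<lambda>F. plus_minus #>\<^bsub>OG\<^esub> lattice_part F"
  interpret PM: normal plus_minus OG by (rule plus_minus_normal)
  interpret N: normal delta_image W by (rule delta_image_normal)
  have \<rho>_hom: "?\<rho> \<in> hom W ?P"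
    using hom_compose[OF lattice_part_hom PM.r_coset_hom_Mod] by (simp add: o_def)
  interpret \<rho>: group_hom W ?P ?\<rho>
    by (intro group_hom.intro group_hom_axioms.intro group_W PM.factorgroup_is_group \<rho>_hom)
  have \<rho>_one: "?\<rho> F = \<one>\<^bsub>?P\<^esub> \<longleftrightarrow> lattice_part F \<in> plus_minus" if F: "F \<in> carrier W" for F
  proof -
    have "lattice_part F \<in> carrier OG" using lattice_part_hom F by (auto simp: hom_def)
    then show ?thesis
      using OG.coset_join1[OF _ _ PM.subgroup_axioms] OG.coset_join2[OF _ PM.subgroup_axioms]
      unfolding one_FactGroup by blast
  qed
  have \<rho>_surj: "?\<rho> ` carrier W = carrier ?P"
  proof
    show "carrier ?P \<subseteq> ?\<rho> ` carrier W"
      unfolding carrier_FactGroup using lattice_part_surj by force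
  qed auto
  have "delta_image \<subseteq> kernel W ?P ?\<rho>"
  proof
    fix n assume n: "n \<in> delta_image"
    then have nW: "n \<in> carrier W" using delta_image_subset by blast
    have "lattice_part n = (\<lambda>m\<in>L. m)"
      using n by (auto simp: delta_image_def delta_map_def lattice_part_weak_map)
    then show "n \<in> kernel W ?P ?\<rho>"
      using nW \<rho>_one[OF nW] by (simp add: kernel_def plus_minus_def)
  qed
  then obtain \<rho>' where \<rho>': "\<rho>' \<in> hom (W Mod delta_image) ?P"
    "\<And>F. F \<in> carrier W \<Longrightarrow> \<rho>' (delta_image #>\<^bsub>W\<^esub> F) = ?\<rho> F"
    using \<rho>.FactGroup_universal_kernel[OF delta_image_normal] by blast
  interpret \<rho>': group_hom "W Mod delta_image" ?P \<rho>'
    by (intro group_hom.intro group_hom_axioms.intro N.factorgroup_is_group PM.factorgroup_is_group \<rho>')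
  have "\<rho>' ` carrier (W Mod delta_image) = carrier ?P"
    unfolding carrier_FactGroup[of W] image_image \<rho>_surj[symmetric]
    by (rule image_cong) (auto simp: \<rho>'(2))
  from \<rho>'.FactGroup_iso[OF this]
  have "(W Mod delta_image) Mod kernel (W Mod delta_image) ?P \<rho>' \<cong> ?P" .
  moreover have "kernel (W Mod delta_image) ?P \<rho>' = pi0_Ad_plus \<Theta> ` carrier (xmod_pi0 \<Theta>)"
    unfolding pi0_Ad_plus_image
  proof (intro equalityI subsetI)
    fix X assume "X \<in> kernel (W Mod delta_image) ?P \<rho>'"
    then obtain F where F: "F \<in> carrier W" "X = delta_image #>\<^bsub>W\<^esub> F" "?\<rho> F = \<one>\<^bsub>?P\<^esub>"
      using \<rho>'(2) unfolding kernel_def carrier_FactGroup by force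
    then obtain n p where n: "n \<in> delta_image" and p: "p \<in> S" and F': "F = n \<cdot> Ad_plus \<Theta> p"
      using \<rho>_one lattice_part_kernel by blast
    have nW: "n \<in> carrier W" using n delta_image_subset by blast
    have "X = (delta_image #>\<^bsub>W\<^esub> n) #>\<^bsub>W\<^esub> Ad_plus \<Theta> p"
      unfolding F(2) F'
      by (rule W.coset_mult_assoc[symmetric, OF delta_image_subset nW Ad_plus_mem[OF p]])
    then have "X = delta_image #>\<^bsub>W\<^esub> Ad_plus \<Theta> p"
      using W.coset_join2[OF nW delta_image_subgroup n] by simp
    then show "X \<in> (\<lambda>x. delta_image #>\<^bsub>W\<^esub> Ad_plus \<Theta> x) ` S" using p by blast
  next
    fix X assume "X \<in> (\<lambda>x. delta_image #>\<^bsub>W\<^esub> Ad_plus \<Theta> x) ` S"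
    then obtain p where p: "p \<in> S" "X = delta_image #>\<^bsub>W\<^esub> Ad_plus \<Theta> p" by blast
    have one: "\<one>\<^bsub>W\<^esub> \<in> delta_image" by (rule subgroup.one_closed[OF delta_image_subgroup])
    have "Ad_plus \<Theta> p = \<one>\<^bsub>W\<^esub> \<cdot> Ad_plus \<Theta> p" using Ad_plus_mem[OF p(1)] by simp
    then have "lattice_part (Ad_plus \<Theta> p) \<in> plus_minus"
      using lattice_part_kernel[OF Ad_plus_mem[OF p(1)]] p(1) one by blast
    then have "\<rho>' X = \<one>\<^bsub>?P\<^esub>"
      using \<rho>'(2)[OF Ad_plus_mem[OF p(1)]] \<rho>_one[OF Ad_plus_mem[OF p(1)]] p(2) by simp
    then show "X \<in> kernel (W Mod delta_image) ?P \<rho>'"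
      using p Ad_plus_mem[OF p(1)] by (auto simp: kernel_def carrier_FactGroup)
  qed
  ultimately show ?thesis
    by (simp add: pi0_Out_plus_def pi0_Aut_plus_def cokernel_def wAct_delta_image
        projective_orthogonal_lattice_group_def plus_minus_def)
qed

end

theorem corollary6p5:
  fixes L :: "'t::real_normed_vector set"
    and J :: "'t \<Rightarrow> 't \<Rightarrow> real"
  assumes "full_lattice L"
    and "bilinear J"
    and "\<And>m n. m \<in> L \<Longrightarrow> n \<in> L \<Longrightarrow> J m n \<in> \<int>"
    and "(\<lambda>m. \<lambda>n\<in>L. symmetrization J m n) \<in> iso (lattice_group L) (dual_lattice_group L)"
  shows "pi0_Out_plus (Theta' L J) \<cong>
         projective_orthogonal_lattice_group L (symmetrization J)"
proof -
  interpret unimodular_theta_data L J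
  proof (unfold_locales)
    fix \<xi> :: "'t \<Rightarrow> real" assume \<xi>: "linear \<xi>" "\<And>m. m \<in> L \<Longrightarrow> \<xi> m \<in> \<int>"
    \<comment> \<open>An integral linear functional restricts to an element of the dual lattice,
      where surjectivity of the given isomorphism supplies the vector \<open>l\<close>.\<close>
    have "restrict \<xi> L \<in> carrier (dual_lattice_group L)"
      using \<xi> full_latticeD[OF assms(1)] by (auto simp: dual_lattice_group_def linear_add)
    then have "restrict \<xi> L \<in> (\<lambda>m. \<lambda>n\<in>L. symmetrization J m n) ` L"
      using assms(4) by (simp add: iso_def bij_betw_def lattice_group_def)
    then obtain l where l: "l \<in> L" "restrict \<xi> L = (\<lambda>n\<in>L. symmetrization J l n)" by blast
    then show "\<exists>l\<in>L. \<forall>m\<in>L. symmetrization J l m = \<xi> m"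
      by (metis restrict_apply')
  qed (use assms in auto)
  show ?thesis by (rule pi0_Out_plus_iso)
qed

end
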